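(* Let $n\geq3$ and let $\mathbb G=\mathrm{SO}_{2n}(\overline{\mathbb F_q})$, or $\mathbb G=\mathrm{SO}_{2n+1}(\overline{\mathbb F_q})$ with $q$ odd. Let $A\in\mathrm{GL}_n(q)\setminus Z(\mathrm{GL}_n(q))$ be a semisimple element such that $j(A)\in[\mathbb G^F,\mathbb G^F]$. If $q\in\{3,5,7\}$, assume in addition that $j(A)$ is not in the special situation $(\ast)$ of the context. Then the conjugacy class $\mathcal O_{\pi(j(A))}^{\boldsymbol G}$ collapses.
   Context: $q$ is a power of the prime $p$. Let $J_m$ be the $m\times m$ matrix with $1$'s on the antidiagonal and $0$ elsewhere. $\mathrm{SO}_{2n+1}$ ($p$ odd) is the subgroup of $\mathrm{SL}_{2n+1}$ preserving the bilinear form with matrix $J_{2n+1}$; $\mathrm{SO}_{2n}$ is the subgroup of $\mathrm{SL}_{2n}$ preserving the quadratic form $\sum_{i=1}^n x_ix_{2n-i+1}$. $F$ raises matrix entries to the $q$-th power, so $\mathbb G^F=\mathrm{SO}_{n'}(q)$ with $n'=2n$ or $2n+1$. Put $\boldsymbol G=[\mathbb G^F,\mathbb G^F]/Z([\mathbb G^F,\mathbb G^F])$ and let $\pi:[\mathbb G^F,\mathbb G^F]\to\boldsymbol G$ be the projection. With $\phi(A)=J_n\,{}^tA^{-1}J_n$, the injective homomorphism $j:\mathrm{GL}_n(q)\to\mathbb G^F$ is $j(A)=\operatorname{diag}(A,\phi(A))$ if $n'=2n$ and $j(A)=\operatorname{diag}(A,1,\phi(A))$ if $n'=2n+1$ (block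 diagonal). Special situation $(\ast)$: $n'=2n+1$, $q$ odd, and $j(A)$ is the element $\operatorname{diag}(-\mathrm{id}_n,1,-\mathrm{id}_n)$ (up to conjugation). For a finite group $G$ and $x\in G$, $\mathcal O_x^G$ is the conjugacy class of $x$ in $G$. A conjugacy class $\mathcal O$ of $G$ is: - of type C if there are $H\le G$ and $r,s\in H\cap\mathcal O$ such that $rs\ne sr$, $\mathcal O_r^H\neq\mathcal O_s^H$, $H=\langle \mathcal O_r^H,\mathcal O_s^H\rangle$, and $\min\{|\mathcal O_r^H|,|\mathcal O_s^H|\}>2$ or $\max\{|\mathcal O_r^H|,|\mathcal O_s^H|\}>4$; - of type D if there are $r,s\in\mathcal O$ with $\mathcal O_r^{\langle r,s\rangle}\ne\mathcal O_s^{\langle r,s\rangle}$ and $(rs)^2\neq(sr)^2$; - of type F if there are $r_1,r_2,r_3,r_4\in\mathcal O$ such that, with $K=\langle r_1,r_2,r_3,r_4\rangle$, for all $a\ne b$: $\mathcal O_{r_a}^K\neq\mathcal O_{r_b}^K$ and $r_ar_b\ne r_br_a$. $\mathcal O$ collapses if it is of type C, D or F. *)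

theory Defs
  imports
    "HOL-Library.Cardinality"
    "HOL-Algebra.Coset"
    "HOL-Algebra.Generated_Groups"
    "HOL-Algebra.Algebraic_Closure_Type"
    "Jordan_Normal_Form.Matrix"
    "Jordan_Normal_Form.Determinant"
begin

section \<open>Conjugacy classes and collapsing\<close>

definition group_center :: "('g, 'm) monoid_scheme \<Rightarrow> 'g set" where
  "group_center G = {z \<in> carrier G. \<forall>g \<in> carrier G. z \<otimes>\<^bsub>G\<^esub> g = g \<otimes>\<^bsub>G\<^esub> z}"

definition conj_class :: "('g, 'm) monoid_scheme \<Rightarrow> 'g \<Rightarrow> 'g set" where
  "conj_class G x = {g \<otimes>\<^bsub>G\<^esub> x \<otimes>\<^bsub>G\<^esub> inv\<^bsub>G\<^esub> g | g. g \<in> carrier G}"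

text \<open>For a subgroup \<open>H\<close> of \<open>G\<close>, the class of \<open>x\<close> under conjugation by \<open>H\<close>.\<close>

abbreviation conj_class_in :: "('g, 'm) monoid_scheme \<Rightarrow> 'g set \<Rightarrow> 'g \<Rightarrow> 'g set" where
  "conj_class_in G H x \<equiv> conj_class (G\<lparr>carrier := H\<rparr>) x"

definition type_C :: "('g, 'm) monoid_scheme \<Rightarrow> 'g set \<Rightarrow> bool" where
  "type_C G \<O> \<longleftrightarrow> (\<exists>H r s. subgroup H G \<and> r \<in> H \<inter> \<O> \<and> s \<in> H \<inter> \<O> \<and>
     r \<otimes>\<^bsub>G\<^esub> s \<noteq> s \<otimes>\<^bsub>G\<^esub> r \<and>
     conj_class_in G H r \<noteq> conj_class_in G H s \<and>
     H = generate G (conj_class_in G H r \<union> conj_class_in G H s) \<and>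
     (min (card (conj_class_in G H r)) (card (conj_class_in G H s)) > 2 \<or>
      max (card (conj_class_in G H r)) (card (conj_class_in G H s)) > 4))"

definition type_D :: "('g, 'm) monoid_scheme \<Rightarrow> 'g set \<Rightarrow> bool" where
  "type_D G \<O> \<longleftrightarrow> (\<exists>r \<in> \<O>. \<exists>s \<in> \<O>.
     conj_class_in G (generate G {r, s}) r \<noteq> conj_class_in G (generate G {r, s}) s \<and>
     (r \<otimes>\<^bsub>G\<^esub> s) [^]\<^bsub>G\<^esub> (2::nat) \<noteq> (s \<otimes>\<^bsub>G\<^esub> r) [^]\<^bsub>G\<^esub> (2::nat))"

definition type_F :: "('g, 'm) monoid_scheme \<Rightarrow> 'g set \<Rightarrow> bool" where
  "type_F G \<O> \<longleftrightarrow> (\<exists>r :: nat \<Rightarrow> 'g. r ` {1..4} \<subseteq> \<O> \<and>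
     (\<forall>a \<in> {1..4}. \<forall>b \<in> {1..4}. a \<noteq> b \<longrightarrow>
        conj_class_in G (generate G (r ` {1..4})) (r a) \<noteq>
          conj_class_in G (generate G (r ` {1..4})) (r b) \<and>
        r a \<otimes>\<^bsub>G\<^esub> r b \<noteq> r b \<otimes>\<^bsub>G\<^esub> r a))"

definition collapses :: "('g, 'm) monoid_scheme \<Rightarrow> 'g set \<Rightarrow> bool" where
  "collapses G \<O> \<longleftrightarrow> type_C G \<O> \<or> type_D G \<O> \<or> type_F G \<O>"


section \<open>Matrix groups\<close>

definition GL :: "nat \<Rightarrow> 'k::field mat monoid" where
  "GL n = units_of (ring_mat TYPE('k) n ())"

definition SL :: "nat \<Rightarrow> 'k::field mat monoid" where
  "SL n = (GL n)\<lparr>carrier := {g \<in> carrier (GL n). det g = 1}\<rparr>"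

definition J_mat :: "nat \<Rightarrow> 'k::field mat" where
  "J_mat m = mat m m (\<lambda>(i, k). if i + k + 1 = m then 1 else 0)"

definition J_bilinear :: "nat \<Rightarrow> 'k::field vec \<Rightarrow> 'k vec \<Rightarrow> 'k" where
  "J_bilinear m v w = v \<bullet> (J_mat m *\<^sub>v w)"

text \<open>For \<open>m = 2n\<close> this is \<open>x\<^sub>1 x\<^bsub>2n\<^esub> + \<dots> + x\<^sub>n x\<^bsub>n+1\<^esub>\<close>; vector indices start at \<open>0\<close> here.\<close>

definition hyp_quadratic :: "nat \<Rightarrow> 'k::field vec \<Rightarrow> 'k" where
  "hyp_quadratic m v = (\<Sum>i < m div 2. v $ i * v $ (m - 1 - i))"

text \<open>For even \<open>m\<close> the quadratic form is used, not its polarization: the two differ in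
  characteristic 2, where this group is the full orthogonal group. The odd case is only meant for
  characteristic different from 2.\<close>

definition SO :: "nat \<Rightarrow> 'k::field mat monoid" where
  "SO m = (SL m)\<lparr>carrier := {g \<in> carrier (SL m).
     if even m
     then \<forall>v \<in> carrier_vec m. hyp_quadratic m (g *\<^sub>v v) = hyp_quadratic m v
     else \<forall>v \<in> carrier_vec m. \<forall>w \<in> carrier_vec m.
            J_bilinear m (g *\<^sub>v v) (g *\<^sub>v w) = J_bilinear m v w}\<rparr>"

definition frobenius :: "nat \<Rightarrow> 'k::field mat \<Rightarrow> 'k mat" where
  "frobenius q = map_mat (\<lambda>x. x ^ q)"

text \<open>Over an algebraic closure of the field with \<open>q\<close> elements, that field is the set of solutions
  of \<open>x\<^sup>q = x\<close>, so \<open>GL_q q n\<close> and \<open>SO_q q m\<close> below are the groups of matrices with entries in it.\<close>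

definition fixed_points :: "('g, 'm) monoid_scheme \<Rightarrow> ('g \<Rightarrow> 'g) \<Rightarrow> ('g, 'm) monoid_scheme" where
  "fixed_points G f = G\<lparr>carrier := {x \<in> carrier G. f x = x}\<rparr>"

definition GL_q :: "nat \<Rightarrow> nat \<Rightarrow> 'k::field mat monoid" where
  "GL_q q n = fixed_points (GL n) (frobenius q)"

definition SO_q :: "nat \<Rightarrow> nat \<Rightarrow> 'k::field mat monoid" where
  "SO_q q m = fixed_points (SO m) (frobenius q)"

definition semisimple_mat :: "'k::alg_closed_field mat \<Rightarrow> bool" where
  "semisimple_mat A \<longleftrightarrow> (\<exists>D. diagonal_mat D \<and> similar_mat A D)"


section \<open>The simple quotient and the embedding of the general linear group\<close>

definition SO_derived :: "nat \<Rightarrow> nat \<Rightarrow> 'k::field mat monoid" where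
  "SO_derived q m = (SO_q q m)\<lparr>carrier := derived (SO_q q m) (carrier (SO_q q m))\<rparr>"

definition PSO_derived :: "nat \<Rightarrow> nat \<Rightarrow> 'k::field mat set monoid" where
  "PSO_derived q m = SO_derived q m Mod group_center (SO_derived q m)"

definition proj :: "nat \<Rightarrow> nat \<Rightarrow> 'k::field mat \<Rightarrow> 'k mat set" where
  "proj q m x = group_center (SO_derived q m) #>\<^bsub>SO_derived q m\<^esub> x"

definition phi :: "nat \<Rightarrow> 'k::field mat \<Rightarrow> 'k mat" where
  "phi n A = J_mat n * transpose_mat (inv\<^bsub>GL n\<^esub> A) * J_mat n"

definition j_emb :: "nat \<Rightarrow> nat \<Rightarrow> 'k::field mat \<Rightarrow> 'k mat" where
  "j_emb n m A =
     (if m = 2 * n then diag_block_mat [A, phi n A] else diag_block_mat [A, 1\<^sub>m 1, phi n A])"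

definition special_situation :: "nat \<Rightarrow> nat \<Rightarrow> nat \<Rightarrow> 'k::field mat \<Rightarrow> bool" where
  "special_situation q n m A \<longleftrightarrow> m = 2 * n + 1 \<and> odd q \<and>
     j_emb n m A \<in> conj_class (SO_q q m) (diag_block_mat [- (1\<^sub>m n), 1\<^sub>m 1, - (1\<^sub>m n)])"

end

theory Submission
  imports Defs
begin

text \<open>
  The class is of type C. Put \<open>r = j(A)\<close>. One looks for a conjugate \<open>s\<close> of \<open>r\<close> such that, modulo the
  center, \<open>r\<close> and \<open>s r s\<^sup>-\<^sup>1\<close> do not commute, \<open>s\<close> and \<open>r s r\<^sup>-\<^sup>1\<close> do not commute, and \<open>r\<close>, \<open>s\<close> are not
  conjugate in \<open>\<langle>r, s\<rangle>\<close>; then \<open>H = \<langle>r, s\<rangle>\<close> works. The center consists of \<open>1\<close> and at most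
  \<open>diag(-1, -1)\<close> or \<open>diag(-1, 1, -1)\<close>. Non-conjugacy is seen on a subspace stable under \<open>r\<close> and \<open>s\<close> on which
  these act by matrices \<open>B\<close> and \<open>B'\<close> that commute up to sign: all \<open>\<langle>r, s\<rangle>\<close>-conjugates of \<open>r\<close> act there
  by \<open>B\<close> or \<open>-B\<close>, while \<open>B'\<close> is neither. Non-commutation is seen on a two-dimensional subquotient
  on which \<open>r\<close> is diagonal and \<open>s\<close> is upper triangular.

  If all eigenvalues of \<open>A\<close> lie in \<open>F\<^sub>q\<close>, there are two distinct ones, and such an \<open>s\<close> exists in the
  image of \<open>j\<close>. Otherwise some eigenvalue \<open>\<alpha>\<close> lies outside \<open>F\<^sub>q\<close>. The Frobenius map
  permutes a suitable family of eigenvectors of \<open>A\<close>; shifting the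
  eigenvalues along an orbit gives a rational conjugate \<open>A'\<close> of \<open>A\<close> commuting with \<open>A\<close>, and \<open>s\<close> is
  \<open>j(A')\<close> conjugated by a root element of the unipotent radical of the Siegel parabolic. The shift
  uses one orbit, or two orbits of length two if \<open>\<alpha>, \<alpha>\<^sup>q = \<alpha>\<^sup>-\<^sup>1\<close> are the only eigenvalues. This leaves
  \<open>n = 4\<close>, \<open>\<alpha>\<^sup>2 = -1\<close>, where \<open>s\<close> is again found in the image of \<open>j\<close>, with \<open>B\<close> and \<open>B'\<close>
  generating a quaternion group.
\<close>

section \<open>Classes of type C\<close>

text \<open>The center can only change signs, and this shapes the argument: conjugacy has to be
  excluded up to a factor -1, whereas non-commutation is first proved for matrices. To pass to the
  quotient one uses that, on the chosen subspace, \<open>r\<close> acts by B and its conjugate by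
  \<open>s\<close> acts by B or -B; they commute there, so a central factor between the two products
  must be 1. Conjugating elements have to lie in the derived group, which is a spinor norm
  condition. It is met by using only root elements, which are commutators because n \<ge> 3, and
  images of SL_n(q), which is generated by transvections. A conjugating element of another
  determinant is corrected inside the centralizer of A. A Siegel root element links an eigenvalue a
  of A with the inverse 1/b of the eigenvalue of a second eigenvector, and it is useful only if ab
  \<noteq> 1. The pair \<alpha>, \<alpha>^-1 fails this test, which is why two orbits are taken. If
  they fill the space and \<alpha>^2 = -1, the shift turns A into -A, so the sign ambiguity remains
  and another conjugate is needed.\<close>

lemma (in group) conj_class_in_generate:
  assumes "K \<subseteq> carrier G" "x \<in> carrier G"
  shows "conj_class_in G (generate G K) x = {g \<otimes> x \<otimes> inv g | g. g \<in> generate G K}"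
proof -
  have sub: "subgroup (generate G K) G" by (rule generate_is_subgroup[OF assms(1)])
  have "inv\<^bsub>G\<lparr>carrier := generate G K\<rparr>\<^esub> g = inv g" if "g \<in> generate G K" for g
    using m_inv_consistent[OF sub that] by simp
  then show ?thesis unfolding conj_class_def by auto metis
qed

text \<open>If x does not commute with t = y x y^-1, then x, t and x t x^-1 are three different
  conjugates of x. So \<open>c1\<close> and \<open>c2\<close> give both classes at least three
  elements, which meets the bound on the minimum; \<open>c1\<close> also gives rs \<noteq> sr, and
  \<open>nc\<close> keeps the two classes apart.\<close>

lemma (in group) type_C_criterion:
  assumes fin: "finite (carrier G)" and O: "\<O> \<subseteq> carrier G" and r: "r \<in> \<O>" and s: "s \<in> \<O>"
    and c1: "r \<otimes> (s \<otimes> r \<otimes> inv s) \<noteq> (s \<otimes> r \<otimes> inv s) \<otimes> r"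
    and c2: "s \<otimes> (r \<otimes> s \<otimes> inv r) \<noteq> (r \<otimes> s \<otimes> inv r) \<otimes> s"
    and nc: "\<And>h. h \<in> generate G {r, s} \<Longrightarrow> s \<noteq> h \<otimes> r \<otimes> inv h"
  shows "type_C G \<O>"
proof -
  define H where "H = generate G {r, s}"
  have rs: "{r, s} \<subseteq> carrier G" and rG: "r \<in> carrier G" and sG: "s \<in> carrier G" using O r s by auto
  have sub: "subgroup H G" unfolding H_def by (rule generate_is_subgroup[OF rs])
  have HG: "H \<subseteq> carrier G" using sub subgroup.subset by blast
  have rH: "r \<in> H" and sH: "s \<in> H" unfolding H_def by (auto intro: generate.incl)
  note cls = conj_class_in_generate[OF rs, folded H_def]
  have cl: "conj_class_in G H x = {g \<otimes> x \<otimes> inv g | g. g \<in> H}" if "x \<in> H" for x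
    using cls that HG by blast
  have in_H: "conj_class_in G H x \<subseteq> H" if "x \<in> H" for x
    unfolding cl[OF that] using that sub by (auto intro!: subgroup.m_closed subgroup.m_inv_closed)
  have self: "x \<in> conj_class_in G H x" if "x \<in> H" for x
    unfolding cl[OF that] using that HG subgroup.one_closed[OF sub]
    by (intro CollectI exI[of _ "\<one>"]) auto
  have conj: "g \<otimes> y \<otimes> inv g \<in> conj_class_in G H x" if x: "x \<in> H" and g: "g \<in> H" and y: "y \<in> conj_class_in G H x" for x y g
  proof -
    obtain h where h: "h \<in> H" "y = h \<otimes> x \<otimes> inv h" using x y cl by blast
    have "g \<otimes> y \<otimes> inv g = (g \<otimes> h) \<otimes> x \<otimes> inv (g \<otimes> h)"
      using h x g HG by (simp add: subsetD m_assoc inv_mult_group)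
    then show ?thesis unfolding cl[OF x] using subgroup.m_closed[OF sub g h(1)] by blast
  qed
  have card3: "card (conj_class_in G H x) > 2"
    if x: "x \<in> H" and y: "y \<in> H" and ne: "x \<otimes> (y \<otimes> x \<otimes> inv y) \<noteq> (y \<otimes> x \<otimes> inv y) \<otimes> x" for x y
  proof -
    define t where "t = y \<otimes> x \<otimes> inv y"
    define u where "u = x \<otimes> t \<otimes> inv x"
    have G: "x \<in> carrier G" "y \<in> carrier G" "t \<in> carrier G" "u \<in> carrier G"
      unfolding u_def t_def using subsetD[OF HG x] subsetD[OF HG y] by simp_all
    have "t \<in> conj_class_in G H x" "u \<in> conj_class_in G H x" "x \<in> conj_class_in G H x"
      unfolding t_def u_def using conj self x y by blast+
    moreover have "x \<noteq> t" using ne unfolding t_def[symmetric] by auto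
    moreover have "u \<noteq> t"
    proof
      assume "u = t"
      then have "u \<otimes> x = t \<otimes> x" by simp
      then show False using ne G unfolding u_def t_def[symmetric] by (simp add: m_assoc)
    qed
    moreover have "u \<noteq> x"
    proof
      assume "u = x"
      then have "u \<otimes> x = x \<otimes> x" by simp
      then have "x \<otimes> t = x \<otimes> x" using G unfolding u_def by (simp add: m_assoc)
      then have "t = x" using G by simp
      then show False using \<open>x \<noteq> t\<close> by simp
    qed
    ultimately have "{x, t, u} \<subseteq> conj_class_in G H x" "card {x, t, u} = 3" by auto
    moreover have "finite (conj_class_in G H x)"
      using in_H[OF x] HG fin by (meson finite_subset)
    ultimately show ?thesis using card_mono[of "conj_class_in G H x" "{x, t, u}"] by linarith
  qed
  have "r \<otimes> s \<noteq> s \<otimes> r" 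
  proof
    assume "r \<otimes> s = s \<otimes> r"
    then have "s \<otimes> r \<otimes> inv s = r" using rG sG by (metis inv_solve_right m_closed)
    then show False using c1 by simp
  qed
  moreover have "conj_class_in G H r \<noteq> conj_class_in G H s"
    using self[OF sH] nc unfolding cl[OF rH] H_def[symmetric] by fastforce
  moreover have "H = generate G (conj_class_in G H r \<union> conj_class_in G H s)"
  proof
    show "H \<subseteq> generate G (conj_class_in G H r \<union> conj_class_in G H s)"
      using mono_generate[of "{r, s}" "conj_class_in G H r \<union> conj_class_in G H s"] self[OF rH] self[OF sH]
      unfolding H_def[symmetric] by blast
    show "generate G (conj_class_in G H r \<union> conj_class_in G H s) \<subseteq> H"
      using generate_subgroup_incl[OF _ sub] in_H[OF rH] in_H[OF sH] by simp
  qed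
  moreover have "card (conj_class_in G H r) > 2" by (rule card3[OF rH sH c1])
  moreover have "card (conj_class_in G H s) > 2" by (rule card3[OF sH rH c2])
  ultimately show ?thesis unfolding type_C_def using sub rH sH r s
    by (intro exI[of _ H] exI[of _ r] exI[of _ s]) auto
qed

text \<open>The subgroup generated by the images of r and s is the image of the subgroup generated
  by r and s, so every condition can be tested on elements upstairs. The homomorphism in question
  will be the projection modulo the center.\<close>

lemma (in group_hom) type_C_image_criterion:
  assumes fin: "finite (carrier H)" and r: "r \<in> carrier G" and x: "x \<in> carrier G"
    and s: "s = x \<otimes>\<^bsub>G\<^esub> r \<otimes>\<^bsub>G\<^esub> inv\<^bsub>G\<^esub> x"
    and c1: "h (r \<otimes>\<^bsub>G\<^esub> (s \<otimes>\<^bsub>G\<^esub> r \<otimes>\<^bsub>G\<^esub> inv\<^bsub>G\<^esub> s)) \<noteq> h ((s \<otimes>\<^bsub>G\<^esub> r \<otimes>\<^bsub>G\<^esub> inv\<^bsub>G\<^esub> s) \<otimes>\<^bsub>G\<^esub> r)"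
    and c2: "h (s \<otimes>\<^bsub>G\<^esub> (r \<otimes>\<^bsub>G\<^esub> s \<otimes>\<^bsub>G\<^esub> inv\<^bsub>G\<^esub> r)) \<noteq> h ((r \<otimes>\<^bsub>G\<^esub> s \<otimes>\<^bsub>G\<^esub> inv\<^bsub>G\<^esub> r) \<otimes>\<^bsub>G\<^esub> s)"
    and nc: "\<And>g. g \<in> generate G {r, s} \<Longrightarrow> h s \<noteq> h (g \<otimes>\<^bsub>G\<^esub> r \<otimes>\<^bsub>G\<^esub> inv\<^bsub>G\<^esub> g)"
  shows "type_C H (conj_class H (h r))"
proof (rule H.type_C_criterion[OF fin])
  have sG: "s \<in> carrier G" using r x unfolding s by simp
  show "conj_class H (h r) \<subseteq> carrier H" unfolding conj_class_def using r by auto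
  show "h r \<in> conj_class H (h r)" unfolding conj_class_def using r
    by (intro CollectI exI[of _ "\<one>\<^bsub>H\<^esub>"]) simp
  show "h s \<in> conj_class H (h r)" unfolding conj_class_def s using r x
    by (intro CollectI exI[of _ "h x"]) simp
  show "h r \<otimes>\<^bsub>H\<^esub> (h s \<otimes>\<^bsub>H\<^esub> h r \<otimes>\<^bsub>H\<^esub> inv\<^bsub>H\<^esub> h s) \<noteq> h s \<otimes>\<^bsub>H\<^esub> h r \<otimes>\<^bsub>H\<^esub> inv\<^bsub>H\<^esub> h s \<otimes>\<^bsub>H\<^esub> h r"
    using c1 r sG by simp
  show "h s \<otimes>\<^bsub>H\<^esub> (h r \<otimes>\<^bsub>H\<^esub> h s \<otimes>\<^bsub>H\<^esub> inv\<^bsub>H\<^esub> h r) \<noteq> h r \<otimes>\<^bsub>H\<^esub> h s \<otimes>\<^bsub>H\<^esub> inv\<^bsub>H\<^esub> h r \<otimes>\<^bsub>H\<^esub> h s"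
    using c2 r sG by simp
  fix k assume "k \<in> generate H {h r, h s}"
  then have "k \<in> h ` generate G {r, s}" using generate_img[of "{r, s}"] r sG by simp
  then obtain g where g: "g \<in> generate G {r, s}" "k = h g" by blast
  have "g \<in> carrier G" using g(1) G.generate_in_carrier[of "{r, s}"] r sG by simp
  then show "h s \<noteq> k \<otimes>\<^bsub>H\<^esub> h r \<otimes>\<^bsub>H\<^esub> inv\<^bsub>H\<^esub> k" using nc[OF g(1)] r unfolding g(2) by simp
qed

lemma (in group) group_center_normal: "group_center G \<lhd> G"
proof -
  have "subgroup (group_center G) G"
  proof
    show "group_center G \<subseteq> carrier G" "\<one> \<in> group_center G" unfolding group_center_def by auto
    fix x assume x: "x \<in> group_center G"
    then have xG: "x \<in> carrier G" unfolding group_center_def by simp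
    have "inv x \<otimes> g = g \<otimes> inv x" if g: "g \<in> carrier G" for g
    proof -
      have "x \<otimes> g = g \<otimes> x" using x g unfolding group_center_def by simp
      then show ?thesis using xG g by (metis inv_closed inv_solve_left inv_solve_right m_assoc m_closed)
    qed
    then show "inv x \<in> group_center G" using xG unfolding group_center_def by simp
    fix y assume y: "y \<in> group_center G"
    then have yG: "y \<in> carrier G" unfolding group_center_def by simp
    have "x \<otimes> y \<otimes> g = g \<otimes> (x \<otimes> y)" if g: "g \<in> carrier G" for g
    proof -
      have "x \<otimes> g = g \<otimes> x" "y \<otimes> g = g \<otimes> y" using x y g unfolding group_center_def by simp_all
      then show ?thesis using xG yG g by (metis m_assoc)
    qed
    then show "x \<otimes> y \<in> group_center G" using xG yG unfolding group_center_def by simp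
  qed
  moreover have "g \<otimes> z \<otimes> inv g = z" if "g \<in> carrier G" "z \<in> group_center G" for g z
  proof -
    have z: "z \<in> carrier G" "z \<otimes> g = g \<otimes> z" using that unfolding group_center_def by auto
    then have "g \<otimes> z \<otimes> inv g = z \<otimes> g \<otimes> inv g" by simp
    also have "\<dots> = z \<otimes> (g \<otimes> inv g)" using z(1) that(1) by (intro m_assoc) auto
    also have "\<dots> = z" using z(1) that(1) by simp
    finally show ?thesis .
  qed
  ultimately show ?thesis unfolding normal_inv_iff by simp
qed

lemma (in group) quotient_center_hom: "group_hom G (G Mod group_center G) (\<lambda>a. group_center G #> a)"
proof -
  interpret normal "group_center G" G by (rule group_center_normal)
  show ?thesis
    using is_group factorgroup_is_group r_coset_hom_Mod unfolding group_hom_def group_hom_axioms_def by simp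
qed

lemma (in group) center_coset_eqD:
  assumes "group_center G #> a = group_center G #> b" "a \<in> carrier G" "b \<in> carrier G"
  obtains z where "z \<in> group_center G" "a = z \<otimes> b"
proof -
  interpret normal "group_center G" G by (rule group_center_normal)
  have "a \<in> group_center G #> a" by (rule rcos_self[OF assms(2) is_subgroup])
  then have "a \<in> group_center G #> b" by (simp only: assms(1))
  then show thesis using that unfolding r_coset_def by blast
qed

section \<open>Matrices with entries in a finite field\<close>

lemma mult_mat_assoc:
  fixes A :: "'k::semiring_0 mat"
  assumes "dim_col A = dim_row B" "dim_col B = dim_row C"
  shows "(A * B) * C = A * (B * C)"
  by (rule assoc_mult_mat[of _ "dim_row A" "dim_col A" _ "dim_col B" _ "dim_col C"]) (use assms in auto)

lemma mult_mat_unit_left: "n = dim_row A \<Longrightarrow> 1\<^sub>m n * A = (A :: 'k::semiring_1 mat)"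
  by (rule left_mult_one_mat[of _ _ "dim_col A"]) auto

lemma mult_mat_unit_right: "n = dim_col A \<Longrightarrow> A * 1\<^sub>m n = (A :: 'k::semiring_1 mat)"
  by (rule right_mult_one_mat[of _ "dim_row A"]) auto

lemma mult_mat_add_right:
  fixes A :: "'k::semiring_0 mat"
  assumes "dim_col A = dim_row B" "dim_row B = dim_row C" "dim_col B = dim_col C"
  shows "A * (B + C) = A * B + A * C"
  by (rule mult_add_distrib_mat[of _ "dim_row A" "dim_col A" _ "dim_col B"]) (use assms in auto)

lemma mult_mat_add_left:
  fixes A :: "'k::semiring_0 mat"
  assumes "dim_col A = dim_row C" "dim_row A = dim_row B" "dim_col A = dim_col B"
  shows "(A + B) * C = A * C + B * C"
  by (rule add_mult_distrib_mat[of _ "dim_row A" "dim_col A" _ _ "dim_col C"]) (use assms in auto)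

lemma mult_mat_minus_right:
  fixes A :: "'k::ring mat"
  assumes "dim_col A = dim_row B" "dim_row B = dim_row C" "dim_col B = dim_col C"
  shows "A * (B - C) = A * B - A * C"
  by (rule mult_minus_distrib_mat[of _ "dim_row A" "dim_col A" _ "dim_col B"]) (use assms in auto)

lemma mult_mat_minus_left:
  fixes A :: "'k::ring mat"
  assumes "dim_col A = dim_row C" "dim_row A = dim_row B" "dim_col A = dim_col B"
  shows "(A - B) * C = A * C - B * C"
  by (rule minus_mult_distrib_mat[of _ "dim_row A" "dim_col A" _ _ "dim_col C"]) (use assms in auto)

lemma mult_mat_uminus_right:
  "dim_col A = dim_row B \<Longrightarrow> A * (- B) = - (A * B :: 'k::ring mat)"
  by (intro eq_matI) (auto simp: scalar_prod_def sum_negf)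

lemma mult_mat_uminus_left:
  "dim_col A = dim_row B \<Longrightarrow> (- A) * B = - (A * B :: 'k::ring mat)"
  by (intro eq_matI) (auto simp: scalar_prod_def sum_negf)

text \<open>The side conditions are equations between dimensions, which the simplifier can settle.
  As rewrite rules these laws associate products to the right and expand sums.\<close>

lemmas mat_ring = mult_mat_assoc mult_mat_unit_left mult_mat_unit_right mult_mat_add_left mult_mat_add_right
  mult_mat_minus_left mult_mat_minus_right mult_mat_uminus_left mult_mat_uminus_right

lemma mat_transpose_mult: "dim_col A = dim_row B \<Longrightarrow> (A * B)\<^sup>T = B\<^sup>T * (A\<^sup>T :: 'k::comm_semiring_0 mat)"
  by (rule transpose_mult[of _ "dim_row A" "dim_col A" _ "dim_col B"]) auto

text \<open>Sylvester's determinant identity: N L = L M with L unitriangular, and the block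
  triangular matrices N and M have the two sides as determinants. It later gives the determinant of
  a matrix that differs from the identity by a product through a smaller space.\<close>

lemma det_one_plus_mult:
  fixes U W :: "'k::field mat"
  assumes U: "U \<in> carrier_mat n k" and W: "W \<in> carrier_mat k n"
  shows "det (1\<^sub>m n + U * W) = det (1\<^sub>m k + W * U)"
proof -
  define L where "L = four_block_mat (1\<^sub>m n) (0\<^sub>m n k) (- W) (1\<^sub>m k)"
  define M where "M = four_block_mat (1\<^sub>m n) U (0\<^sub>m k n) (1\<^sub>m k + W * U)"
  define N where "N = four_block_mat (1\<^sub>m n + U * W) U (0\<^sub>m k n) (1\<^sub>m k)"
  have [simp]: "dim_row U = n" "dim_col U = k" "dim_row W = k" "dim_col W = n" using U W by auto
  have mW: "- W \<in> carrier_mat k n" using W by simp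
  have c: "1\<^sub>m k + W * U \<in> carrier_mat k k" "1\<^sub>m n + U * W \<in> carrier_mat n n" using U W by auto
  have "L * M = four_block_mat (1\<^sub>m n * 1\<^sub>m n + 0\<^sub>m n k * 0\<^sub>m k n) (1\<^sub>m n * U + 0\<^sub>m n k * (1\<^sub>m k + W * U))
      (- W * 1\<^sub>m n + 1\<^sub>m k * 0\<^sub>m k n) (- W * U + 1\<^sub>m k * (1\<^sub>m k + W * U))"
    unfolding L_def M_def by (rule mult_four_block_mat[OF _ _ mW _ _ U _ c(1)]) auto
  also have "\<dots> = four_block_mat (1\<^sub>m n) U (- W) (1\<^sub>m k)"
    by (rule arg_cong4[where f = four_block_mat]) (auto simp: mat_ring)
  finally have LM: "L * M = four_block_mat (1\<^sub>m n) U (- W) (1\<^sub>m k)" .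
  have "N * L = four_block_mat ((1\<^sub>m n + U * W) * 1\<^sub>m n + U * (- W)) ((1\<^sub>m n + U * W) * 0\<^sub>m n k + U * 1\<^sub>m k)
      (0\<^sub>m k n * 1\<^sub>m n + 1\<^sub>m k * (- W)) (0\<^sub>m k n * 0\<^sub>m n k + 1\<^sub>m k * 1\<^sub>m k)"
    unfolding L_def N_def by (rule mult_four_block_mat[OF c(2) U _ _ _ _ mW]) auto
  also have "\<dots> = four_block_mat (1\<^sub>m n) U (- W) (1\<^sub>m k)"
    by (rule arg_cong4[where f = four_block_mat]) (auto simp: mat_ring)
  finally have NL: "N * L = L * M" unfolding LM .
  have carr: "L \<in> carrier_mat (n + k) (n + k)" "M \<in> carrier_mat (n + k) (n + k)" "N \<in> carrier_mat (n + k) (n + k)"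
    unfolding L_def M_def N_def by auto
  have "det L = 1" unfolding L_def
    by (subst det_four_block_mat_upper_right_zero[of _ n _ k]) (use mW in auto)
  moreover have "det M = det (1\<^sub>m k + W * U)" unfolding M_def
    by (subst det_four_block_mat_lower_left_zero[of _ n _ k]) (use U c in auto)
  moreover have "det N = det (1\<^sub>m n + U * W)" unfolding N_def
    by (subst det_four_block_mat_lower_left_zero[of _ n _ k]) (use U c in auto)
  moreover have "det N * det L = det L * det M"
    unfolding det_mult[OF carr(3,1), symmetric] det_mult[OF carr(1,2), symmetric] NL ..
  ultimately show ?thesis by simp
qed

text \<open>Additivity of x \<mapsto> x^q carries the arithmetic of the situation: the field with q
  elements is the set of fixed points of this map in the algebraically closed field, and matrices
  over it are those fixed entrywise.\<close>

locale frobenius_field =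
  fixes q :: nat and field_type :: "'k::alg_closed_field itself"
  assumes q_gt_1: "q > 1" and add_power_q: "\<And>x y :: 'k. (x + y) ^ q = x ^ q + y ^ q"
begin

lemma power_q_hom: "comm_ring_hom (\<lambda>x::'k. x ^ (q ^ i))"
proof
  fix x y :: 'k
  show "(x + y) ^ q ^ i = x ^ q ^ i + y ^ q ^ i"
    by (induction i) (simp_all add: power_mult add_power_q power_Suc2 del: power_Suc)
  show "(0::'k) ^ q ^ i = 0" "(1::'k) ^ q ^ i = 1" using q_gt_1 by simp_all
  show "(x * y) ^ q ^ i = x ^ q ^ i * y ^ q ^ i" by (rule power_mult_distrib)
qed

sublocale frob: comm_ring_hom "\<lambda>x::'k. x ^ q" using power_q_hom[of 1] by simp

lemma power_q_inject [simp]: "x ^ q ^ i = y ^ q ^ i \<longleftrightarrow> x = (y::'k)"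
proof
  assume eq: "x ^ q ^ i = y ^ q ^ i"
  interpret comm_ring_hom "\<lambda>x::'k. x ^ (q ^ i)" by (rule power_q_hom)
  have "(x - y) ^ q ^ i = 0" using eq by (simp add: hom_minus)
  then show "x = y" by simp
qed simp

definition rational :: "'k mat \<Rightarrow> bool" where
  "rational A \<longleftrightarrow> (\<forall>i<dim_row A. \<forall>j<dim_col A. (A $$ (i, j)) ^ q = A $$ (i, j))"

lemma rational_frobenius: "rational A \<longleftrightarrow> frobenius q A = A"
  unfolding rational_def frobenius_def mat_eq_iff by auto

lemma rationalD: "rational A \<Longrightarrow> i < dim_row A \<Longrightarrow> j < dim_col A \<Longrightarrow> (A $$ (i, j)) ^ q = A $$ (i, j)"
  unfolding rational_def by blast

lemma frobenius_mult: "dim_col A = dim_row B \<Longrightarrow> frobenius q (A * B) = frobenius q A * (frobenius q B :: 'k mat)"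
  unfolding frobenius_def by (rule frob.mat_hom_mult[of _ "dim_row A" "dim_col A" _ "dim_col B"]) auto

lemma rational_mult: "rational A \<Longrightarrow> rational B \<Longrightarrow> dim_col A = dim_row B \<Longrightarrow> rational (A * B)"
  unfolding rational_frobenius by (simp add: frobenius_mult)

lemma rational_one: "rational (1\<^sub>m n)"
  using q_gt_1 unfolding rational_def by auto

lemma rational_det: "rational A \<Longrightarrow> det A ^ q = det A"
  unfolding rational_frobenius frobenius_def using frob.hom_det[of A] by simp

text \<open>The Frobenius image of B is also a right inverse of A, hence equal to B.\<close>

lemma rational_inverse:
  assumes A: "A \<in> carrier_mat n n" and B: "B \<in> carrier_mat n n" and AB: "A * B = 1\<^sub>m n" and r: "rational A"
  shows "rational B"
proof -
  have [simp]: "dim_row A = n" "dim_col A = n" "dim_row B = n" "dim_col B = n" using A B by auto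
  have [simp]: "dim_row (frobenius q B) = n" "dim_col (frobenius q B) = n" unfolding frobenius_def by auto
  have BA: "B * A = 1\<^sub>m n" by (rule mat_mult_left_right_inverse[OF A B AB])
  have "A * frobenius q B = frobenius q (A * B)" using r by (simp add: frobenius_mult rational_frobenius)
  also have "\<dots> = 1\<^sub>m n" unfolding AB using rational_one rational_frobenius by blast
  finally have "B * (A * frobenius q B) = B * 1\<^sub>m n" by simp
  then have "(B * A) * frobenius q B = B" by (simp add: mat_ring)
  then show ?thesis unfolding rational_frobenius BA by (simp add: mat_ring)
qed

lemma finite_rational: "finite {x::'k. x ^ q = x}"
proof -
  let ?p = "monom 1 q - monom 1 1 :: 'k poly"
  have "coeff ?p q = 1" using q_gt_1 by simp
  then have "?p \<noteq> 0" by (metis coeff_0 zero_neq_one)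
  then have "finite {x. poly ?p x = 0}" by (rule poly_roots_finite)
  then show ?thesis by (simp add: poly_monom)
qed

lemma finite_rational_mat: "finite {A \<in> carrier_mat n m. rational A}"
proof -
  let ?F = "{x::'k. x ^ q = x}"
  let ?D = "{..<n} \<times> {..<m}"
  have "{A \<in> carrier_mat n m. rational A} \<subseteq> (\<lambda>f. mat n m f) ` (?D \<rightarrow>\<^sub>E ?F)"
  proof
    fix A assume A: "A \<in> {A \<in> carrier_mat n m. rational A}"
    then have "A = mat n m (\<lambda>p\<in>?D. A $$ p)" by (intro eq_matI) auto
    moreover have "(\<lambda>p\<in>?D. A $$ p) \<in> ?D \<rightarrow>\<^sub>E ?F" using A rationalD[of A] by (auto split: if_split_asm)
    ultimately show "A \<in> (\<lambda>f. mat n m f) ` (?D \<rightarrow>\<^sub>E ?F)" by blast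
  qed
  then show ?thesis by (rule finite_subset) (intro finite_imageI finite_PiE finite_rational; simp)
qed

lemma rational_addrow_mat: "t ^ q = t \<Longrightarrow> rational (addrow_mat n t i j)"
  using q_gt_1 unfolding rational_def by (auto simp: addrow_mat_def add_power_q)

text \<open>Generation of SL_n(q) by transvections, cast as an induction rule. Row operations over
  F_q turn the columns of g into unit vectors one after the other; each operation is multiplication
  by a rational transvection, so it keeps determinant and rationality and is undone by another
  one.\<close>

lemma SL_transvection_induct [consumes 3, case_names one step]:
  assumes g: "g \<in> carrier_mat n n" "rational g" "det g = 1"
    and one: "P (1\<^sub>m n)"
    and step: "\<And>h i j t. h \<in> carrier_mat n n \<Longrightarrow> P h \<Longrightarrow> i < n \<Longrightarrow> j < n \<Longrightarrow> i \<noteq> j \<Longrightarrow> t ^ q = t \<Longrightarrow>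
      P (addrow_mat n t i j * h)"
  shows "P g"
proof -
  define S where "S h \<longleftrightarrow> h \<in> carrier_mat n n \<and> rational h \<and> det h = 1" for h
  have S_step: "S (addrow t i j h)" and P_step: "P (addrow t i j h) \<Longrightarrow> P h"
    if h: "S h" and ij: "i < n" "j < n" "i \<noteq> j" "t ^ q = t" for h i j t
  proof -
    have hc: "h \<in> carrier_mat n n" using h S_def by simp
    note a = addrow_mat[OF hc ij(2)]
    have "rational (addrow t i j h)" unfolding a
      using h hc ij by (intro rational_mult rational_addrow_mat) (auto simp: S_def)
    moreover have "addrow_mat n t i j * h \<in> carrier_mat n n" by (rule mult_carrier_mat[OF addrow_mat_carrier hc])
    ultimately show "S (addrow t i j h)" using h hc unfolding S_def
      by (simp add: a det_mult[of _ n] det_addrow_mat[OF ij(3)])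
    assume P: "P (addrow t i j h)"
    have "addrow_mat n (- t) i j * addrow t i j h = (addrow_mat n (- t) i j * addrow_mat n t i j) * h"
      unfolding a using hc by (simp add: mult_mat_assoc)
    also have "\<dots> = h" using addrow_mat_inv[OF ij(1-3), of "- t"] hc by simp
    finally show "P h" using step[OF _ P ij(1-3), of "- t"] ij(4) hc by (simp add: frob.hom_uminus)
  qed
  \<comment> \<open>The first k columns agree with those of the identity. The claim for k is reduced
    to the claim for k + 1, ending at k = n, where h is the identity.\<close>
  define cols_unit where "cols_unit k h \<longleftrightarrow> (\<forall>c<k. \<forall>i<n. h $$ (i, c) = (if i = c then 1 else 0))" for k and h :: "'k mat"
  \<comment> \<open>Once the pivot is 1, the other nonzero entries of column k are removed one at a
    time; their number is the measure.\<close>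
  have clear: "P h" if IH: "\<And>h. S h \<Longrightarrow> cols_unit (Suc k) h \<Longrightarrow> P h" and k: "k < n"
    and h: "S h" "cols_unit k h" "h $$ (k, k) = 1" for k h
    using h
  proof (induction "card {i. i < n \<and> i \<noteq> k \<and> h $$ (i, k) \<noteq> 0}" arbitrary: h rule: less_induct)
    case less
    have hc: "h \<in> carrier_mat n n" using less.prems S_def by simp
    show ?case
    proof (cases "\<exists>i<n. i \<noteq> k \<and> h $$ (i, k) \<noteq> 0")
      case False
      then have "cols_unit (Suc k) h" using less.prems k unfolding cols_unit_def less_Suc_eq by auto
      then show ?thesis using IH less.prems by blast
    next
      case True
      then obtain i where i: "i < n" "i \<noteq> k" "h $$ (i, k) \<noteq> 0" by blast
      define t where "t = - h $$ (i, k)"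
      have t: "t ^ q = t" using rationalD[of h i k] less.prems(1) hc i k unfolding t_def S_def
        by (simp add: frob.hom_uminus)
      define h' where "h' = addrow t i k h"
      have ent: "h' $$ (a, b) = (if a = i then t * h $$ (k, b) + h $$ (i, b) else h $$ (a, b))"
        if "a < n" "b < n" for a b using that hc i k unfolding h'_def by auto
      have "S h'" unfolding h'_def by (rule S_step[OF less.prems(1) i(1) k i(2) t])
      moreover have "cols_unit k h'" unfolding cols_unit_def
      proof (intro allI impI)
        fix c a assume c: "c < k" "a < n"
        have "h $$ (k, c) = 0" "h $$ (a, c) = (if a = c then 1 else 0)"
          using less.prems(2) c k unfolding cols_unit_def by auto
        then show "h' $$ (a, c) = (if a = c then 1 else 0)" using c k by (subst ent) auto
      qed
      moreover have "h' $$ (k, k) = 1" using less.prems(3) k i by (simp add: ent)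
      moreover have "{a. a < n \<and> a \<noteq> k \<and> h' $$ (a, k) \<noteq> 0} \<subset> {a. a < n \<and> a \<noteq> k \<and> h $$ (a, k) \<noteq> 0}"
      proof -
        have "h' $$ (i, k) = 0" using less.prems(3) i k by (subst ent) (auto simp: t_def)
        moreover have "h' $$ (a, k) = h $$ (a, k)" if "a < n" "a \<noteq> i" for a
          using that k by (subst ent) auto
        ultimately show ?thesis using i by (metis (mono_tags, lifting) mem_Collect_eq psubsetI subsetI)
      qed
      then have "card {a. a < n \<and> a \<noteq> k \<and> h' $$ (a, k) \<noteq> 0} < card {a. a < n \<and> a \<noteq> k \<and> h $$ (a, k) \<noteq> 0}"
        by (rule psubset_card_mono[rotated]) simp
      ultimately have "P h'" using less.hyps by blast
      then show ?thesis unfolding h'_def by (rule P_step[OF less.prems(1) i(1) k i(2) t])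
    qed
  qed
  have "P h" if "k \<le> n" "S h" "cols_unit k h" for k h
    using that
  proof (induction k arbitrary: h rule: inc_induct)
    case base
    then have "h = 1\<^sub>m n" by (intro eq_matI) (auto simp: S_def cols_unit_def)
    then show ?case using one by simp
  next
    case (step k)
    note k = \<open>k < n\<close>
    have hc: "h \<in> carrier_mat n n" and hd: "det h = 1" using step.prems S_def by simp_all
    have IH: "\<And>h. S h \<Longrightarrow> cols_unit (Suc k) h \<Longrightarrow> P h" by (rule step.IH)
    have clear: "\<And>h. S h \<Longrightarrow> cols_unit k h \<Longrightarrow> h $$ (k, k) = 1 \<Longrightarrow> P h"
      using clear IH k by blast
    \<comment> \<open>A nonzero entry below the pivot position makes the pivot 1: t solves t f_ik +
      f_kk = 1. Row i is zero in the earlier columns, so these stay intact.\<close>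
    have via_row: "P f" if f: "S f" "cols_unit k f" and i: "i < n" "k < i" "f $$ (i, k) \<noteq> 0" for f i
    proof -
      define t where "t = (1 - f $$ (k, k)) / f $$ (i, k)"
      have fc: "f \<in> carrier_mat n n" and fr: "rational f" using f S_def by simp_all
      have t: "t ^ q = t" using rationalD[OF fr, of k k] rationalD[OF fr, of i k] fc i k
        unfolding t_def by (simp add: power_divide frob.hom_minus)
      have ent: "addrow t k i f $$ (a, b) = (if a = k then t * f $$ (i, b) + f $$ (k, b) else f $$ (a, b))"
        if "a < n" "b < n" for a b using that fc i k by auto
      have ki: "k \<noteq> i" using i by simp
      have "P (addrow t k i f)"
      proof (rule clear)
        show "S (addrow t k i f)" by (rule S_step[OF f(1) k i(1) ki t])
        show "cols_unit k (addrow t k i f)" unfolding cols_unit_def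
        proof (intro allI impI)
          fix c a assume c: "c < k" "a < n"
          have "f $$ (i, c) = 0" "f $$ (a, c) = (if a = c then 1 else 0)"
            using f(2) c k i unfolding cols_unit_def by auto
          then show "addrow t k i f $$ (a, c) = (if a = c then 1 else 0)" using c k by (subst ent) auto
        qed
        show "addrow t k i f $$ (k, k) = 1" using i ent[OF k k] by (simp add: t_def)
      qed
      then show "P f" by (rule P_step[OF f(1) k i(1) ki t])
    qed
    show ?case
    proof (cases "\<exists>i. k < i \<and> i < n \<and> h $$ (i, k) \<noteq> 0")
      case True
      then show ?thesis using via_row[OF step.prems] by blast
    next
      case False
      \<comment> \<open>For the last column no row below is available, but then h is triangular with
        all other diagonal entries 1, so the last pivot equals det h = 1.\<close>
      have "upper_triangular h" if "Suc k = n"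
        using step.prems(2) that hc unfolding cols_unit_def by (intro upper_triangularI) auto
      then have last: "h $$ (k, k) = 1" if "Suc k = n"
      proof -
        have "det h = prod_list (diag_mat h)" using \<open>Suc k = n \<Longrightarrow> upper_triangular h\<close>[OF that] hc
          by (rule det_upper_triangular)
        also have "\<dots> = (\<Prod>i<n. h $$ (i, i))" using hc unfolding diag_mat_def
          by (simp add: prod.list_conv_set_nth lessThan_atLeast0)
        also have "\<dots> = (\<Prod>i<k. h $$ (i, i)) * h $$ (k, k)" unfolding that[symmetric] by simp
        also have "(\<Prod>i<k. h $$ (i, i)) = 1" using step.prems(2) k unfolding cols_unit_def
          by (intro prod.neutral) auto
        finally show ?thesis using hd by simp
      qed
      show ?thesis
      proof (cases "Suc k = n")
        case True
        then show ?thesis using clear[OF step.prems last] by blast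
      next
        case neq: False
        \<comment> \<open>If the pivot vanished as well, column k would be a combination of the
          earlier unit columns; the vector v records this relation and contradicts det h =
          1.\<close>
        have nz: "h $$ (k, k) \<noteq> 0"
        proof
          assume z: "h $$ (k, k) = 0"
          define v where "v = vec n (\<lambda>i. if i < k then - h $$ (i, k) else if i = k then 1 else 0)"
          have "h *\<^sub>v v = 0\<^sub>v n"
          proof (rule eq_vecI)
            fix i assume "i < dim_vec (0\<^sub>v n :: 'k vec)"
            then have i: "i < n" by simp
            have "(h *\<^sub>v v) $ i = (\<Sum>c<n. h $$ (i, c) * v $ c)"
              using hc i by (simp add: scalar_prod_def v_def lessThan_atLeast0)
            also have "\<dots> = (\<Sum>c<n. (if c = i \<and> i < k then - h $$ (i, k) else 0) + (if c = k then h $$ (i, k) else 0))"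
              using step.prems(2) i k unfolding cols_unit_def v_def by (intro sum.cong) auto
            also have "\<dots> = 0" using i k z False
              by (cases "i < k"; cases "i = k") (auto simp: sum.distrib)
            finally show "(h *\<^sub>v v) $ i = 0\<^sub>v n $ i" using i by simp
          qed (use hc in auto)
          moreover have "v $ k \<noteq> 0\<^sub>v n $ k" using k by (simp add: v_def)
          then have "v \<noteq> 0\<^sub>v n" by metis
          moreover have "v \<in> carrier_vec n" by (simp add: v_def)
          ultimately have "det h = 0" unfolding det_0_iff_vec_prod_zero_field[OF hc] by blast
          then show False using hd by simp
        qed
        have k1: "Suc k < n" "Suc k \<noteq> k" using k neq by auto
        have one: "(1::'k) ^ q = 1" by simp
        have ent: "addrow 1 (Suc k) k h $$ (a, b) = (if a = Suc k then h $$ (k, b) + h $$ (Suc k, b) else h $$ (a, b))"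
          if "a < n" "b < n" for a b using that hc k1 k by auto
        \<comment> \<open>Adding row k to row k + 1 copies the nonzero pivot below itself, which
          restores the situation of \<open>via_row\<close>.\<close>
        have "P (addrow 1 (Suc k) k h)"
        proof (rule via_row[of _ "Suc k"])
          show "S (addrow 1 (Suc k) k h)" by (rule S_step[OF step.prems(1) k1(1) k k1(2) one])
          show "cols_unit k (addrow 1 (Suc k) k h)" unfolding cols_unit_def
          proof (intro allI impI)
            fix c a assume c: "c < k" "a < n"
            have "h $$ (k, c) = 0" "h $$ (a, c) = (if a = c then 1 else 0)"
              using step.prems(2) c k unfolding cols_unit_def by auto
            then show "addrow 1 (Suc k) k h $$ (a, c) = (if a = c then 1 else 0)" using c k by (subst ent) auto
          qed
          show "addrow 1 (Suc k) k h $$ (Suc k, k) \<noteq> 0" using nz False k1 ent[OF k1(1) k] by simp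
        qed (use k1 in auto)
        then show ?thesis by (rule P_step[OF step.prems(1) k1(1) k k1(2) one])
      qed
    qed
  qed
  from this[of 0 g] show ?thesis using g by (simp add: S_def cols_unit_def)
qed

end

section \<open>Orthogonal groups\<close>

lemma group_GL: "group (GL m :: 'k::field mat monoid)"
proof -
  interpret ring "ring_mat TYPE('k) m ()" by (rule ring_mat)
  show ?thesis unfolding GL_def by (rule units_group)
qed

lemma mult_GL [simp]: "x \<otimes>\<^bsub>GL m\<^esub> y = x * y" and one_GL [simp]: "\<one>\<^bsub>GL m\<^esub> = 1\<^sub>m m"
  unfolding GL_def units_of_def ring_mat_def by simp_all

lemma carrier_GL: "g \<in> carrier (GL m) \<longleftrightarrow> g \<in> carrier_mat m m \<and> det g \<noteq> (0::'k::field)"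
proof
  assume g: "g \<in> carrier (GL m)"
  then have "g \<in> Units (ring_mat TYPE('k) m ())" unfolding GL_def units_of_def by simp
  then show "g \<in> carrier_mat m m \<and> det g \<noteq> 0"
    using unit_imp_det_non_zero unfolding Units_def ring_mat_def by auto
next
  assume "g \<in> carrier_mat m m \<and> det g \<noteq> 0"
  then show "g \<in> carrier (GL m)" using det_non_zero_imp_unit[of g m "()"] unfolding GL_def units_of_def by simp
qed

lemma invertible_obtain:
  assumes "g \<in> carrier_mat m m" "det g \<noteq> (0::'k::field)"
  obtains h where "h \<in> carrier_mat m m" "g * h = 1\<^sub>m m" "h * g = 1\<^sub>m m"
  using det_non_zero_imp_unit[OF assms, of "()"] unfolding Units_def ring_mat_def by auto

lemma inv_GL:
  assumes "g \<in> carrier_mat m m" "h \<in> carrier_mat m m" "g * h = 1\<^sub>m m"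
  shows "inv\<^bsub>GL m\<^esub> g = (h :: 'k::field mat)"
proof (rule group.inv_equality[OF group_GL])
  have d: "det g * det h = 1" using det_mult[OF assms(1,2)] assms(3) by simp
  show "h \<otimes>\<^bsub>GL m\<^esub> g = \<one>\<^bsub>GL m\<^esub>" using mat_mult_left_right_inverse[OF assms] by simp
  show "g \<in> carrier (GL m)" "h \<in> carrier (GL m)" unfolding carrier_GL using assms d by auto
qed

text \<open>The condition in \<open>SO\<close> as a predicate on g alone, so that the two kinds of
  form share the closure lemmas.\<close>

definition preserves_form :: "nat \<Rightarrow> 'k::field mat \<Rightarrow> bool" where
  "preserves_form m g \<longleftrightarrow>
     (if even m
      then \<forall>v \<in> carrier_vec m. hyp_quadratic m (g *\<^sub>v v) = hyp_quadratic m v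
      else \<forall>v \<in> carrier_vec m. \<forall>w \<in> carrier_vec m. J_bilinear m (g *\<^sub>v v) (g *\<^sub>v w) = J_bilinear m v w)"

lemma preserves_form_mult:
  assumes "g \<in> carrier_mat m m" "h \<in> carrier_mat m m" "preserves_form m g" "preserves_form m h"
  shows "preserves_form m (g * h)"
proof -
  have "g * h *\<^sub>v v = g *\<^sub>v (h *\<^sub>v v)" if "v \<in> carrier_vec m" for v using assms that by simp
  moreover have "h *\<^sub>v v \<in> carrier_vec m" if "v \<in> carrier_vec m" for v using assms that by auto
  ultimately show ?thesis using assms(3,4) unfolding preserves_form_def by auto
qed

lemma preserves_form_inverse:
  assumes "g \<in> carrier_mat m m" "h \<in> carrier_mat m m" "g * h = 1\<^sub>m m" "preserves_form m g"
  shows "preserves_form m h"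
proof -
  have "g *\<^sub>v (h *\<^sub>v v) = v" if "v \<in> carrier_vec m" for v
    using assms that by (metis assoc_mult_mat_vec one_mult_mat_vec)
  moreover have "h *\<^sub>v v \<in> carrier_vec m" if "v \<in> carrier_vec m" for v using assms that by auto
  ultimately show ?thesis using assms(4) unfolding preserves_form_def by metis
qed

lemma J_bilinear_sum:
  assumes "v \<in> carrier_vec m" "w \<in> carrier_vec m"
  shows "J_bilinear m v w = (\<Sum>i<m. v $ i * w $ (m - 1 - i))"
proof -
  have "(J_mat m *\<^sub>v w) $ i = w $ (m - 1 - i)" if "i < m" for i
  proof -
    have "(J_mat m *\<^sub>v w) $ i = (\<Sum>k = 0..<m. (if Suc (i + k) = m then 1 else 0) * w $ k)"
      using that assms unfolding J_mat_def by (simp add: scalar_prod_def)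
    also have "\<dots> = (\<Sum>k = 0..<m. if k = m - 1 - i then w $ k else 0)"
      using that by (intro sum.cong) auto
    also have "\<dots> = w $ (m - 1 - i)" using that by simp
    finally show ?thesis .
  qed
  then show ?thesis unfolding J_bilinear_def scalar_prod_def using assms
    by (simp add: J_mat_def lessThan_atLeast0)
qed

context frobenius_field
begin

lemma carrier_SO_q:
  "g \<in> carrier (SO_q q m) \<longleftrightarrow>
     g \<in> carrier_mat m m \<and> det g = (1::'k) \<and> preserves_form m g \<and> rational g"
  unfolding SO_q_def fixed_points_def SO_def SL_def rational_frobenius preserves_form_def
  by (auto simp: carrier_GL)

lemma SO_q_eq: "SO_q q m = (GL m)\<lparr>carrier := carrier (SO_q q m :: 'k mat monoid)\<rparr>"
  unfolding SO_q_def fixed_points_def SO_def SL_def by simp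

lemma subgroup_SO_q: "subgroup (carrier (SO_q q m)) (GL m :: 'k mat monoid)"
proof
  show "carrier (SO_q q m) \<subseteq> carrier (GL m :: 'k mat monoid)" unfolding carrier_SO_q carrier_GL subset_iff by simp
  show "\<one>\<^bsub>GL m\<^esub> \<in> carrier (SO_q q m :: 'k mat monoid)"
    unfolding carrier_SO_q by (auto simp: rational_one preserves_form_def)
  fix x :: "'k mat" assume x: "x \<in> carrier (SO_q q m)"
  then have x': "x \<in> carrier_mat m m" "det x = 1" "preserves_form m x" "rational x" unfolding carrier_SO_q by auto
  then obtain y where y: "y \<in> carrier_mat m m" "x * y = 1\<^sub>m m" using invertible_obtain by (metis one_neq_zero)
  have "inv\<^bsub>GL m\<^esub> x = y" by (rule inv_GL[OF x'(1) y])
  moreover have "det x * det y = 1" using det_mult[OF x'(1) y(1)] y(2) by simp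
  ultimately show "inv\<^bsub>GL m\<^esub> x \<in> carrier (SO_q q m)" unfolding carrier_SO_q
    using x' y preserves_form_inverse[OF x'(1) y x'(3)] rational_inverse[OF x'(1) y x'(4)] by simp
  fix y :: "'k mat" assume y: "y \<in> carrier (SO_q q m)"
  then have y': "y \<in> carrier_mat m m" "det y = 1" "preserves_form m y" "rational y" unfolding carrier_SO_q by auto
  show "x \<otimes>\<^bsub>GL m\<^esub> y \<in> carrier (SO_q q m)" unfolding carrier_SO_q
    using x' y' by (auto simp: det_mult[of _ m] preserves_form_mult intro!: rational_mult)
qed

lemma group_SO_q: "group (SO_q q m :: 'k mat monoid)"
  by (subst SO_q_eq) (rule subgroup.subgroup_is_group[OF subgroup_SO_q group_GL])

lemma mult_SO_q [simp]: "x \<otimes>\<^bsub>SO_q q m\<^esub> y = x * (y :: 'k mat)"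
  and one_SO_q [simp]: "\<one>\<^bsub>SO_q q m\<^esub> = (1\<^sub>m m :: 'k mat)"
  by (subst SO_q_eq; simp)+

lemma inv_SO_q:
  assumes "g \<in> carrier (SO_q q m)" "h \<in> carrier_mat m m" "g * h = 1\<^sub>m m"
  shows "inv\<^bsub>SO_q q m\<^esub> g = (h :: 'k mat)"
proof -
  have "inv\<^bsub>SO_q q m\<^esub> g = inv\<^bsub>GL m\<^esub> g"
    using group.m_inv_consistent[OF group_GL subgroup_SO_q assms(1)] SO_q_eq by metis
  also have "\<dots> = h" using assms by (intro inv_GL) (auto simp: carrier_SO_q)
  finally show ?thesis .
qed

lemma SO_derived_sub: "subgroup (carrier (SO_derived q m)) (SO_q q m :: 'k mat monoid)"
  unfolding SO_derived_def by simp (rule group.derived_is_subgroup[OF group_SO_q order.refl])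

lemma group_SO_derived: "group (SO_derived q m :: 'k mat monoid)"
proof -
  have "SO_derived q m = (SO_q q m)\<lparr>carrier := carrier (SO_derived q m :: 'k mat monoid)\<rparr>"
    unfolding SO_derived_def by simp
  then show ?thesis using subgroup.subgroup_is_group[OF SO_derived_sub group_SO_q] by metis
qed

lemma carrier_SO_derived_sub: "g \<in> carrier (SO_derived q m) \<Longrightarrow> g \<in> carrier (SO_q q m :: 'k mat monoid)"
  using subgroup.subset[OF SO_derived_sub] by blast

lemma carrier_SO_derivedD:
  "g \<in> carrier (SO_derived q m) \<Longrightarrow> g \<in> carrier_mat m m"
  "g \<in> carrier (SO_derived q m) \<Longrightarrow> det g = (1::'k)"
  "g \<in> carrier (SO_derived q m) \<Longrightarrow> preserves_form m g"
  "g \<in> carrier (SO_derived q m) \<Longrightarrow> rational g"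
  using carrier_SO_derived_sub carrier_SO_q by blast+

lemma mult_SO_derived [simp]: "x \<otimes>\<^bsub>SO_derived q m\<^esub> y = x * (y :: 'k mat)"
  and one_SO_derived [simp]: "\<one>\<^bsub>SO_derived q m\<^esub> = (1\<^sub>m m :: 'k mat)"
  unfolding SO_derived_def by simp_all

lemma inv_SO_derived:
  assumes "g \<in> carrier (SO_derived q m)" "h \<in> carrier_mat m m" "g * h = 1\<^sub>m m"
  shows "inv\<^bsub>SO_derived q m\<^esub> g = (h :: 'k mat)"
proof -
  have "inv\<^bsub>SO_derived q m\<^esub> g = inv\<^bsub>SO_q q m\<^esub> g"
    using group.m_inv_consistent[OF group_SO_q SO_derived_sub assms(1)] unfolding SO_derived_def by simp
  then show ?thesis using inv_SO_q[OF carrier_SO_derived_sub[OF assms(1)] assms(2,3)] by simp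
qed

lemma inv_SO_derivedD:
  assumes "g \<in> carrier (SO_derived q m :: 'k mat monoid)"
  shows "inv\<^bsub>SO_derived q m\<^esub> g \<in> carrier_mat m m" "g * inv\<^bsub>SO_derived q m\<^esub> g = 1\<^sub>m m"
    "inv\<^bsub>SO_derived q m\<^esub> g * g = 1\<^sub>m m"
proof -
  interpret group "SO_derived q m :: 'k mat monoid" by (rule group_SO_derived)
  show "inv\<^bsub>SO_derived q m\<^esub> g \<in> carrier_mat m m" using assms carrier_SO_derivedD(1) by blast
  show "g * inv\<^bsub>SO_derived q m\<^esub> g = 1\<^sub>m m" "inv\<^bsub>SO_derived q m\<^esub> g * g = 1\<^sub>m m"
    using r_inv[OF assms] l_inv[OF assms] by simp_all
qed

lemma finite_SO_derived: "finite (carrier (SO_derived q m :: 'k mat monoid))"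
  by (rule finite_subset[OF _ finite_rational_mat[of m m]]) (use carrier_SO_derivedD in blast)

text \<open>The equation presents z as the commutator of x and y without mentioning inverses, so it
  can be verified entry by entry.\<close>

lemma commutator_in_SO_derived:
  assumes x: "x \<in> carrier (SO_q q m)" and y: "y \<in> carrier (SO_q q m)" and z: "z \<in> carrier_mat m m"
    and eq: "x * y = z * (y * (x :: 'k mat))"
  shows "z \<in> carrier (SO_derived q m)"
proof -
  interpret group "SO_q q m :: 'k mat monoid" by (rule group_SO_q)
  have xm: "x \<in> carrier_mat m m" and ym: "y \<in> carrier_mat m m" using x y carrier_SO_q by auto
  obtain x' where x': "x' \<in> carrier_mat m m" "x * x' = 1\<^sub>m m"
    using invertible_obtain[OF xm] x carrier_SO_q by (metis one_neq_zero)
  obtain y' where y': "y' \<in> carrier_mat m m" "y * y' = 1\<^sub>m m"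
    using invertible_obtain[OF ym] y carrier_SO_q by (metis one_neq_zero)
  have [simp]: "dim_row x = m" "dim_col x = m" "dim_row y = m" "dim_col y = m" "dim_row z = m" "dim_col z = m"
    "dim_row x' = m" "dim_col x' = m" "dim_row y' = m" "dim_col y' = m"
    using xm ym z x' y' by auto
  have "z = z * (y * (x * x') * y')" using x'(2) y'(2) by (simp add: mat_ring)
  also have "\<dots> = (z * (y * x)) * x' * y'" by (simp add: mult_mat_assoc)
  also have "\<dots> = x * y * x' * y'" by (simp add: eq)
  also have "\<dots> = x \<otimes>\<^bsub>SO_q q m\<^esub> y \<otimes>\<^bsub>SO_q q m\<^esub> inv\<^bsub>SO_q q m\<^esub> x \<otimes>\<^bsub>SO_q q m\<^esub> inv\<^bsub>SO_q q m\<^esub> y"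
    using inv_SO_q[OF x x'] inv_SO_q[OF y y'] by simp
  finally have "z \<in> derived_set (SO_q q m) (carrier (SO_q q m))" using x y by blast
  then show ?thesis unfolding SO_derived_def derived_def by (auto intro: generate.incl)
qed

end

section \<open>Root elements of the orthogonal group\<close>

locale orthogonal_setting = frobenius_field q field_type
  for q :: nat and field_type :: "'k::alg_closed_field itself" +
  fixes n m :: nat
  assumes n_ge_3: "n \<ge> 3" and m_cases: "m = 2 * n \<or> m = 2 * n + 1"
begin

text \<open>The index that the form pairs with i. Only the middle index, present for odd m, is its
  own partner; the remaining ones are the \<open>outer\<close> indices.\<close>

definition mir :: "nat \<Rightarrow> nat" where "mir i = m - 1 - i"

definition outer :: "nat \<Rightarrow> bool" where "outer i \<longleftrightarrow> i < m \<and> i \<noteq> mir i"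

lemma mir_less [simp]: "i < m \<Longrightarrow> mir i < m" unfolding mir_def by simp
lemma mir_mir [simp]: "i < m \<Longrightarrow> mir (mir i) = i" unfolding mir_def by simp
lemma outer_less [simp]: "outer i \<Longrightarrow> i < m" unfolding outer_def by simp
lemma outer_mir [simp]: "outer i \<Longrightarrow> outer (mir i)" unfolding outer_def by (metis mir_less mir_mir)
lemma outer_neq_mir: "outer i \<Longrightarrow> i \<noteq> mir i" unfolding outer_def by simp
lemma mir_inject: "i < m \<Longrightarrow> j < m \<Longrightarrow> mir i = mir j \<longleftrightarrow> i = j" by (metis mir_mir)
lemma mir_eq_iff: "i < m \<Longrightarrow> j < m \<Longrightarrow> mir i = j \<longleftrightarrow> i = mir j" by (metis mir_mir)
lemma outer_iff: "outer i \<longleftrightarrow> i < n \<or> m - n \<le> i \<and> i < m"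
  using m_cases unfolding outer_def mir_def by auto

lemma outer_pair: "outer i \<Longrightarrow> j < n \<Longrightarrow> (j = i \<or> j = mir i) \<longleftrightarrow> j = min i (mir i)"
  using m_cases unfolding outer_def mir_def by auto

lemma min_mir: "outer i \<Longrightarrow> min i (mir i) < n"
  using m_cases unfolding outer_def mir_def by auto

text \<open>Here n \<ge> 3 enters: the 2n outer indices form n pairs, and the pairs of i and j
  cannot exhaust them. The free index l makes root elements commutators and helps to pin down the
  center.\<close>

lemma obtain_outer:
  assumes "outer i" "outer j"
  obtains l where "outer l" "l \<noteq> i" "l \<noteq> mir i" "l \<noteq> j" "l \<noteq> mir j"
proof -
  have "{..<n} - {min i (mir i), min j (mir j)} \<noteq> {}"
  proof
    assume "{..<n} - {min i (mir i), min j (mir j)} = {}"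
    then have "card {..<n} \<le> card {min i (mir i), min j (mir j)}" by (intro card_mono) auto
    also have "\<dots> \<le> 2" by (simp add: card_insert_if)
    finally show False using n_ge_3 by simp
  qed
  then obtain l where l: "l < n" "l \<noteq> min i (mir i)" "l \<noteq> min j (mir j)" by auto
  then show ?thesis using that[of l] outer_pair[OF assms(1) l(1)] outer_pair[OF assms(2) l(1)] outer_iff by blast
qed

text \<open>The unipotent element 1 + t e(a, b) - t e(mir b, mir a); the second term is forced by
  the form. For a, b < n it is the image of a transvection of GL_n, and for a < n and b = mir c with
  c < n it lies in the unipotent radical of the Siegel parabolic.\<close>

definition root :: "nat \<Rightarrow> nat \<Rightarrow> 'k \<Rightarrow> 'k mat" where
  "root a b t = mat m m (\<lambda>(i, j). (if i = j then 1 else 0) + (if i = a \<and> j = b then t else 0)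
     - (if i = mir b \<and> j = mir a then t else 0))"

text \<open>For a = mir b the two off-diagonal terms fall on the same place and cancel; with one
  middle and one outer index a quadratic term in t survives and the form is not preserved.\<close>

definition root_pair :: "nat \<Rightarrow> nat \<Rightarrow> bool" where
  "root_pair a b \<longleftrightarrow> outer a \<and> outer b \<and> a \<noteq> b \<and> a \<noteq> mir b"

lemma root_pairD:
  assumes "root_pair a b"
  shows "a < m" "b < m" "mir a < m" "mir b < m" "a \<noteq> b" "a \<noteq> mir b" "a \<noteq> mir a" "b \<noteq> mir b" "b \<noteq> mir a" "mir a \<noteq> mir b"
  using assms outer_neq_mir[of a] outer_neq_mir[of b] mir_inject[of a b]
  unfolding root_pair_def by (auto simp: mir_eq_iff)

lemma root_carrier [simp]: "root a b t \<in> carrier_mat m m" "dim_row (root a b t) = m" "dim_col (root a b t) = m"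
  unfolding root_def by simp_all

lemma root_index:
  assumes "i < m" "j < m"
  shows "root a b t $$ (i, j) = (if i = j then 1 else 0) + (if i = a \<and> j = b then t else 0)
       - (if i = mir b \<and> j = mir a then t else 0)"
  using assms unfolding root_def by simp

lemma root_mult_vec:
  assumes "root_pair a b" "v \<in> carrier_vec m" "i < m"
  shows "(root a b t *\<^sub>v v) $ i = v $ i + (if i = a then t * v $ b else 0) - (if i = mir b then t * v $ mir a else 0)"
proof -
  have "(root a b t *\<^sub>v v) $ i = (\<Sum>j<m. ((if i = j then v $ j else 0) + (if i = a \<and> j = b then t * v $ j else 0)
     - (if i = mir b \<and> j = mir a then t * v $ j else 0)))"
  proof -
    have "(root a b t *\<^sub>v v) $ i = (\<Sum>j<m. root a b t $$ (i, j) * v $ j)"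
      using assms(2,3) by (simp add: scalar_prod_def lessThan_atLeast0)
    also have "\<dots> = (\<Sum>j<m. ((if i = j then v $ j else 0) + (if i = a \<and> j = b then t * v $ j else 0)
     - (if i = mir b \<and> j = mir a then t * v $ j else 0)))"
    proof (rule sum.cong[OF refl])
      fix j assume "j \<in> {..<m}"
      then have "root a b t $$ (i, j) = (if i = j then 1 else 0) + (if i = a \<and> j = b then t else 0)
       - (if i = mir b \<and> j = mir a then t else 0)" using assms(3) by (intro root_index) auto
      then show "root a b t $$ (i, j) * v $ j = (if i = j then v $ j else 0) + (if i = a \<and> j = b then t * v $ j else 0)
     - (if i = mir b \<and> j = mir a then t * v $ j else 0)"
        by (simp only: left_diff_distrib distrib_right if_distribR if_distrib[of "\<lambda>x. x * v $ j"] mult_1_left mult_zero_left)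
    qed
    finally show ?thesis .
  qed
  also have "\<dots> = (\<Sum>j<m. if i = j then v $ j else 0) + (\<Sum>j<m. if i = a \<and> j = b then t * v $ j else 0)
     - (\<Sum>j<m. if i = mir b \<and> j = mir a then t * v $ j else 0)"
    by (simp only: sum.distrib sum_subtractf)
  also have "(\<Sum>j<m. if i = j then v $ j else 0) = v $ i" using assms(3) by simp
  also have "(\<Sum>j<m. if i = a \<and> j = b then t * v $ j else 0) = (if i = a then t * v $ b else 0)"
    using root_pairD(2)[OF assms(1)] by simp
  also have "(\<Sum>j<m. if i = mir b \<and> j = mir a then t * v $ j else 0) = (if i = mir b then t * v $ mir a else 0)"
    using root_pairD(3)[OF assms(1)] by simp
  finally show ?thesis .
qed

lemma root_mult_mat:
  assumes "root_pair a b" "M \<in> carrier_mat m l" "i < m" "j < l"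
  shows "(root a b t * M) $$ (i, j) = M $$ (i, j) + (if i = a then t * M $$ (b, j) else 0)
     - (if i = mir b then t * M $$ (mir a, j) else 0)"
proof -
  have "(root a b t * M) $$ (i, j) = (root a b t *\<^sub>v col M j) $ i" using assms by simp
  also have "\<dots> = col M j $ i + (if i = a then t * col M j $ b else 0) - (if i = mir b then t * col M j $ mir a else 0)"
    by (rule root_mult_vec[OF assms(1) _ assms(3)]) (use assms in auto)
  finally show ?thesis using assms root_pairD[OF assms(1)] by simp
qed

lemma root_eq_addrow:
  assumes ab: "root_pair a b"
  shows "root a b t = addrow_mat m t a b * addrow_mat m (- t) (mir b) (mir a)"
proof -
  note D = root_pairD[OF ab]
  have "root a b t = addrow t a b (addrow_mat m (- t) (mir b) (mir a))"
    using D unfolding root_def by (intro eq_matI) (auto simp: addrow_mat_def)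
  also have "\<dots> = addrow_mat m t a b * addrow_mat m (- t) (mir b) (mir a)"
    by (rule addrow_mat) (use D in auto)
  finally show ?thesis .
qed

lemma root_det:
  assumes ab: "root_pair a b"
  shows "det (root a b t) = 1"
  unfolding root_eq_addrow[OF ab] det_mult[OF addrow_mat_carrier addrow_mat_carrier]
  using root_pairD[OF ab] by (simp add: det_addrow_mat)

text \<open>Only the pairs {a, mir a} and {b, mir b} contribute a change. For the quadratic form the
  changes are c and -c with c = t v_b v_(mir a); its sum has one term per pair, whose index is the
  smaller of the two.\<close>

lemma root_preserves_form:
  assumes ab: "root_pair a b"
  shows "preserves_form m (root a b t)"
proof -
  note D = root_pairD[OF ab]
  have out: "outer a" "outer b" using ab root_pair_def by auto
  have quad: "hyp_quadratic m (root a b t *\<^sub>v v) = hyp_quadratic m v" if v: "v \<in> carrier_vec m" and "even m" for v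
  proof -
    have mn: "m div 2 = n" using m_cases by auto
    define c where "c = t * v $ b * v $ mir a"
    have "hyp_quadratic m (root a b t *\<^sub>v v) =
      (\<Sum>i<n. v $ i * v $ mir i + (if i = min a (mir a) then c else 0) - (if i = min b (mir b) then c else 0))"
      unfolding hyp_quadratic_def mn
    proof (rule sum.cong[OF refl])
      fix i assume "i \<in> {..<n}"
      then have i: "i < n" "i < m" using m_cases by auto
      have "(root a b t *\<^sub>v v) $ i * (root a b t *\<^sub>v v) $ (m - 1 - i)
         = v $ i * v $ mir i + (if i = a \<or> i = mir a then c else 0) - (if i = b \<or> i = mir b then c else 0)"
        unfolding mir_def[symmetric] root_mult_vec[OF ab v i(2)] root_mult_vec[OF ab v mir_less[OF i(2)]]
        using D i by (auto simp: mir_eq_iff c_def algebra_simps)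
      then show "(root a b t *\<^sub>v v) $ i * (root a b t *\<^sub>v v) $ (m - 1 - i) = 
        v $ i * v $ mir i + (if i = min a (mir a) then c else 0) - (if i = min b (mir b) then c else 0)"
        unfolding outer_pair[OF out(1) i(1)] outer_pair[OF out(2) i(1)] .
    qed
    also have "\<dots> = hyp_quadratic m v"
      using min_mir[OF out(1)] min_mir[OF out(2)]
      unfolding hyp_quadratic_def mn mir_def[symmetric] by (simp add: sum.distrib sum_subtractf)
    finally show ?thesis .
  qed
  have bil: "J_bilinear m (root a b t *\<^sub>v v) (root a b t *\<^sub>v w) = J_bilinear m v w"
    if v: "v \<in> carrier_vec m" and w: "w \<in> carrier_vec m" for v w
  proof -
    define c d where "c = t * v $ b * w $ mir a" and "d = t * v $ mir a * w $ b"
    have "J_bilinear m (root a b t *\<^sub>v v) (root a b t *\<^sub>v w) =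
      (\<Sum>i<m. (root a b t *\<^sub>v v) $ i * (root a b t *\<^sub>v w) $ mir i)"
      unfolding mir_def
      by (rule J_bilinear_sum[OF mult_mat_vec_carrier[OF root_carrier(1) v] mult_mat_vec_carrier[OF root_carrier(1) w]])
    also have "\<dots> = (\<Sum>i<m. v $ i * w $ mir i + (if i = a then c else 0) - (if i = mir b then d else 0)
       + (if i = mir a then d else 0) - (if i = b then c else 0))"
    proof (rule sum.cong[OF refl])
      fix i assume "i \<in> {..<m}"
      then have i: "i < m" by simp
      show "(root a b t *\<^sub>v v) $ i * (root a b t *\<^sub>v w) $ mir i = v $ i * w $ mir i + (if i = a then c else 0)
        - (if i = mir b then d else 0) + (if i = mir a then d else 0) - (if i = b then c else 0)"
        unfolding root_mult_vec[OF ab v i] root_mult_vec[OF ab w mir_less[OF i]]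
        using D i by (auto simp: mir_eq_iff c_def d_def algebra_simps)
    qed
    also have "\<dots> = (\<Sum>i<m. v $ i * w $ mir i)" using D by (simp add: sum.distrib sum_subtractf)
    also have "\<dots> = J_bilinear m v w" unfolding mir_def by (rule J_bilinear_sum[symmetric, OF v w])
    finally show ?thesis .
  qed
  show ?thesis unfolding preserves_form_def using quad bil by simp
qed

lemma root_in_SO_q:
  assumes ab: "root_pair a b" and t: "t ^ q = t"
  shows "root a b t \<in> carrier (SO_q q m)"
proof -
  have "rational (root a b t)" unfolding root_eq_addrow[OF ab]
    using t by (intro rational_mult rational_addrow_mat) (auto simp: frob.hom_uminus)
  then show ?thesis unfolding carrier_SO_q using root_det[OF ab] root_preserves_form[OF ab] by simp
qed

text \<open>The Chevalley commutator relation [x_al(1), x_lb(t)] = x_ab(t). Because l avoids the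
  pairs of a and b, no further root appears.\<close>

lemma root_commutator:
  assumes ab: "root_pair a b" and l: "outer l" "l \<noteq> a" "l \<noteq> mir a" "l \<noteq> b" "l \<noteq> mir b"
  shows "root a l 1 * root l b t = root a b t * (root l b t * root a l 1)"
proof (rule eq_matI)
  have al: "root_pair a l" and lb: "root_pair l b" using ab l unfolding root_pair_def by auto
  note D = root_pairD[OF ab] root_pairD[OF al] root_pairD[OF lb]
  fix i j assume "i < dim_row (root a b t * (root l b t * root a l 1))" "j < dim_col (root a b t * (root l b t * root a l 1))"
  then have ij: "i < m" "j < m" by simp_all
  have c: "root l b t * root a l 1 \<in> carrier_mat m m" by (rule mult_carrier_mat[of _ m m]) simp_all
  have ent: "root c d s $$ (x, y) = (if x = y then 1 else 0) + (if x = c \<and> y = d then s else 0)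
       - (if x = mir d \<and> y = mir c then s else 0)" if "x < m" "y < m" for c d s x y
    using that unfolding root_def by simp
  show "(root a l 1 * root l b t) $$ (i, j) = (root a b t * (root l b t * root a l 1)) $$ (i, j)"
    unfolding root_mult_mat[OF ab c ij] root_mult_mat[OF al root_carrier(1) ij]
      root_mult_mat[OF lb root_carrier(1) ij] root_mult_mat[OF lb root_carrier(1) D(2) ij(2)]
      root_mult_mat[OF lb root_carrier(1) D(3) ij(2)]
      ent[OF ij] ent[OF D(2) ij(2)] ent[OF D(3) ij(2)] ent[OF D(12) ij(2)] ent[OF D(13) ij(2)]
      ent[OF D(22) ij(2)] ent[OF D(23) ij(2)]
    using D by auto
qed simp_all

lemma root_in_SO_derived:
  assumes ab: "root_pair a b" and t: "t ^ q = t"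
  shows "root a b t \<in> carrier (SO_derived q m)"
proof -
  obtain l where l: "outer l" "l \<noteq> a" "l \<noteq> mir a" "l \<noteq> b" "l \<noteq> mir b"
    using obtain_outer[of a b] ab unfolding root_pair_def by blast
  have al: "root_pair a l" and lb: "root_pair l b" using ab l unfolding root_pair_def by auto
  show ?thesis
    by (rule commutator_in_SO_derived[OF root_in_SO_q[OF al] root_in_SO_q[OF lb t] _ root_commutator[OF ab l]]) simp_all
qed

lemma root_transpose: "(root a b t)\<^sup>T = root b a t"
proof (rule eq_matI)
  fix i j assume "i < dim_row (root b a t)" "j < dim_col (root b a t)"
  then have ij: "i < m" "j < m" by simp_all
  have "(root a b t)\<^sup>T $$ (i, j) = root a b t $$ (j, i)" using ij by simp
  also have "\<dots> = root b a t $$ (i, j)"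
    unfolding root_index[OF ij] root_index[OF ij(2,1)] by (simp add: conj_commute eq_commute[of i j])
  finally show "(root a b t)\<^sup>T $$ (i, j) = root b a t $$ (i, j)" .
qed simp_all

lemma mult_root:
  assumes ab: "root_pair a b" and M: "M \<in> carrier_mat m m" and ij: "i < m" "j < m"
  shows "(M * root a b t) $$ (i, j) = M $$ (i, j) + (if j = b then t * M $$ (i, a) else 0)
     - (if j = mir a then t * M $$ (i, mir b) else 0)"
proof -
  have ba: "root_pair b a" using ab root_pairD[OF ab] unfolding root_pair_def by auto
  have "M * root a b t = (root b a t * M\<^sup>T)\<^sup>T"
    using M by (simp add: mat_transpose_mult root_transpose)
  also have "\<dots> $$ (i, j) = (root b a t * M\<^sup>T) $$ (j, i)" using M ij by simp
  also have "\<dots> = M\<^sup>T $$ (j, i) + (if j = b then t * M\<^sup>T $$ (a, i) else 0)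
     - (if j = mir a then t * M\<^sup>T $$ (mir b, i) else 0)"
    by (rule root_mult_mat[OF ba _ ij(2,1)]) (use M in simp)
  finally show ?thesis using M ij root_pairD[OF ab] by simp
qed

section \<open>The center of the derived group\<close>

definition sign_mat :: "'k \<Rightarrow> 'k mat" where
  "sign_mat e = mat m m (\<lambda>(i, j). if i = j then if outer i then e else 1 else 0)"

lemma card_outer: "card {i. outer i} = 2 * n"
proof -
  have "{i. outer i} = {..<n} \<union> {m - n..<m}" unfolding outer_iff using m_cases by auto
  moreover have "{..<n} \<inter> {m - n..<m} = {}" using m_cases by auto
  ultimately show ?thesis using m_cases by (auto simp: card_Un_disjoint)
qed

lemma root_pair_exists: "outer a \<Longrightarrow> outer x \<Longrightarrow> \<exists>b. root_pair a b \<and> b \<noteq> x \<and> b \<noteq> mir x"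
  using obtain_outer[of a x] unfolding root_pair_def by (metis mir_mir outer_less)

text \<open>Commuting with the root elements makes z diagonal with one value e on all outer indices.
  The form then yields e^2 = 1, and the determinant makes the middle entry 1.\<close>

lemma center_SO_derived:
  assumes z: "z \<in> group_center (SO_derived q m :: 'k mat monoid)"
  obtains e where "e * e = 1" "z = sign_mat e"
proof -
  have zc: "z \<in> carrier (SO_derived q m)" using z unfolding group_center_def by simp
  note zm [simp] = carrier_SO_derivedD(1)[OF zc]
  have [simp]: "dim_row z = m" "dim_col z = m" using carrier_matD[OF zm] by simp_all
  have eq: "z $$ (x, y) + (if y = b then z $$ (x, a) else 0) - (if y = mir a then z $$ (x, mir b) else 0) =
      z $$ (x, y) + (if x = a then z $$ (b, y) else 0) - (if x = mir b then z $$ (mir a, y) else 0)"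
    if ab: "root_pair a b" and xy: "x < m" "y < m" for a b x y
  proof -
    have "z * root a b 1 = root a b 1 * z"
      using z root_in_SO_derived[OF ab, of 1] unfolding group_center_def by simp
    then show ?thesis using mult_root[OF ab zm xy, of 1] root_mult_mat[OF ab zm xy, of 1] by simp
  qed
  \<comment> \<open>In the entry (x, b) of z u = u z, with u the root element for (a, b), only z_xa
    survives if x is neither a nor mir b; so b is chosen with mir b different from x.\<close>
  have col0: "z $$ (x, a) = 0" if a: "outer a" and x: "x < m" "x \<noteq> a" for a x
  proof -
    obtain b where b: "root_pair a b" "x \<noteq> mir b"
    proof (cases "outer x")
      case True
      then show ?thesis using root_pair_exists[OF a True] that by (metis mir_mir root_pairD(2))
    next
      case False
      then show ?thesis using root_pair_exists[OF a a] that root_pair_def outer_mir by metis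
    qed
    note D = root_pairD[OF b(1)]
    show ?thesis using eq[OF b(1) x(1) D(2)] b(2) D x by simp
  qed
  have diag: "z $$ (a, a) = z $$ (b, b)" if ab: "root_pair a b" for a b
  proof -
    note D = root_pairD[OF ab]
    show ?thesis using eq[OF ab D(1,2)] D by simp
  qed
  have row0: "z $$ (b, y) = 0" if b: "outer b" and y: "y < m" "y \<noteq> b" for b y
  proof -
    obtain a where "root_pair b a" using root_pair_exists[OF b b] by blast
    then have ab: "root_pair a b" using root_pairD[of b a] unfolding root_pair_def by auto
    note D = root_pairD[OF ab]
    have "outer (mir b)" using b by simp
    then have "z $$ (a, mir b) = 0" using col0[of "mir b" a] D by simp
    then show ?thesis using eq[OF ab D(1) y(1)] D y by (simp split: if_splits)
  qed
  define e where "e = z $$ (0, 0)"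
  have m0: "m \<ge> 1" using n_ge_3 m_cases by auto
  have o0: "outer 0" unfolding outer_iff using n_ge_3 m_cases by auto
  have om: "outer (mir 0)" using outer_mir[OF o0] .
  have diag_e: "z $$ (a, a) = e" if a: "outer a" for a
  proof -
    \<comment> \<open>The indices a and 0 do not form a root pair when a is 0 or mir 0, so their
      diagonal entries are compared through a third index l.\<close>
    obtain l where l: "outer l" "l \<noteq> a" "l \<noteq> mir a" "l \<noteq> 0" "l \<noteq> mir 0" using obtain_outer[OF a o0] by blast
    have "root_pair l a" "root_pair l 0" using l a o0 unfolding root_pair_def by auto
    then show ?thesis using diag unfolding e_def by metis
  qed
  have zv: "(z *\<^sub>v v) $ i = e * v $ i" if i: "outer i" and v: "v \<in> carrier_vec m" for v i
  proof -
    have "(z *\<^sub>v v) $ i = (\<Sum>j<m. z $$ (i, j) * v $ j)"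
      using i v by (simp add: scalar_prod_def lessThan_atLeast0)
    also have "\<dots> = (\<Sum>j<m. if j = i then e * v $ j else 0)"
      using row0[OF i] diag_e[OF i] by (intro sum.cong) auto
    finally show ?thesis using i by simp
  qed
  have pf: "preserves_form m z" by (rule carrier_SO_derivedD(3)[OF zc])
  have ee: "e * e = 1"
  proof (cases "even m")
    case True
    then have mn: "m = 2 * n" "m div 2 = n" using m_cases by auto
    \<comment> \<open>The coordinates 0 and mir 0 span a hyperbolic plane; this vector in it has the
      value 1, so preservation of the form reads e^2 = 1.\<close>
    define v :: "'k vec" where "v = vec m (\<lambda>i. if i = 0 \<or> i = mir 0 then 1 else 0)"
    have v: "v \<in> carrier_vec m" unfolding v_def by simp
    have "hyp_quadratic m (z *\<^sub>v v) = (\<Sum>i<n. e * e * (v $ i * v $ mir i))"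
      unfolding hyp_quadratic_def mn(2) mir_def[symmetric]
    proof (intro sum.cong refl)
      fix i assume "i \<in> {..<n}"
      then have "outer i" unfolding outer_iff by auto
      then show "(z *\<^sub>v v) $ i * (z *\<^sub>v v) $ mir i = e * e * (v $ i * v $ mir i)"
        unfolding zv[OF \<open>outer i\<close> v] zv[OF outer_mir[OF \<open>outer i\<close>] v] by simp
    qed
    then have "hyp_quadratic m (z *\<^sub>v v) = e * e * hyp_quadratic m v"
      unfolding hyp_quadratic_def mn(2) mir_def[symmetric] by (simp add: sum_distrib_left)
    moreover have "hyp_quadratic m v = (\<Sum>i<n. if i = 0 then 1 else 0)"
      unfolding hyp_quadratic_def mn(2) mir_def[symmetric]
    proof (intro sum.cong refl)
      fix i assume "i \<in> {..<n}"
      then have "i < n" by simp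
      then have i: "i < m" "i \<noteq> mir 0" "mir i \<noteq> 0" "0 < m" using mn(1) unfolding mir_def by linarith+
      then show "v $ i * v $ mir i = (if i = 0 then 1 else 0)"
        unfolding v_def using mir_inject[OF i(1,4)] by simp
    qed
    then have "hyp_quadratic m v = 1" using n_ge_3 by simp
    ultimately show ?thesis using pf True v unfolding preserves_form_def by auto
  next
    case False
    define v w :: "'k vec" where "v = unit_vec m 0" and "w = unit_vec m (mir 0)"
    have v: "v \<in> carrier_vec m" and w: "w \<in> carrier_vec m" unfolding v_def w_def by simp_all
    have zvw: "z *\<^sub>v v \<in> carrier_vec m" "z *\<^sub>v w \<in> carrier_vec m" by (rule mult_mat_vec_carrier[OF zm v], rule mult_mat_vec_carrier[OF zm w])
    have zx: "(z *\<^sub>v u) $ i = e * u $ i" if "u \<in> {v, w}" "i < m" for u i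
    proof (cases "outer i")
      case True then show ?thesis using zv v w that by auto
    next
      case False
      then have "i \<noteq> 0 \<and> i \<noteq> mir 0" using o0 om by metis
      then have "col z 0 $ i = 0" "col z (mir 0) $ i = 0" "i \<noteq> 0" "i \<noteq> mir 0"
        using m0 col0[OF o0, of i] col0[OF om, of i] o0 om that m0 by auto
      moreover have "z *\<^sub>v v = col z 0" "z *\<^sub>v w = col z (mir 0)"
        unfolding v_def w_def using outer_less[OF o0] outer_less[OF om] by (auto intro!: eq_vecI)
      ultimately show ?thesis using that m0 unfolding v_def w_def by auto
    qed
    have "J_bilinear m (z *\<^sub>v v) (z *\<^sub>v w) = e * e * J_bilinear m v w"
      unfolding J_bilinear_sum[OF zvw] J_bilinear_sum[OF v w] sum_distrib_left
    proof (intro sum.cong refl)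
      fix i assume "i \<in> {..<m}"
      then have i: "i < m" "m - 1 - i < m" by auto
      show "(z *\<^sub>v v) $ i * (z *\<^sub>v w) $ (m - 1 - i) = e * e * (v $ i * w $ (m - 1 - i))"
        using zx[of v, OF _ i(1)] zx[of w, OF _ i(2)] by (simp del: index_mult_mat_vec)
    qed
    moreover have "J_bilinear m v w = (\<Sum>i<m. if i = 0 then 1 else 0)"
      unfolding J_bilinear_sum[OF v w] using m0 by (intro sum.cong refl) (auto simp: v_def w_def mir_def)
    then have "J_bilinear m v w = 1" using m0 by simp
    ultimately show ?thesis using pf False v w unfolding preserves_form_def by auto
  qed
  have offdiag: "z $$ (i, j) = 0" if "i < m" "j < m" "i \<noteq> j" for i j
  proof -
    have "outer i \<or> outer j" using that unfolding outer_def mir_def by linarith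
    then show ?thesis using row0[of i j] col0[of j i] that by blast
  qed
  then have "upper_triangular z" by (auto simp: upper_triangular_def)
  then have "det z = prod_list (diag_mat z)" by (rule det_upper_triangular[OF _ zm])
  also have "\<dots> = (\<Prod>i<m. z $$ (i, i))" unfolding diag_mat_def
    by (simp add: prod.list_conv_set_nth lessThan_atLeast0)
  also have "\<dots> = (\<Prod>i\<in>{i. outer i}. z $$ (i, i)) * (\<Prod>i\<in>{i. i < m \<and> \<not> outer i}. z $$ (i, i))"
  proof (subst prod.union_disjoint[symmetric])
    show "finite {i. outer i}" by (rule finite_subset[of _ "{..<m}"]) auto
  qed (auto intro!: prod.cong)
  also have "(\<Prod>i\<in>{i. outer i}. z $$ (i, i)) = (\<Prod>i\<in>{i. outer i}. e)" by (intro prod.cong refl diag_e) simp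
  also have "\<dots> = 1" using ee by (simp add: card_outer power_mult power2_eq_square)
  \<comment> \<open>The 2n outer entries contribute e^(2n) = 1 to det z = 1, which leaves 1 for the
    middle entry if there is one.\<close>
  finally have mid: "(\<Prod>i\<in>{i. i < m \<and> \<not> outer i}. z $$ (i, i)) = 1"
    using carrier_SO_derivedD(2)[OF zc] by simp
  have "z $$ (i, i) = 1" if "i < m" "\<not> outer i" for i
  proof -
    have "{i. i < m \<and> \<not> outer i} = {i}" using that unfolding outer_def mir_def by auto
    then show ?thesis using mid by simp
  qed
  then have "z = sign_mat e" using offdiag diag_e unfolding sign_mat_def by (intro eq_matI) auto
  then show thesis using that ee by blast
qed

text \<open>\<open>j(A)\<close> is \<open>levi A (A\<^sup>-\<^sup>1)\<close>; carrying the inverse as an argument avoids \<open>inv\<close>.\<close>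

definition levi :: "'k mat \<Rightarrow> 'k mat \<Rightarrow> 'k mat" where
  "levi A B = mat m m (\<lambda>(i, j). if i < n \<and> j < n then A $$ (i, j)
     else if m - n \<le> i \<and> m - n \<le> j then B $$ (mir j, mir i)
     else if i = j then 1 else 0)"

lemma levi_carrier [simp]: "levi A B \<in> carrier_mat m m" "dim_row (levi A B) = m" "dim_col (levi A B) = m"
  unfolding levi_def by simp_all

lemma levi_index:
  "i < m \<Longrightarrow> j < m \<Longrightarrow> levi A B $$ (i, j) = (if i < n \<and> j < n then A $$ (i, j)
     else if m - n \<le> i \<and> m - n \<le> j then B $$ (mir j, mir i)
     else if i = j then 1 else 0)"
  unfolding levi_def by simp

lemma phi_eq:
  fixes A B :: "'k mat"
  assumes A: "A \<in> carrier_mat n n" and B: "B \<in> carrier_mat n n" and AB: "A * B = 1\<^sub>m n"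
    and ij: "i < n" "j < n"
  shows "phi n A $$ (i, j) = B $$ (n - 1 - j, n - 1 - i)"
proof -
  have J: "J_mat n \<in> carrier_mat n n" unfolding J_mat_def by simp
  have Jrow: "(J_mat n * M) $$ (a, b) = M $$ (n - 1 - a, b)" if "a < n" "b < n" "M \<in> carrier_mat n n" for a b and M :: "'k mat"
  proof -
    have "(J_mat n * M) $$ (a, b) = (\<Sum>k = 0..<n. (if Suc (a + k) = n then 1 else 0) * M $$ (k, b))"
      using that by (simp add: J_mat_def scalar_prod_def)
    also have "\<dots> = (\<Sum>k<n. (if k = n - 1 - a then M $$ (k, b) else 0))"
      unfolding lessThan_atLeast0 using that by (intro sum.cong) auto
    also have "\<dots> = M $$ (n - 1 - a, b)" using that by simp
    finally show ?thesis .
  qed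
  have Jcol: "(M * J_mat n) $$ (a, b) = M $$ (a, n - 1 - b)" if "a < n" "b < n" "M \<in> carrier_mat n n" for a b and M :: "'k mat"
  proof -
    have "(M * J_mat n) $$ (a, b) = (\<Sum>k = 0..<n. M $$ (a, k) * (if Suc (k + b) = n then 1 else 0))"
      using that by (simp add: J_mat_def scalar_prod_def)
    also have "\<dots> = (\<Sum>k<n. (if k = n - 1 - b then M $$ (a, k) else 0))"
      unfolding lessThan_atLeast0 using that by (intro sum.cong) auto
    also have "\<dots> = M $$ (a, n - 1 - b)" using that by simp
    finally show ?thesis .
  qed
  have "phi n A = J_mat n * B\<^sup>T * J_mat n" unfolding phi_def inv_GL[OF A B AB] ..
  then have "phi n A $$ (i, j) = (J_mat n * B\<^sup>T) $$ (i, n - 1 - j)"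
    using ij Jcol[OF ij, of "J_mat n * B\<^sup>T"] mult_carrier_mat[OF J, of "B\<^sup>T" n] B by simp
  also have "\<dots> = B\<^sup>T $$ (n - 1 - i, n - 1 - j)" using ij B by (intro Jrow) auto
  finally show ?thesis using ij B by simp
qed

lemma j_emb_levi:
  assumes A: "A \<in> carrier_mat n n" and B: "B \<in> carrier_mat n n" and AB: "A * B = 1\<^sub>m n"
  shows "j_emb n m A = levi A B"
proof -
  have phc: "phi n A \<in> carrier_mat n n" unfolding phi_def inv_GL[OF A B AB]
    by (intro mult_carrier_mat[of _ n n]) (use B in \<open>auto simp: J_mat_def\<close>)
  note ph = phi_eq[OF A B AB]
  show ?thesis
  proof (cases "m = 2 * n")
    case True
    have "j_emb n m A = four_block_mat A (0\<^sub>m n n) (0\<^sub>m n n) (phi n A)"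
    proof -
      have "four_block_mat C (0\<^sub>m n 0) (0\<^sub>m 0 n) (0\<^sub>m 0 0) = C" if "C \<in> carrier_mat n n" for C :: "'k mat"
        using that by (intro eq_matI) auto
      then show ?thesis unfolding j_emb_def using True A phc by (simp add: Let_def)
    qed
    also have "\<dots> = levi A B"
    proof (rule eq_matI)
      fix i j assume "i < dim_row (levi A B)" "j < dim_col (levi A B)"
      then have ij: "i < m" "j < m" by simp_all
      show "four_block_mat A (0\<^sub>m n n) (0\<^sub>m n n) (phi n A) $$ (i, j) = levi A B $$ (i, j)"
        unfolding levi_index[OF ij] mir_def using A phc ij True by (auto simp: ph mult_2)
    qed (unfold levi_carrier, use A phc True in simp_all)
    finally show ?thesis .
  next
    case False
    then have m: "m = 2 * n + 1" using m_cases by simp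
    have "j_emb n m A = four_block_mat A (0\<^sub>m n (n + 1)) (0\<^sub>m (n + 1) n)
       (four_block_mat (1\<^sub>m 1) (0\<^sub>m 1 n) (0\<^sub>m n 1) (phi n A))"
    proof -
      have "four_block_mat C (0\<^sub>m n 0) (0\<^sub>m 0 n) (0\<^sub>m 0 0) = C" if "C \<in> carrier_mat n n" for C :: "'k mat"
        using that by (intro eq_matI) auto
      then show ?thesis unfolding j_emb_def using m A phc by (simp add: Let_def)
    qed
    also have "\<dots> = levi A B"
    proof (rule eq_matI)
      fix i j assume "i < dim_row (levi A B)" "j < dim_col (levi A B)"
      then have ij: "i < m" "j < m" by simp_all
      show "four_block_mat A (0\<^sub>m n (n + 1)) (0\<^sub>m (n + 1) n)
          (four_block_mat (1\<^sub>m 1) (0\<^sub>m 1 n) (0\<^sub>m n 1) (phi n A)) $$ (i, j) = levi A B $$ (i, j)"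
        unfolding levi_index[OF ij] mir_def using A phc ij m by (auto simp: ph mult_2)
    qed (unfold levi_carrier, use A phc m in simp_all)
    finally show ?thesis .
  qed
qed

text \<open>The second arguments stand for inverses and multiply in the opposite order. The three
  ranges of the row index are those of the block of A, of the mirrored block, and of the middle
  entry.\<close>

lemma levi_mult:
  assumes A: "A \<in> carrier_mat n n" "B \<in> carrier_mat n n" and C: "C \<in> carrier_mat n n" "D \<in> carrier_mat n n"
  shows "levi A B * levi C D = levi (A * C) (D * B)"
proof (rule eq_matI)
  fix i j assume "i < dim_row (levi (A * C) (D * B))" "j < dim_col (levi (A * C) (D * B))"
  then have ij: "i < m" "j < m" by simp_all
  have nm: "n \<le> m - n" "m - n \<le> m" "n \<le> m" using m_cases by auto
  have sum: "(levi A B * levi C D) $$ (i, j) = (\<Sum>k<m. levi A B $$ (i, k) * levi C D $$ (k, j))"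
    using ij by (simp add: scalar_prod_def lessThan_atLeast0)
  consider "i < n" | "m - n \<le> i" | "n \<le> i" "i < m - n" by linarith
  then show "(levi A B * levi C D) $$ (i, j) = levi (A * C) (D * B) $$ (i, j)"
  proof cases
    case 1
    have "(\<Sum>k<m. levi A B $$ (i, k) * levi C D $$ (k, j)) = (\<Sum>k<n. A $$ (i, k) * levi C D $$ (k, j))"
      using 1 nm ij by (intro sum.mono_neutral_cong_right) (auto simp: levi_index)
    also have "\<dots> = (\<Sum>k<n. if j < n then A $$ (i, k) * C $$ (k, j) else 0)"
      using 1 nm ij by (intro sum.cong) (auto simp: levi_index)
    also have "\<dots> = levi (A * C) (D * B) $$ (i, j)"
      using 1 nm ij A C by (auto simp: levi_index scalar_prod_def lessThan_atLeast0)
    finally show ?thesis unfolding sum .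
  next
    case 2
    have "(\<Sum>k<m. levi A B $$ (i, k) * levi C D $$ (k, j)) = (\<Sum>k\<in>{m - n..<m}. B $$ (mir k, mir i) * levi C D $$ (k, j))"
      using 2 nm ij by (intro sum.mono_neutral_cong_right) (auto simp: levi_index)
    also have "\<dots> = (\<Sum>k<n. B $$ (k, mir i) * levi C D $$ (mir k, j))"
      by (rule sum.reindex_bij_witness[of _ mir mir]) (use nm in \<open>auto simp: mir_def\<close>)
    also have "\<dots> = (\<Sum>k<n. if m - n \<le> j then B $$ (k, mir i) * D $$ (mir j, k) else 0)"
    proof (intro sum.cong refl)
      fix k assume "k \<in> {..<n}"
      then have k: "k < m" "mir k < m" "m - n \<le> mir k" using nm unfolding mir_def by auto
      then show "B $$ (k, mir i) * levi C D $$ (mir k, j) = (if m - n \<le> j then B $$ (k, mir i) * D $$ (mir j, k) else 0)"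
        using nm ij unfolding levi_index[OF k(2) ij(2)] mir_mir[OF k(1)] by auto
    qed
    also have "\<dots> = levi (A * C) (D * B) $$ (i, j)"
    proof -
      have "mir i < n" using 2 ij unfolding mir_def by auto
      moreover have "mir j < n" if "m - n \<le> j" using that ij unfolding mir_def by auto
      ultimately show ?thesis unfolding levi_index[OF ij]
        using 2 nm ij A C by (auto simp: scalar_prod_def lessThan_atLeast0 mult.commute)
    qed
    finally show ?thesis unfolding sum .
  next
    case 3
    have "(\<Sum>k<m. levi A B $$ (i, k) * levi C D $$ (k, j)) = (\<Sum>k<m. if k = i then levi C D $$ (k, j) else 0)"
      using 3 nm ij by (intro sum.cong) (auto simp: levi_index)
    also have "\<dots> = levi (A * C) (D * B) $$ (i, j)" using 3 nm ij by (auto simp: levi_index)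
    finally show ?thesis unfolding sum .
  qed
qed simp_all

lemma levi_one: "levi (1\<^sub>m n) (1\<^sub>m n) = 1\<^sub>m m"
proof (rule eq_matI)
  fix i j assume "i < dim_row (1\<^sub>m m :: 'k mat)" "j < dim_col (1\<^sub>m m :: 'k mat)"
  then have ij: "i < m" "j < m" by simp_all
  have "mir i < n" if "m - n \<le> i" using that ij unfolding mir_def by auto
  moreover have "mir j < n" if "m - n \<le> j" using that ij unfolding mir_def by auto
  ultimately show "levi (1\<^sub>m n) (1\<^sub>m n) $$ (i, j) = 1\<^sub>m m $$ (i, j)"
    using ij mir_inject[OF ij(2,1)] unfolding levi_index[OF ij] by auto
qed simp_all

lemma addrow_mat_index:
  "i < n \<Longrightarrow> j < n \<Longrightarrow> addrow_mat n t a b $$ (i, j) = (if i = j then 1 else 0) + (if i = a \<and> j = b then t else (0::'k))"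
  by (auto simp: addrow_mat_def)

text \<open>The inverse transvection has parameter -t, and its mirrored transpose supplies the
  second off-diagonal term of the root element.\<close>

lemma levi_addrow:
  assumes ab: "a < n" "b < n" "a \<noteq> b"
  shows "levi (addrow_mat n t a b) (addrow_mat n (- t) a b) = root a b t"
proof (rule eq_matI)
  fix i j assume "i < dim_row (root a b t)" "j < dim_col (root a b t)"
  then have ij: "i < m" "j < m" by simp_all
  have nm: "n \<le> m - n" "m - n \<le> m" "n \<le> m" using m_cases by auto
  have ab': "a < m" "b < m" "m - n \<le> mir a" "m - n \<le> mir b" using ab nm unfolding mir_def by auto
  have i_mir: "i = mir b \<Longrightarrow> m - n \<le> i" and j_mir: "j = mir a \<Longrightarrow> m - n \<le> j" using ab' by blast+
  have disj: "\<not> (x < n \<and> m - n \<le> x)" for x using nm(1) by linarith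
  consider "i < n" "j < n" | "m - n \<le> i" "m - n \<le> j" | "\<not> (i < n \<and> j < n)" "\<not> (m - n \<le> i \<and> m - n \<le> j)" by blast
  then show "levi (addrow_mat n t a b) (addrow_mat n (- t) a b) $$ (i, j) = root a b t $$ (i, j)"
  proof cases
    case 1
    then have "\<not> (i = mir b \<and> j = mir a)" using i_mir disj by blast
    then have "root a b t $$ (i, j) = addrow_mat n t a b $$ (i, j)"
      unfolding root_index[OF ij] addrow_mat_index[OF 1] by (simp only: if_False diff_zero)
    then show ?thesis unfolding levi_index[OF ij] using 1 by simp
  next
    case 2
    then have mi: "mir i < n" "mir j < n" using ij unfolding mir_def by auto
    have eqs: "i = mir b \<longleftrightarrow> mir i = b" "j = mir a \<longleftrightarrow> mir j = a" "i = j \<longleftrightarrow> mir j = mir i"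
      using mir_eq_iff[OF ij(1) ab'(2)] mir_eq_iff[OF ij(2) ab'(1)] mir_inject[OF ij(2,1)] by auto
    have n12: "\<not> (i = a \<and> j = b)" "\<not> (i < n \<and> j < n)" using disj 2 ab by blast+
    have "levi (addrow_mat n t a b) (addrow_mat n (- t) a b) $$ (i, j) = addrow_mat n (- t) a b $$ (mir j, mir i)"
      unfolding levi_index[OF ij] using n12(2) 2 by (simp only: if_False if_True simp_thms)
    also have "\<dots> = (if mir j = mir i then 1 else 0) - (if mir i = b \<and> mir j = a then t else 0)"
      unfolding addrow_mat_index[OF mi(2,1)] by simp
    also have "\<dots> = root a b t $$ (i, j)"
      unfolding root_index[OF ij] eqs using n12(1) by (simp only: if_False add_0_right)
    finally show ?thesis .
  next
    case 3
    then have "\<not> (i = a \<and> j = b)" "\<not> (i = mir b \<and> j = mir a)" using i_mir j_mir ab by blast+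
    then have "root a b t $$ (i, j) = (if i = j then 1 else 0)"
      unfolding root_index[OF ij] by (simp only: if_False add_0_right diff_zero)
    then show ?thesis unfolding levi_index[OF ij] using 3 by (simp only: if_False)
  qed
qed simp_all

text \<open>Membership in the derived group comes from generators: transvections generate SL_n(q)
  and are sent to root elements, which are commutators. No spinor norm has to be computed.\<close>

lemma levi_in_SO_derived:
  assumes g: "g \<in> carrier_mat n n" "h \<in> carrier_mat n n" "g * h = 1\<^sub>m n" "rational g" "det g = 1"
  shows "levi g h \<in> carrier (SO_derived q m)"
proof -
  interpret group "SO_derived q m :: 'k mat monoid" by (rule group_SO_derived)
  from g(1,4,5) have "\<exists>h. h \<in> carrier_mat n n \<and> g * h = 1\<^sub>m n \<and> levi g h \<in> carrier (SO_derived q m)"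
  proof (induction rule: SL_transvection_induct)
    case one
    have "levi (1\<^sub>m n) (1\<^sub>m n) \<in> carrier (SO_derived q m)" using one_closed levi_one by simp
    then show ?case by (intro exI[of _ "1\<^sub>m n"]) auto
  next
    case (step f i j t)
    from step.IH obtain f' where f': "f' \<in> carrier_mat n n" "f * f' = 1\<^sub>m n" "levi f f' \<in> carrier (SO_derived q m)" by blast
    define e e' where "e = addrow_mat n t i j" and "e' = addrow_mat n (- t) i j"
    have ee: "e \<in> carrier_mat n n" "e' \<in> carrier_mat n n" "e * e' = 1\<^sub>m n"
      unfolding e_def e'_def using addrow_mat_inv[OF step.hyps(2-4)] by auto
    have "root_pair i j" using step.hyps(2-4) m_cases unfolding root_pair_def outer_iff mir_def by auto
    then have "levi e e' \<in> carrier (SO_derived q m)"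
      unfolding e_def e'_def levi_addrow[OF step.hyps(2-4)] using step.hyps(5) by (intro root_in_SO_derived)
    from m_closed[OF this f'(3)] have "levi (e * f) (f' * e') \<in> carrier (SO_derived q m)"
      using levi_mult[OF ee(1,2) step.hyps(1) f'(1)] by simp
    moreover have "(e * f) * (f' * e') = 1\<^sub>m n"
    proof -
      have "(e * f) * (f' * e') = e * ((f * f') * e')"
        using ee(1,2) step.hyps(1) f'(1) by (simp add: mult_mat_assoc)
      then show ?thesis using ee f'(2) by (simp add: mat_ring)
    qed
    moreover have "f' * e' \<in> carrier_mat n n" using f'(1) ee by simp
    ultimately show ?case unfolding e_def by blast
  qed
  then obtain h' where h': "h' \<in> carrier_mat n n" "g * h' = 1\<^sub>m n" "levi g h' \<in> carrier (SO_derived q m)" by blast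
  \<comment> \<open>The induction produces some inverse h' of g; uniqueness of the inverse
    identifies it with the given h.\<close>
  have "h' = h * g * h'" using mat_mult_left_right_inverse[OF g(1-3)] h'(1) by simp
  also have "\<dots> = h" using g(1,2) h'(1,2) by (simp add: mult_mat_assoc)
  finally show ?thesis using h'(3) by simp
qed

end

section \<open>Collapsing detected on an invariant subspace\<close>

lemma smult_mat_mult_left: "dim_col A = dim_row B \<Longrightarrow> (c \<cdot>\<^sub>m A) * B = c \<cdot>\<^sub>m (A * B :: 'k::comm_ring_1 mat)"
  by (rule mult_smult_assoc_mat[of _ "dim_row A" "dim_col A" _ "dim_col B"]) auto

lemma smult_mat_mult_right: "dim_col A = dim_row B \<Longrightarrow> A * (c \<cdot>\<^sub>m B) = c \<cdot>\<^sub>m (A * B :: 'k::comm_ring_1 mat)"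
  by (rule mult_smult_distrib[of _ "dim_row A" "dim_col A" _ "dim_col B"]) auto

lemma smult_mat_add: "dim_row A = dim_row B \<Longrightarrow> dim_col A = dim_col B \<Longrightarrow>
   c \<cdot>\<^sub>m (A + B) = c \<cdot>\<^sub>m A + c \<cdot>\<^sub>m (B :: 'k::comm_ring_1 mat)"
  by (rule eq_matI) (auto simp: distrib_left)

lemma smult_smult_mat: "a \<cdot>\<^sub>m (b \<cdot>\<^sub>m A) = (a * b) \<cdot>\<^sub>m (A :: 'k::comm_ring_1 mat)"
  by (rule eq_matI) (auto simp: mult.assoc)

lemma one_smult_mat [simp]: "1 \<cdot>\<^sub>m A = (A :: 'k::comm_ring_1 mat)"
  by (rule eq_matI) auto

lemma right_inverse_cancel:
  assumes "B \<in> carrier_mat l l" "B' \<in> carrier_mat l l" "B * B' = 1\<^sub>m l" "M \<in> carrier_mat k l" "N \<in> carrier_mat k l" "M * B = N * (B :: 'k::field mat)"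
  shows "M = N"
proof -
  have [simp]: "dim_row B = l" "dim_col B = l" "dim_row B' = l" "dim_col B' = l" "dim_row M = k" "dim_col M = l" "dim_row N = k" "dim_col N = l"
    using assms by auto
  have "M = (M * B) * B'" using assms(3) by (simp add: mat_ring)
  also have "\<dots> = N" unfolding assms(6) using assms(3) by (simp add: mat_ring)
  finally show ?thesis .
qed

context orthogonal_setting
begin

text \<open>The reason why the invariant subspace must avoid the middle coordinate: there the center
  acts by a scalar sign.\<close>

lemma sign_mat_mult:
  assumes E: "E \<in> carrier_mat m l" "\<And>i j. i < m \<Longrightarrow> j < l \<Longrightarrow> \<not> outer i \<Longrightarrow> E $$ (i, j) = 0"
  shows "sign_mat e * E = e \<cdot>\<^sub>m E"
proof (rule eq_matI)
  fix i j assume "i < dim_row (e \<cdot>\<^sub>m E)" "j < dim_col (e \<cdot>\<^sub>m E)"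
  then have ij: "i < m" "j < l" using E(1) by auto
  have "(sign_mat e * E) $$ (i, j) = (\<Sum>k<m. sign_mat e $$ (i, k) * E $$ (k, j))"
    using ij E(1) by (simp add: scalar_prod_def lessThan_atLeast0 sign_mat_def)
  also have "\<dots> = (\<Sum>k<m. (if k = i then (if outer i then e else 1) * E $$ (k, j) else 0))"
    using ij by (intro sum.cong) (auto simp: sign_mat_def)
  also have "\<dots> = e * E $$ (i, j)" using ij E(2)[OF ij] by simp
  finally show "(sign_mat e * E) $$ (i, j) = (e \<cdot>\<^sub>m E) $$ (i, j)" using ij E(1) by simp
qed (use E in \<open>auto simp: sign_mat_def\<close>)

text \<open>The columns of E span a subspace stable under r and s, which act on it by B and B'. The
  left inverse L makes E injective, and the support on outer indices makes the center act by signs.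
  The inequalities \<open>c1\<close> and \<open>c2\<close> are between matrices; that they persist
  modulo the center is part of the proof.\<close>

lemma collapse_criterion:
  fixes r s s' r' x E L B B' :: "'k mat"
  assumes r: "r \<in> carrier (SO_derived q m)" and x: "x \<in> carrier (SO_derived q m)"
    and sm: "s \<in> carrier_mat m m" and sx: "s * x = x * r"
    and r': "r' \<in> carrier_mat m m" "r * r' = 1\<^sub>m m" and s': "s' \<in> carrier_mat m m" "s * s' = 1\<^sub>m m"
    and E: "E \<in> carrier_mat m l" "\<And>i j. i < m \<Longrightarrow> j < l \<Longrightarrow> \<not> outer i \<Longrightarrow> E $$ (i, j) = 0"
    and L: "L \<in> carrier_mat l m" "L * E = 1\<^sub>m l"
    and B: "B \<in> carrier_mat l l" "B' \<in> carrier_mat l l" and rE: "r * E = E * B" and sE: "s * E = E * B'"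
    and BB: "B * B' = B' * B \<or> B * B' = - (B' * B)" and ne: "B' \<noteq> B" "B' \<noteq> - B"
    and c1: "r * (s * r * s') \<noteq> s * r * s' * r"
    and c2: "s * (r * s * r') \<noteq> r * s * r' * s"
  shows "collapses (PSO_derived q m) (conj_class (PSO_derived q m) (proj q m r))"
proof -
  let ?G = "SO_derived q m :: 'k mat monoid"
  let ?Z = "group_center ?G"
  interpret G: group ?G by (rule group_SO_derived)
  interpret h: group_hom ?G "?G Mod ?Z" "\<lambda>a. ?Z #>\<^bsub>?G\<^esub> a" by (rule G.quotient_center_hom)
  note rm = carrier_SO_derivedD(1)[OF r] and xm = carrier_SO_derivedD(1)[OF x]
  obtain x' where x': "x' \<in> carrier_mat m m" "x * x' = 1\<^sub>m m"
    using inv_SO_derivedD[OF x] by blast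
  have [simp]: "dim_row r = m" "dim_col r = m" "dim_row s = m" "dim_col s = m" "dim_row x = m" "dim_col x = m"
    "dim_row r' = m" "dim_col r' = m" "dim_row s' = m" "dim_col s' = m" "dim_row x' = m" "dim_col x' = m"
    "dim_row E = m" "dim_col E = l" "dim_row L = l" "dim_col L = m"
    "dim_row B = l" "dim_col B = l" "dim_row B' = l" "dim_col B' = l"
    using rm xm sm r' s' x' E L B by auto
  have s_eq: "s = x * r * x'"
  proof -
    have "s = s * (x * x')" unfolding x'(2) by (simp add: mat_ring)
    also have "\<dots> = (s * x) * x'" by (simp add: mat_ring)
    finally show ?thesis unfolding sx .
  qed
  have s_conj: "s = x \<otimes>\<^bsub>?G\<^esub> r \<otimes>\<^bsub>?G\<^esub> inv\<^bsub>?G\<^esub> x"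
    using s_eq inv_SO_derived[OF x x'] by simp
  then have s: "s \<in> carrier ?G" using x r by (simp only: G.m_closed G.inv_closed)
  have inverses: "inv\<^bsub>?G\<^esub> r = r'" "inv\<^bsub>?G\<^esub> s = s'" using inv_SO_derived[OF r r'] inv_SO_derived[OF s s'] by auto
  have left_inj: "M = N" if "E * M = E * N" "M \<in> carrier_mat l k" "N \<in> carrier_mat l k" for M N k
  proof -
    have "M = (L * E) * M" using that L by simp
    also have "\<dots> = L * (E * N)" using that by (simp add: mat_ring)
    also have "\<dots> = (L * E) * N" using that(2,3) by (simp add: mat_ring)
    finally show ?thesis using that L by simp
  qed
  \<comment> \<open>Inverses stabilize the subspace as well; L extracts the matrix by which they
    act.\<close>
  have inverse_block: "\<exists>D'. D' \<in> carrier_mat l l \<and> D * D' = 1\<^sub>m l \<and> D' * D = 1\<^sub>m l \<and> g' * E = E * D'"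
    if g: "g \<in> carrier_mat m m" "g' \<in> carrier_mat m m" "g * g' = 1\<^sub>m m" and D: "D \<in> carrier_mat l l" "g * E = E * D" for g g' D
  proof -
    have [simp]: "dim_row g = m" "dim_col g = m" "dim_row g' = m" "dim_col g' = m" "dim_row D = l" "dim_col D = l" using g D by auto
    define D' where "D' = L * (g' * E)"
    have D'm: "D' \<in> carrier_mat l l" unfolding D'_def by auto
    then have [simp]: "dim_row D' = l" "dim_col D' = l" by auto
    have g'g: "g' * g = 1\<^sub>m m" by (rule mat_mult_left_right_inverse[OF g])
    have "g' * E * D = g' * (g * E)" unfolding D(2) by (simp add: mat_ring)
    also have "\<dots> = (g' * g) * E" by (simp add: mat_ring)
    also have "\<dots> = E" unfolding g'g by (simp add: mat_ring)
    finally have 1: "g' * E * D = E" .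
    have "D' * D = L * (g' * E * D)" unfolding D'_def by (simp add: mat_ring)
    then have D'D: "D' * D = 1\<^sub>m l" unfolding 1 L(2) .
    then have DD': "D * D' = 1\<^sub>m l" using mat_mult_left_right_inverse[OF D'm D(1)] by simp
    have "g' * E = g' * E * (D * D')" unfolding DD' by (simp add: mat_ring)
    also have "\<dots> = (g' * E * D) * D'" by (simp add: mat_ring)
    finally show ?thesis unfolding 1 using D'm D'D DD' by blast
  qed
  obtain Bi where Bi: "Bi \<in> carrier_mat l l" "B * Bi = 1\<^sub>m l" "Bi * B = 1\<^sub>m l" "r' * E = E * Bi"
    using inverse_block[OF rm r' B(1) rE] by blast
  obtain Bi' where Bi': "Bi' \<in> carrier_mat l l" "B' * Bi' = 1\<^sub>m l" "Bi' * B' = 1\<^sub>m l" "s' * E = E * Bi'"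
    using inverse_block[OF sm s' B(2) sE] by blast
  have [simp]: "dim_row Bi = l" "dim_col Bi = l" "dim_row Bi' = l" "dim_col Bi' = l" using Bi Bi' by auto
  \<comment> \<open>Both alternatives of \<open>BB\<close> are merged into one sign. If both hold,
    either choice serves.\<close>
  define e0 :: 'k where "e0 = (if B * B' = B' * B then 1 else - 1)"
  have e0: "e0 * e0 = 1" unfolding e0_def by simp
  have comm: "B * B' = e0 \<cdot>\<^sub>m (B' * B)" using BB unfolding e0_def by (auto intro!: eq_matI)
  have comm': "B' * B = e0 \<cdot>\<^sub>m (B * B')" unfolding comm by (simp add: smult_smult_mat e0)
  have conj_block: "C * D * Ci = e0 \<cdot>\<^sub>m D"
    if "C * D = e0 \<cdot>\<^sub>m (D * C)" "C * Ci = 1\<^sub>m l" "C \<in> carrier_mat l l" "Ci \<in> carrier_mat l l" "D \<in> carrier_mat l l" for C D Ci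
  proof -
    have [simp]: "dim_row C = l" "dim_col C = l" "dim_row Ci = l" "dim_col Ci = l" "dim_row D = l" "dim_col D = l"
      using that by auto
    have "C * D * Ci = e0 \<cdot>\<^sub>m (D * (C * Ci))" unfolding that(1) by (simp add: mat_ring smult_mat_mult_left)
    then show ?thesis unfolding that(2) by (simp add: mat_ring)
  qed
  \<comment> \<open>On the subspace f acts by D and its conjugate g f g^-1 by e0 D, so both products
    act by e0 D^2. A central z between them therefore acts there as 1 and is the identity.\<close>
  have sq: "f * (g * f * g') = g * f * g' * f"
    if eq: "z \<in> ?Z" "f * (g * f * g') = z * (g * f * g' * f)"
      and car: "f \<in> carrier_mat m m" "g \<in> carrier_mat m m" "g' \<in> carrier_mat m m"
      and D: "D \<in> carrier_mat l l" "f * E = E * D" "Di \<in> carrier_mat l l" "D * Di = 1\<^sub>m l"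
      and C: "C \<in> carrier_mat l l" "g * E = E * C" "Ci \<in> carrier_mat l l" "C * Ci = 1\<^sub>m l" "g' * E = E * Ci"
      and CD: "C * D = e0 \<cdot>\<^sub>m (D * C)" for z f g g' D Di C Ci
  proof -
    have [simp]: "dim_row f = m" "dim_col f = m" "dim_row g = m" "dim_col g = m" "dim_row g' = m" "dim_col g' = m"
      "dim_row D = l" "dim_col D = l" "dim_row Di = l" "dim_col Di = l" "dim_row C = l" "dim_col C = l" "dim_row Ci = l" "dim_col Ci = l"
      using car D C by auto
    obtain e where e: "e * e = 1" "z = sign_mat e" using center_SO_derived[OF eq(1)] .
    have "g * f * g' * E = g * (f * (E * Ci))" using C(5) by (simp add: mat_ring)
    also have "\<dots> = g * ((f * E) * Ci)" by (simp add: mat_ring)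
    also have "\<dots> = (g * E) * (D * Ci)" unfolding D(2) by (simp add: mat_ring)
    also have "\<dots> = E * (C * D * Ci)" unfolding C(2) by (simp add: mat_ring)
    finally have t: "g * f * g' * E = E * (e0 \<cdot>\<^sub>m D)" using conj_block[OF CD C(4,1,3) D(1)] by simp
    have "f * (g * f * g') * E = f * (g * f * g' * E)" by (simp add: mat_ring)
    also have "\<dots> = (f * E) * (e0 \<cdot>\<^sub>m D)" unfolding t by (simp add: mat_ring)
    also have "\<dots> = E * (e0 \<cdot>\<^sub>m (D * D))" unfolding D(2) by (simp add: mat_ring smult_mat_mult_right)
    finally have 1: "f * (g * f * g') * E = E * (e0 \<cdot>\<^sub>m (D * D))" .
    have "g * f * g' * f * E = (g * f * g') * (f * E)" by (simp add: mat_ring)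
    also have "\<dots> = (g * f * g' * E) * D" unfolding D(2) by (simp add: mat_ring)
    also have "\<dots> = E * (e0 \<cdot>\<^sub>m (D * D))" unfolding t by (simp add: mat_ring smult_mat_mult_left)
    finally have 2: "g * f * g' * f * E = E * (e0 \<cdot>\<^sub>m (D * D))" .
    have zE: "z * E = e \<cdot>\<^sub>m E" unfolding e(2) by (rule sign_mat_mult[OF E])
    have "z \<in> carrier_mat m m" unfolding e(2) sign_mat_def by simp
    then have [simp]: "dim_row z = m" "dim_col z = m" by auto
    have "E * (e0 \<cdot>\<^sub>m (D * D)) = z * (g * f * g' * f) * E" using 1 eq(2) by simp
    also have "\<dots> = z * (g * f * g' * f * E)" by (simp add: mat_ring)
    also have "\<dots> = (z * E) * (e0 \<cdot>\<^sub>m (D * D))" unfolding 2 by (simp add: mat_ring)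
    also have "\<dots> = E * (e \<cdot>\<^sub>m (e0 \<cdot>\<^sub>m (D * D)))" unfolding zE
      by (simp add: smult_mat_mult_left smult_mat_mult_right smult_smult_mat mult.commute)
    finally have "e0 \<cdot>\<^sub>m (D * D) = e \<cdot>\<^sub>m (e0 \<cdot>\<^sub>m (D * D))"
      by (rule left_inj[of _ _ l]) (use D(1) in auto)
    then have ee: "e0 \<cdot>\<^sub>m (e0 \<cdot>\<^sub>m (D * D)) = e0 \<cdot>\<^sub>m (e \<cdot>\<^sub>m (e0 \<cdot>\<^sub>m (D * D)))" by (rule arg_cong)
    have e0e: "e0 * (e * e0) = e" using e0 by (metis mult.assoc mult.commute mult_1)
    have "1\<^sub>m l * D * D = e0 \<cdot>\<^sub>m (e0 \<cdot>\<^sub>m (D * D))" by (simp add: mat_ring smult_smult_mat e0)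
    also note ee
    also have "e0 \<cdot>\<^sub>m (e \<cdot>\<^sub>m (e0 \<cdot>\<^sub>m (D * D))) = e \<cdot>\<^sub>m (D * D)" by (simp only: smult_smult_mat e0e)
    also have "\<dots> = e \<cdot>\<^sub>m 1\<^sub>m l * D * D" by (simp add: mat_ring smult_mat_mult_left)
    finally have "1\<^sub>m l * D * D = e \<cdot>\<^sub>m 1\<^sub>m l * D * D" .
    from right_inverse_cancel[OF D(1,3,4) _ _ this, of l] have "1\<^sub>m l * D = e \<cdot>\<^sub>m 1\<^sub>m l * D"
      using D(1) by (simp add: carrier_matI)
    from right_inverse_cancel[OF D(1,3,4) _ _ this, of l] have "1\<^sub>m l = e \<cdot>\<^sub>m (1\<^sub>m l :: 'k mat)"
      by (simp add: carrier_matI)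
    \<comment> \<open>For l = 0 all matrices of size l would be equal, against B' \<noteq> B; hence
      e can be read off from an entry of the identity.\<close>
    moreover have "l \<noteq> 0" using ne(1) B by (metis eq_matI carrier_matD less_nat_zero_code)
    ultimately have "(1\<^sub>m l :: 'k mat) $$ (0, 0) = (e \<cdot>\<^sub>m 1\<^sub>m l) $$ (0, 0)" by metis
    then have "e = 1" using \<open>l \<noteq> 0\<close> by simp
    then have "z = 1\<^sub>m m" unfolding e(2) sign_mat_def by (intro eq_matI) auto
    then show ?thesis using eq(2) by (simp add: mat_ring)
  qed
  have "type_C (?G Mod ?Z) (conj_class (?G Mod ?Z) (?Z #>\<^bsub>?G\<^esub> r))"
  proof (rule h.type_C_image_criterion[OF _ r x s_conj])
    show "finite (carrier (?G Mod ?Z))"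
      unfolding FactGroup_def RCOSETS_def using finite_SO_derived by simp
    show "?Z #>\<^bsub>?G\<^esub> (r \<otimes>\<^bsub>?G\<^esub> (s \<otimes>\<^bsub>?G\<^esub> r \<otimes>\<^bsub>?G\<^esub> inv\<^bsub>?G\<^esub> s)) \<noteq>
      ?Z #>\<^bsub>?G\<^esub> (s \<otimes>\<^bsub>?G\<^esub> r \<otimes>\<^bsub>?G\<^esub> inv\<^bsub>?G\<^esub> s \<otimes>\<^bsub>?G\<^esub> r)"
    proof
      assume "?Z #>\<^bsub>?G\<^esub> (r \<otimes>\<^bsub>?G\<^esub> (s \<otimes>\<^bsub>?G\<^esub> r \<otimes>\<^bsub>?G\<^esub> inv\<^bsub>?G\<^esub> s)) =
        ?Z #>\<^bsub>?G\<^esub> (s \<otimes>\<^bsub>?G\<^esub> r \<otimes>\<^bsub>?G\<^esub> inv\<^bsub>?G\<^esub> s \<otimes>\<^bsub>?G\<^esub> r)"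
      from G.center_coset_eqD[OF this] obtain z where z: "z \<in> ?Z"
        "r \<otimes>\<^bsub>?G\<^esub> (s \<otimes>\<^bsub>?G\<^esub> r \<otimes>\<^bsub>?G\<^esub> inv\<^bsub>?G\<^esub> s) = z \<otimes>\<^bsub>?G\<^esub> (s \<otimes>\<^bsub>?G\<^esub> r \<otimes>\<^bsub>?G\<^esub> inv\<^bsub>?G\<^esub> s \<otimes>\<^bsub>?G\<^esub> r)"
        using r s by (metis G.m_closed G.inv_closed)
      have "r * (s * r * s') = s * r * s' * r"
        by (rule sq[OF z(1) _ rm sm s'(1) B(1) rE Bi(1,2) B(2) sE Bi'(1,2,4) comm']) (use z(2) inverses in simp)
      then show False using c1 by simp
    qed
    show "?Z #>\<^bsub>?G\<^esub> (s \<otimes>\<^bsub>?G\<^esub> (r \<otimes>\<^bsub>?G\<^esub> s \<otimes>\<^bsub>?G\<^esub> inv\<^bsub>?G\<^esub> r)) \<noteq>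
      ?Z #>\<^bsub>?G\<^esub> (r \<otimes>\<^bsub>?G\<^esub> s \<otimes>\<^bsub>?G\<^esub> inv\<^bsub>?G\<^esub> r \<otimes>\<^bsub>?G\<^esub> s)"
    proof
      assume "?Z #>\<^bsub>?G\<^esub> (s \<otimes>\<^bsub>?G\<^esub> (r \<otimes>\<^bsub>?G\<^esub> s \<otimes>\<^bsub>?G\<^esub> inv\<^bsub>?G\<^esub> r)) =
        ?Z #>\<^bsub>?G\<^esub> (r \<otimes>\<^bsub>?G\<^esub> s \<otimes>\<^bsub>?G\<^esub> inv\<^bsub>?G\<^esub> r \<otimes>\<^bsub>?G\<^esub> s)"
      from G.center_coset_eqD[OF this] obtain z where z: "z \<in> ?Z"
        "s \<otimes>\<^bsub>?G\<^esub> (r \<otimes>\<^bsub>?G\<^esub> s \<otimes>\<^bsub>?G\<^esub> inv\<^bsub>?G\<^esub> r) = z \<otimes>\<^bsub>?G\<^esub> (r \<otimes>\<^bsub>?G\<^esub> s \<otimes>\<^bsub>?G\<^esub> inv\<^bsub>?G\<^esub> r \<otimes>\<^bsub>?G\<^esub> s)"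
        using r s by (metis G.m_closed G.inv_closed)
      have "s * (r * s * r') = r * s * r' * s"
        by (rule sq[OF z(1) _ sm rm r'(1) B(2) sE Bi'(1,2) B(1) rE Bi(1,2,4) comm]) (use z(2) inverses in simp)
      then show False using c2 by simp
    qed
    fix g assume g: "g \<in> generate ?G {r, s}"
    then have gG: "g \<in> carrier ?G" using G.generate_in_carrier[of "{r, s}"] r s by blast
    show "?Z #>\<^bsub>?G\<^esub> s \<noteq> ?Z #>\<^bsub>?G\<^esub> (g \<otimes>\<^bsub>?G\<^esub> r \<otimes>\<^bsub>?G\<^esub> inv\<^bsub>?G\<^esub> g)"
    proof
      assume "?Z #>\<^bsub>?G\<^esub> s = ?Z #>\<^bsub>?G\<^esub> (g \<otimes>\<^bsub>?G\<^esub> r \<otimes>\<^bsub>?G\<^esub> inv\<^bsub>?G\<^esub> g)"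
      from G.center_coset_eqD[OF this] obtain z where z: "z \<in> ?Z"
        "s = z \<otimes>\<^bsub>?G\<^esub> (g \<otimes>\<^bsub>?G\<^esub> r \<otimes>\<^bsub>?G\<^esub> inv\<^bsub>?G\<^esub> g)"
        using r s gG by (metis G.m_closed G.inv_closed)
      obtain e where e: "e * e = 1" "z = sign_mat e" using center_SO_derived[OF z(1)] .
      note gm = carrier_SO_derivedD(1)[OF gG] and g' = inv_SO_derivedD[OF gG]
      have [simp]: "dim_row z = m" "dim_col z = m" unfolding e(2) sign_mat_def by auto
      have [simp]: "dim_row g = m" "dim_col g = m" "dim_row (inv\<^bsub>?G\<^esub> g) = m" "dim_col (inv\<^bsub>?G\<^esub> g) = m"
        using gm g'(1) by auto
      have "s * g = z * (g * r) * (inv\<^bsub>?G\<^esub> g * g)" by (subst z(2)) (simp add: mat_ring)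
      then have sg: "s * g = z * (g * r)" unfolding g'(3) by (simp add: mat_ring)
      \<comment> \<open>Every word g in r and s acts by an invertible D that commutes with B up to a
        sign d; for s this is the hypothesis on B and B', and products and inverses preserve
        it.\<close>
      have "\<exists>D Di d. D \<in> carrier_mat l l \<and> Di \<in> carrier_mat l l \<and> D * Di = 1\<^sub>m l \<and> g * E = E * D
          \<and> d * d = 1 \<and> D * B = d \<cdot>\<^sub>m (B * D)"
        using g
      proof (induction rule: generate.induct)
        case one
        show ?case by (intro exI[of _ "1\<^sub>m l"] exI[of _ "1 :: 'k"]) (use B E in \<open>auto simp: mat_ring\<close>)
      next
        case (incl g)
        then consider "g = r" | "g = s" by blast
        then show ?case
        proof cases
          case 1
          show ?thesis unfolding 1
            by (intro exI[of _ B] exI[of _ Bi] exI[of _ "1 :: 'k"] conjI B(1) Bi(1,2) rE) simp_all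
        next
          case 2
          show ?thesis unfolding 2
            by (intro exI[of _ B'] exI[of _ Bi'] exI[of _ e0] conjI B(2) Bi'(1,2) sE comm' e0)
        qed
      next
        case (inv g)
        then consider "g = r" | "g = s" by blast
        then show ?case
        proof cases
          case 1
          show ?thesis unfolding 1 inverses(1)
            by (intro exI[of _ Bi] exI[of _ B] exI[of _ "1 :: 'k"] conjI B(1) Bi(1,3,4)) (simp_all add: Bi(2,3))
        next
          case 2
          have "Bi' * B = Bi' * (B * (B' * Bi'))" unfolding Bi'(2) by (simp add: mat_ring)
          also have "\<dots> = Bi' * ((B * B') * Bi')" by (simp add: mat_ring)
          also have "\<dots> = e0 \<cdot>\<^sub>m ((Bi' * B') * B * Bi')" unfolding comm
            by (simp add: mat_ring smult_mat_mult_left smult_mat_mult_right)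
          also have "\<dots> = e0 \<cdot>\<^sub>m (B * Bi')" unfolding Bi'(3) by (simp add: mat_ring)
          finally have Bi'_B: "Bi' * B = e0 \<cdot>\<^sub>m (B * Bi')" .
          show ?thesis unfolding 2 inverses(2)
            by (intro exI[of _ Bi'] exI[of _ B'] exI[of _ e0] conjI B(2) Bi'(1,3,4) e0 Bi'_B)
        qed
      next
        case (eng g1 g2)
        obtain D1 Di1 d1 where 1: "D1 \<in> carrier_mat l l" "Di1 \<in> carrier_mat l l" "D1 * Di1 = 1\<^sub>m l" "g1 * E = E * D1"
          "d1 * d1 = 1" "D1 * B = d1 \<cdot>\<^sub>m (B * D1)" using eng.IH(1) by blast
        obtain D2 Di2 d2 where 2: "D2 \<in> carrier_mat l l" "Di2 \<in> carrier_mat l l" "D2 * Di2 = 1\<^sub>m l" "g2 * E = E * D2"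
          "d2 * d2 = 1" "D2 * B = d2 \<cdot>\<^sub>m (B * D2)" using eng.IH(2) by blast
        have "g1 \<in> carrier ?G" "g2 \<in> carrier ?G" using eng.hyps G.generate_in_carrier[of "{r, s}"] r s by blast+
        then have "g1 \<in> carrier_mat m m" "g2 \<in> carrier_mat m m" using carrier_SO_derivedD(1) by blast+
        then have [simp]: "dim_row g1 = m" "dim_col g1 = m" "dim_row g2 = m" "dim_col g2 = m" by auto
        have [simp]: "dim_row D1 = l" "dim_col D1 = l" "dim_row D2 = l" "dim_col D2 = l"
          "dim_row Di1 = l" "dim_col Di1 = l" "dim_row Di2 = l" "dim_col Di2 = l" using 1 2 by auto
        have "D1 * D2 * (Di2 * Di1) = D1 * (D2 * Di2) * Di1" by (simp add: mat_ring)
        then have "D1 * D2 * (Di2 * Di1) = 1\<^sub>m l" unfolding 2(3) using 1(3) by (simp add: mat_ring)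
        moreover have "g1 * g2 * E = E * (D1 * D2)"
        proof -
          have "g1 * g2 * E = g1 * (g2 * E)" by (simp add: mat_ring)
          also have "\<dots> = (g1 * E) * D2" unfolding 2(4) by (simp add: mat_ring)
          finally show ?thesis unfolding 1(4) by (simp add: mat_ring)
        qed
        moreover have "D1 * D2 * B = (d1 * d2) \<cdot>\<^sub>m (B * (D1 * D2))"
        proof -
          have "D1 * D2 * B = d2 \<cdot>\<^sub>m ((D1 * B) * D2)" using 2(6) by (simp add: mat_ring smult_mat_mult_right)
          also have "\<dots> = (d1 * d2) \<cdot>\<^sub>m (B * (D1 * D2))" unfolding 1(6)
            by (simp add: mat_ring smult_mat_mult_left smult_smult_mat mult.commute)
          finally show ?thesis .
        qed
        moreover have "(d1 * d2) * (d1 * d2) = 1" using 1(5) 2(5) by (simp add: algebra_simps)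
        moreover have "D1 * D2 \<in> carrier_mat l l" "Di2 * Di1 \<in> carrier_mat l l" by (simp_all add: carrier_matI)
        ultimately show ?case unfolding mult_SO_derived by blast
      qed
      then obtain D Di d where D: "D \<in> carrier_mat l l" "Di \<in> carrier_mat l l" "D * Di = 1\<^sub>m l" "g * E = E * D"
        "d * d = 1" "D * B = d \<cdot>\<^sub>m (B * D)" by blast
      have [simp]: "dim_row D = l" "dim_col D = l" "dim_row Di = l" "dim_col Di = l" using D by auto
      \<comment> \<open>Restricting s g = z g r to the subspace gives B' D = e d B D. Cancelling D
        leaves B' = B or B' = -B, which is excluded.\<close>
      have "E * (B' * D) = (s * E) * D" unfolding sE by (simp add: mat_ring)
      also have "\<dots> = s * (g * E)" unfolding D(4) by (simp add: mat_ring)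
      also have "\<dots> = (s * g) * E" by (simp add: mat_ring)
      also have "\<dots> = z * (g * (r * E))" unfolding sg by (simp add: mat_ring)
      also have "\<dots> = z * ((g * E) * B)" unfolding rE by (simp add: mat_ring)
      also have "\<dots> = (z * E) * (D * B)" unfolding D(4) by (simp add: mat_ring)
      also have "z * E = e \<cdot>\<^sub>m E" unfolding e(2) by (rule sign_mat_mult[OF E])
      also have "e \<cdot>\<^sub>m E * (D * B) = E * ((e * d) \<cdot>\<^sub>m (B * D))" unfolding D(6)
        by (simp add: smult_mat_mult_left smult_mat_mult_right smult_smult_mat mult.commute)
      finally have "B' * D = (e * d) \<cdot>\<^sub>m (B * D)" by (rule left_inj[of _ _ l]) (use D(1) B in auto)
      then have "B' * D = ((e * d) \<cdot>\<^sub>m B) * D" by (simp add: smult_mat_mult_left)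
      from right_inverse_cancel[OF D(1-3) _ _ this, of l] have "B' = (e * d) \<cdot>\<^sub>m B"
        by (simp add: carrier_matI)
      moreover have "(e * d) * (e * d) = 1" using e(1) D(5) by (simp add: algebra_simps)
      then have "e * d = 1 \<or> e * d = - 1" by (simp add: square_eq_1_iff)
      moreover have "(- 1) \<cdot>\<^sub>m B = - B" by (intro eq_matI) auto
      ultimately show False using ne by auto
    qed
  qed
  then show ?thesis unfolding collapses_def PSO_derived_def proj_def by blast
qed

end

text \<open>The subquotient spanned by the images of \<open>E\<close> and \<open>c\<close> in which \<open>M\<close> acts as the upper
  triangular matrix with diagonal \<open>p, q\<close> and off-diagonal entry \<open>y\<close>.\<close>

definition upper2 :: "'k::field mat \<Rightarrow> 'k mat \<Rightarrow> 'k mat \<Rightarrow> 'k mat \<Rightarrow> 'k \<Rightarrow> 'k \<Rightarrow> 'k \<Rightarrow> bool" where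
  "upper2 E \<xi> c M p q y \<longleftrightarrow> (\<exists>P z. P \<in> carrier_mat (dim_col E) (dim_col E) \<and> z \<in> carrier_mat (dim_col E) 1 \<and>
     M * E = E * P \<and> \<xi> * P = p \<cdot>\<^sub>m \<xi> \<and> M * c = q \<cdot>\<^sub>m c + E * z \<and> \<xi> * z = y \<cdot>\<^sub>m 1\<^sub>m 1)"

text \<open>The functional \<open>\<rho>\<close> restricts to \<open>\<xi>\<close> on the image of E
  and kills c. Applied to M c it returns the off-diagonal entry of M, which is therefore
  unique.\<close>

locale subquotient =
  fixes E \<xi> c \<rho> :: "'k::field mat" and N l :: nat
  assumes E: "E \<in> carrier_mat N l" and xi: "\<xi> \<in> carrier_mat 1 l" and c: "c \<in> carrier_mat N 1"
    and rho: "\<rho> \<in> carrier_mat 1 N" and rho_E: "\<rho> * E = \<xi>" and rho_c: "\<rho> * c = 0\<^sub>m 1 1"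
begin

lemma dims [simp]: "dim_row E = N" "dim_col E = l" "dim_row \<xi> = 1" "dim_col \<xi> = l" "dim_row c = N" "dim_col c = 1"
  "dim_row \<rho> = 1" "dim_col \<rho> = N"
  using E xi c rho by auto

lemma upper2_mult:
  assumes M: "M \<in> carrier_mat N N" "upper2 E \<xi> c M p q y" and M': "M' \<in> carrier_mat N N" "upper2 E \<xi> c M' p' q' y'"
  shows "upper2 E \<xi> c (M * M') (p * p') (q * q') (q' * y + p * y')"
proof -
  obtain P z where 1: "P \<in> carrier_mat l l" "z \<in> carrier_mat l 1" "M * E = E * P" "\<xi> * P = p \<cdot>\<^sub>m \<xi>"
    "M * c = q \<cdot>\<^sub>m c + E * z" "\<xi> * z = y \<cdot>\<^sub>m 1\<^sub>m 1" using M(2) unfolding upper2_def by auto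
  obtain P' z' where 2: "P' \<in> carrier_mat l l" "z' \<in> carrier_mat l 1" "M' * E = E * P'" "\<xi> * P' = p' \<cdot>\<^sub>m \<xi>"
    "M' * c = q' \<cdot>\<^sub>m c + E * z'" "\<xi> * z' = y' \<cdot>\<^sub>m 1\<^sub>m 1" using M'(2) unfolding upper2_def by auto
  have [simp]: "dim_row M = N" "dim_col M = N" "dim_row M' = N" "dim_col M' = N" "dim_row P = l" "dim_col P = l"
    "dim_row P' = l" "dim_col P' = l" "dim_row z = l" "dim_col z = 1" "dim_row z' = l" "dim_col z' = 1"
    using M(1) M'(1) 1(1,2) 2(1,2) by auto
  have "M * M' * E = M * (M' * E)" by (simp add: mat_ring)
  also have "\<dots> = (M * E) * P'" unfolding 2(3) by (simp add: mat_ring)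
  also have "\<dots> = E * (P * P')" unfolding 1(3) by (simp add: mat_ring)
  finally have a: "M * M' * E = E * (P * P')" .
  have "\<xi> * (P * P') = (\<xi> * P) * P'" by (simp add: mat_ring)
  also have "\<dots> = (p * p') \<cdot>\<^sub>m \<xi>" unfolding 1(4) by (simp add: smult_mat_mult_left 2(4) smult_smult_mat)
  finally have b: "\<xi> * (P * P') = (p * p') \<cdot>\<^sub>m \<xi>" .
  have "M * M' * c = M * (M' * c)" by (simp add: mat_ring)
  also have "\<dots> = q' \<cdot>\<^sub>m (M * c) + (M * E) * z'" unfolding 2(5) by (simp add: mat_ring smult_mat_mult_right)
  also have "\<dots> = (q' \<cdot>\<^sub>m (q \<cdot>\<^sub>m c) + q' \<cdot>\<^sub>m (E * z)) + E * (P * z')"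
    unfolding 1(3,5) by (simp add: mat_ring smult_mat_add)
  also have "\<dots> = (q * q') \<cdot>\<^sub>m c + E * (q' \<cdot>\<^sub>m z + P * z')"
    by (simp add: mat_ring smult_mat_mult_right smult_smult_mat mult.commute[of q])
      (intro eq_matI; simp add: add.assoc)
  finally have d: "M * M' * c = (q * q') \<cdot>\<^sub>m c + E * (q' \<cdot>\<^sub>m z + P * z')" .
  have "\<xi> * (q' \<cdot>\<^sub>m z + P * z') = q' \<cdot>\<^sub>m (\<xi> * z) + (\<xi> * P) * z'" by (simp add: mat_ring smult_mat_mult_right)
  also have "\<dots> = q' \<cdot>\<^sub>m (y \<cdot>\<^sub>m 1\<^sub>m 1) + p \<cdot>\<^sub>m (y' \<cdot>\<^sub>m 1\<^sub>m 1)" unfolding 1(4,6) by (simp add: smult_mat_mult_left 2(6))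
  also have "\<dots> = (q' * y + p * y') \<cdot>\<^sub>m 1\<^sub>m 1" by (intro eq_matI) auto
  finally have e: "\<xi> * (q' \<cdot>\<^sub>m z + P * z') = (q' * y + p * y') \<cdot>\<^sub>m 1\<^sub>m 1" .
  show ?thesis unfolding upper2_def
    by (intro exI[of _ "P * P'"] exI[of _ "q' \<cdot>\<^sub>m z + P * z'"] conjI a b d e) auto
qed

lemma upper2_unique:
  assumes "M \<in> carrier_mat N N" "upper2 E \<xi> c M p q y" "upper2 E \<xi> c M p' q' y'"
  shows "y = y'"
proof -
  have "\<rho> * (M * c) = t \<cdot>\<^sub>m 1\<^sub>m 1" if up: "upper2 E \<xi> c M a b t" for a b t
  proof -
    obtain P z where 1: "z \<in> carrier_mat l 1" "M * c = b \<cdot>\<^sub>m c + E * z" "\<xi> * z = t \<cdot>\<^sub>m 1\<^sub>m 1"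
      using up unfolding upper2_def by auto
    have [simp]: "dim_row z = l" "dim_col z = 1" using 1(1) by auto
    have "\<rho> * (M * c) = b \<cdot>\<^sub>m (\<rho> * c) + (\<rho> * E) * z" unfolding 1(2) by (simp add: mat_ring smult_mat_mult_right)
    also have "\<dots> = b \<cdot>\<^sub>m 0\<^sub>m 1 1 + t \<cdot>\<^sub>m 1\<^sub>m 1" unfolding rho_E rho_c 1(3) ..
    also have "\<dots> = t \<cdot>\<^sub>m 1\<^sub>m 1" by (intro eq_matI) auto
    finally show ?thesis .
  qed
  from this[OF assms(2)] this[OF assms(3)] have "(y \<cdot>\<^sub>m 1\<^sub>m 1) $$ (0, 0) = (y' \<cdot>\<^sub>m 1\<^sub>m 1 :: 'k mat) $$ (0, 0)" by metis
  then show ?thesis by simp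
qed

lemma upper2_one: "upper2 E \<xi> c (1\<^sub>m N) 1 1 0"
  unfolding upper2_def
  by (intro exI[of _ "1\<^sub>m l"] exI[of _ "0\<^sub>m l 1"]) (auto simp: mat_ring intro!: eq_matI)

text \<open>A computation with 2 x 2 triangular matrices: r is diag(p, q), and s has diagonal a, b
  and corner y. The corner of s r s^-1 is (q - p) y / b, so commuting with r forces p = q. The
  element r s r^-1 has diagonal a, b and corner p y / q, so commuting with s forces a = b or p =
  q.\<close>

lemma noncommuting:
  assumes car: "r \<in> carrier_mat N N" "r' \<in> carrier_mat N N" "s \<in> carrier_mat N N" "s' \<in> carrier_mat N N"
    and ss': "s * s' = 1\<^sub>m N"
    and r: "upper2 E \<xi> c r p q 0" "upper2 E \<xi> c r' (1 / p) (1 / q) 0"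
    and s: "upper2 E \<xi> c s a b y" "upper2 E \<xi> c s' (1 / a) (1 / b) y'"
    and nz: "p \<noteq> 0" "q \<noteq> 0" "a \<noteq> 0" "b \<noteq> 0" and ne: "p \<noteq> q" "a \<noteq> b" "y \<noteq> 0"
  shows "r * (s * r * s') \<noteq> s * r * s' * r" "s * (r * s * r') \<noteq> r * s * r' * s"
proof -
  have rs: "r * s \<in> carrier_mat N N" "s * r \<in> carrier_mat N N" using car by auto
  then have t: "s * r * s' \<in> carrier_mat N N" "r * s * r' \<in> carrier_mat N N" using car by auto
  have "upper2 E \<xi> c (1\<^sub>m N) (a * (1 / a)) (b * (1 / b)) (1 / b * y + a * y')"
    using upper2_mult[OF car(3) s(1) car(4) s(2)] ss' by simp
  \<comment> \<open>The corner y' of the inverse of s is determined by s s' = 1, because corners are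
    unique and the identity has corner 0.\<close>
  then have y': "1 / b * y + a * y' = 0" using upper2_unique[OF _ _ upper2_one] by simp
  note u_sr = upper2_mult[OF car(3) s(1) car(1) r(1)]
  note u_t = upper2_mult[OF rs(2) u_sr car(4) s(2)]
  have "1 / b * (q * y + a * 0) + a * p * y' = (q - p) * y / b"
  proof -
    have "a * y' = - (y / b)" using y' by (simp add: eq_neg_iff_add_eq_0 add.commute)
    moreover have "a * p * y' = p * (a * y')" by (simp add: ac_simps)
    ultimately have "a * p * y' = - (p * y / b)" by simp
    then show ?thesis by (simp add: diff_divide_distrib left_diff_distrib)
  qed
  then have u_t: "upper2 E \<xi> c (s * r * s') (a * p * (1 / a)) (b * q * (1 / b)) ((q - p) * y / b)" using u_t by simp
  show "r * (s * r * s') \<noteq> s * r * s' * r"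
  proof
    assume eq: "r * (s * r * s') = s * r * s' * r"
    have "r * (s * r * s') \<in> carrier_mat N N" using car t by auto
    from upper2_unique[OF this upper2_mult[OF car(1) r(1) t(1) u_t]]
      upper2_mult[OF t(1) u_t car(1) r(1)] eq
    have "b * q * (1 / b) * 0 + p * ((q - p) * y / b) = q * ((q - p) * y / b) + a * p * (1 / a) * 0" by simp
    then have "p * ((q - p) * y / b) = q * ((q - p) * y / b)" by (simp only: mult_zero_right add_0_left add_0_right)
    then have "p = q \<or> (q - p) * y / b = 0" by (metis mult_cancel_right)
    then show False using ne nz by simp
  qed
  note u_rs = upper2_mult[OF car(1) r(1) car(3) s(1)]
  note u_t' = upper2_mult[OF rs(1) u_rs car(2) r(2)]
  have "1 / q * (b * 0 + p * y) + p * a * 0 = p * y / q" by simp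
  then have u_t': "upper2 E \<xi> c (r * s * r') (p * a * (1 / p)) (q * b * (1 / q)) (p * y / q)" using u_t' by simp
  show "s * (r * s * r') \<noteq> r * s * r' * s"
  proof
    assume eq: "s * (r * s * r') = r * s * r' * s"
    have "s * (r * s * r') \<in> carrier_mat N N" using car t by auto
    from upper2_unique[OF this upper2_mult[OF car(3) s(1) t(2) u_t']]
      upper2_mult[OF t(2) u_t' car(3) s(1)] eq
    have "q * b * (1 / q) * y + a * (p * y / q) = b * (p * y / q) + p * a * (1 / p) * y" by simp
    moreover have "q * b * (1 / q) = b" "p * a * (1 / p) = a" using nz by simp_all
    ultimately have "b * y + a * (p * y / q) = b * (p * y / q) + a * y" by (simp only:)
    then have "(b - a) * (y - p * y / q) = 0" by (simp only: left_diff_distrib right_diff_distrib) (simp add: algebra_simps)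
    then have "y = p * y / q" using ne by simp
    then have "q * y = p * y" using nz by (simp add: field_simps)
    then show False using ne by simp
  qed
qed

end

section \<open>Two opposite isotropic subspaces and Siegel root elements\<close>

context orthogonal_setting
begin

text \<open>Together with \<open>incl2\<close>, a basis of each of two opposite totally isotropic
  subspaces. The second is listed in the order dual to the first, so that \<open>levi A B\<close>
  acts by A on one and by the transpose of B on the other.\<close>

definition incl1 :: "'k mat" where "incl1 = mat m n (\<lambda>(i, j). if i = j then 1 else 0)"

definition incl2 :: "'k mat" where "incl2 = mat m n (\<lambda>(i, j). if i = mir j then 1 else 0)"

lemma incl_dims [simp]: "dim_row incl1 = m" "dim_col incl1 = n" "dim_row incl2 = m" "dim_col incl2 = n"
  "incl1 \<in> carrier_mat m n" "incl2 \<in> carrier_mat m n"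
  unfolding incl1_def incl2_def by simp_all

lemma n_le: "n \<le> m - n" "m - n \<le> m" "n \<le> m" using m_cases by auto

lemma mult_incl1: "M \<in> carrier_mat k m \<Longrightarrow> i < k \<Longrightarrow> j < n \<Longrightarrow> (M * incl1) $$ (i, j) = M $$ (i, j)"
proof -
  assume a: "M \<in> carrier_mat k m" "i < k" "j < n"
  then have "(M * incl1) $$ (i, j) = (\<Sum>x<m. M $$ (i, x) * incl1 $$ (x, j))"
    by (simp add: scalar_prod_def lessThan_atLeast0)
  also have "\<dots> = (\<Sum>x<m. if x = j then M $$ (i, x) else 0)"
    using a n_le by (intro sum.cong) (auto simp: incl1_def)
  finally show ?thesis using a n_le by simp
qed

lemma mult_incl2: "M \<in> carrier_mat k m \<Longrightarrow> i < k \<Longrightarrow> j < n \<Longrightarrow> (M * incl2) $$ (i, j) = M $$ (i, mir j)"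
proof -
  assume a: "M \<in> carrier_mat k m" "i < k" "j < n"
  then have "mir j < m" using n_le by simp
  have "(M * incl2) $$ (i, j) = (\<Sum>x<m. M $$ (i, x) * incl2 $$ (x, j))"
    using a by (simp add: scalar_prod_def lessThan_atLeast0)
  also have "\<dots> = (\<Sum>x<m. if x = mir j then M $$ (i, x) else 0)"
    using a n_le by (intro sum.cong) (auto simp: incl2_def)
  finally show ?thesis using \<open>mir j < m\<close> by simp
qed

lemma incl1_mult: "M \<in> carrier_mat n k \<Longrightarrow> i < m \<Longrightarrow> j < k \<Longrightarrow> (incl1 * M) $$ (i, j) = (if i < n then M $$ (i, j) else 0)"
proof -
  assume a: "M \<in> carrier_mat n k" "i < m" "j < k"
  then have "(incl1 * M) $$ (i, j) = (\<Sum>x<n. incl1 $$ (i, x) * M $$ (x, j))"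
    by (simp add: scalar_prod_def lessThan_atLeast0)
  also have "\<dots> = (\<Sum>x<n. if x = i then M $$ (x, j) else 0)"
    using a by (intro sum.cong) (auto simp: incl1_def)
  finally show ?thesis by simp
qed

lemma incl2_mult: "M \<in> carrier_mat n k \<Longrightarrow> i < m \<Longrightarrow> j < k \<Longrightarrow> (incl2 * M) $$ (i, j) = (if m - n \<le> i then M $$ (mir i, j) else 0)"
proof -
  assume a: "M \<in> carrier_mat n k" "i < m" "j < k"
  then have "(incl2 * M) $$ (i, j) = (\<Sum>x<n. incl2 $$ (i, x) * M $$ (x, j))"
    by (simp add: scalar_prod_def lessThan_atLeast0)
  also have "\<dots> = (\<Sum>x<n. if x = mir i then M $$ (x, j) else 0)"
  proof (intro sum.cong refl)
    fix x assume "x \<in> {..<n}"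
    then have x: "x < n" "x < m" using n_le by auto
    show "incl2 $$ (i, x) * M $$ (x, j) = (if x = mir i then M $$ (x, j) else 0)"
      using x a mir_eq_iff[of i x] by (auto simp: incl2_def)
  qed
  finally have "(incl2 * M) $$ (i, j) = (\<Sum>x<n. if x = mir i then M $$ (x, j) else 0)" .
  moreover have "mir i < n \<longleftrightarrow> m - n \<le> i" using a(2) m_cases unfolding mir_def by linarith
  ultimately show ?thesis by simp
qed

lemma levi_incl1:
  assumes "A \<in> carrier_mat n n"
  shows "levi A B * incl1 = incl1 * A"
proof (rule eq_matI)
  fix i j assume "i < dim_row (incl1 * A)" "j < dim_col (incl1 * A)"
  then have ij: "i < m" "j < n" using assms by auto
  then have jm: "j < m" using n_le by simp
  show "(levi A B * incl1) $$ (i, j) = (incl1 * A) $$ (i, j)"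
    unfolding mult_incl1[OF levi_carrier(1) ij] incl1_mult[OF assms ij] levi_index[OF ij(1) jm]
    using ij n_le by auto
qed (use assms in auto)

lemma levi_incl2:
  assumes "B \<in> carrier_mat n n"
  shows "levi A B * incl2 = incl2 * B\<^sup>T"
proof (rule eq_matI)
  fix i j assume "i < dim_row (incl2 * B\<^sup>T)" "j < dim_col (incl2 * B\<^sup>T)"
  then have ij: "i < m" "j < n" using assms by auto
  then have jm: "j < m" "mir j < m" "m - n \<le> mir j" using n_le unfolding mir_def by auto
  have mi: "mir i < n" if "m - n \<le> i" using that ij m_cases unfolding mir_def by linarith
  have "\<not> mir j < n" using jm(3) n_le by linarith
  then show "(levi A B * incl2) $$ (i, j) = (incl2 * B\<^sup>T) $$ (i, j)"
    unfolding mult_incl2[OF levi_carrier(1) ij] incl2_mult[OF transpose_carrier_mat[THEN iffD2, OF assms] ij]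
      levi_index[OF ij(1) jm(2)]
    using ij jm mi assms by auto
qed (use assms in auto)

lemma incl_orth: "incl1\<^sup>T * incl1 = 1\<^sub>m n" "incl1\<^sup>T * incl2 = 0\<^sub>m n n"
proof -
  have c: "incl1\<^sup>T \<in> carrier_mat n m" by simp
  show "incl1\<^sup>T * incl1 = 1\<^sub>m n"
  proof (rule eq_matI)
    fix i j assume "i < dim_row (1\<^sub>m n :: 'k mat)" "j < dim_col (1\<^sub>m n :: 'k mat)"
    then have "i < n" "j < n" by auto
    then show "(incl1\<^sup>T * incl1) $$ (i, j) = 1\<^sub>m n $$ (i, j)"
      unfolding mult_incl1[OF c \<open>i < n\<close> \<open>j < n\<close>] using n_le by (auto simp: incl1_def)
  qed simp_all
  show "incl1\<^sup>T * incl2 = 0\<^sub>m n n"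
  proof (rule eq_matI)
    fix i j assume "i < dim_row (0\<^sub>m n n :: 'k mat)" "j < dim_col (0\<^sub>m n n :: 'k mat)"
    then have ij: "i < n" "j < n" by auto
    then have "mir j < m" "mir j \<noteq> i" using n_le unfolding mir_def by linarith+
    then show "(incl1\<^sup>T * incl2) $$ (i, j) = 0\<^sub>m n n $$ (i, j)"
      unfolding mult_incl2[OF c ij] using ij by (simp add: incl1_def)
  qed simp_all
qed

lemma levi_inj:
  assumes "A \<in> carrier_mat n n" "C \<in> carrier_mat n n" "levi A B = levi C D"
  shows "A = C"
proof -
  have [simp]: "dim_row A = n" "dim_row C = n" using assms by auto
  have "A = incl1\<^sup>T * (levi A B * incl1)" unfolding levi_incl1[OF assms(1)]
    by (simp add: mult_mat_assoc[symmetric] incl_orth mult_mat_unit_left)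
  also have "\<dots> = C" unfolding assms(3) levi_incl1[OF assms(2)]
    by (simp add: mult_mat_assoc[symmetric] incl_orth mult_mat_unit_left)
  finally show ?thesis .
qed

text \<open>The root element for (a, mir b) with a, b < n fixes the first isotropic subspace
  pointwise and adds this skew matrix as a map from the second to the first.\<close>

definition skew :: "nat \<Rightarrow> nat \<Rightarrow> 'k \<Rightarrow> 'k mat" where
  "skew a b t = mat n n (\<lambda>(i, j). (if i = a \<and> j = b then t else 0) - (if i = b \<and> j = a then t else 0))"

lemma siegel_pair:
  assumes "a < n" "b < n" "a \<noteq> b"
  shows "root_pair a (mir b)" "mir (mir b) = b" "outer a" "outer b"
  using assms n_le unfolding root_pair_def outer_iff mir_def by auto

lemma siegel_incl1:
  assumes "a < n" "b < n" "a \<noteq> b"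
  shows "root a (mir b) t * incl1 = incl1"
proof (rule eq_matI)
  fix i j assume "i < dim_row incl1" "j < dim_col incl1"
  then have ij: "i < m" "j < n" by auto
  then have j: "j < m" "j \<noteq> mir b" "j \<noteq> mir a" using assms n_le unfolding mir_def by linarith+
  show "(root a (mir b) t * incl1) $$ (i, j) = incl1 $$ (i, j)"
    unfolding mult_incl1[OF root_carrier(1) ij] root_index[OF ij(1) j(1)] using ij j by (simp add: incl1_def)
qed simp_all

lemma siegel_incl2:
  assumes ab: "a < n" "b < n" "a \<noteq> b"
  shows "root a (mir b) t * incl2 = incl2 + incl1 * skew a b t"
proof (rule eq_matI)
  have sk: "skew a b t \<in> carrier_mat n n" unfolding skew_def by simp
  fix i j assume "i < dim_row (incl2 + incl1 * skew a b t)" "j < dim_col (incl2 + incl1 * skew a b t)"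
  then have ij: "i < m" "j < n" by (auto simp: skew_def)
  have m': "a < m" "b < m" "j < m" "mir j < m" using ab ij n_le by auto
  have e: "mir j = mir b \<longleftrightarrow> j = b" "mir j = mir a \<longleftrightarrow> j = a" using mir_inject m' by blast+
  have "(root a (mir b) t * incl2) $$ (i, j) = (if i = mir j then 1 else 0) + (if i = a \<and> j = b then t else 0)
       - (if i = b \<and> j = a then t else 0)"
    unfolding mult_incl2[OF root_carrier(1) ij] root_index[OF ij(1) m'(4)] mir_mir[OF m'(2)] e ..
  also have "\<dots> = incl2 $$ (i, j) + (if i < n then skew a b t $$ (i, j) else 0)"
    using ij ab by (auto simp: incl2_def skew_def)
  also have "\<dots> = (incl2 + incl1 * skew a b t) $$ (i, j)"
    using ij sk incl1_mult[OF sk ij] by (simp add: skew_def)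
  finally show "(root a (mir b) t * incl2) $$ (i, j) = (incl2 + incl1 * skew a b t) $$ (i, j)" .
qed (simp_all add: skew_def)

lemma incl1_outer: "M \<in> carrier_mat n k \<Longrightarrow> i < m \<Longrightarrow> j < k \<Longrightarrow> \<not> outer i \<Longrightarrow> (incl1 * M) $$ (i, j) = 0"
  using incl1_mult outer_iff by simp

text \<open>The case s = j(A1) with A1 = g A g^-1 and det g = 1. The stable subspace lies in the
  first isotropic subspace, where j(A) acts by A, and non-commutation can be tested in GL_n because
  \<open>levi\<close> determines its first argument.\<close>

lemma collapse_levi:
  fixes A Ai A1 A1i g gi V L B B' :: "'k mat"
  assumes car: "A \<in> carrier_mat n n" "Ai \<in> carrier_mat n n" "A1 \<in> carrier_mat n n" "A1i \<in> carrier_mat n n"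
      "g \<in> carrier_mat n n" "gi \<in> carrier_mat n n"
    and inv: "A * Ai = 1\<^sub>m n" "A1 * A1i = 1\<^sub>m n" "g * gi = 1\<^sub>m n"
    and g: "rational g" "det g = 1" "A1 * g = g * A"
    and r: "j_emb n m A \<in> carrier (SO_derived q m)"
    and V: "V \<in> carrier_mat n l" "L \<in> carrier_mat l n" "L * V = 1\<^sub>m l"
    and B: "B \<in> carrier_mat l l" "B' \<in> carrier_mat l l" "A * V = V * B" "A1 * V = V * B'"
      "B * B' = B' * B \<or> B * B' = - (B' * B)" "B' \<noteq> B" "B' \<noteq> - B"
    and nc: "A * (A1 * A * A1i) \<noteq> A1 * A * A1i * A" "A1 * (A * A1 * Ai) \<noteq> A * A1 * Ai * A1"
  shows "collapses (PSO_derived q m) (conj_class (PSO_derived q m) (proj q m (j_emb n m A)))"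
proof -
  have [simp]: "dim_row A = n" "dim_col A = n" "dim_row Ai = n" "dim_col Ai = n" "dim_row A1 = n" "dim_col A1 = n"
    "dim_row A1i = n" "dim_col A1i = n" "dim_row g = n" "dim_col g = n" "dim_row gi = n" "dim_col gi = n"
    "dim_row V = n" "dim_col V = l" "dim_row L = l" "dim_col L = n" "dim_row B = l" "dim_row B' = l" using car V B by auto
  have inv': "Ai * A = 1\<^sub>m n" "A1i * A1 = 1\<^sub>m n" "gi * g = 1\<^sub>m n"
    using mat_mult_left_right_inverse car inv by blast+
  have jA: "j_emb n m A = levi A Ai" by (rule j_emb_levi[OF car(1,2) inv(1)])
  \<comment> \<open>The relation A1 g = g A rewritten for inverses; it is what the second arguments
    of \<open>levi\<close> have to satisfy.\<close>
  have gi: "Ai * gi = gi * A1i"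
  proof -
    have "Ai * gi = Ai * gi * (A1 * A1i)" unfolding inv(2) by (simp add: mat_ring)
    also have "\<dots> = Ai * gi * (A1 * (g * gi)) * A1i" unfolding inv(3) by (simp add: mat_ring)
    also have "\<dots> = Ai * gi * (A1 * g) * gi * A1i" by (simp add: mat_ring)
    also have "\<dots> = Ai * (gi * g) * A * gi * A1i" unfolding g(3) by (simp add: mat_ring)
    also have "\<dots> = (Ai * A) * gi * A1i" unfolding inv'(3) by (simp add: mat_ring)
    finally show ?thesis unfolding inv'(1) by (simp add: mat_ring)
  qed
  have p: "M * N \<in> carrier_mat n n" if "M \<in> carrier_mat n n" "N \<in> carrier_mat n n" for M N :: "'k mat" using that by simp
  show ?thesis unfolding jA
  proof (rule collapse_criterion[of "levi A Ai" "levi g gi" "levi A1 A1i" "levi Ai A" "levi A1i A1" "incl1 * V" l "L * incl1\<^sup>T" B B'])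
    show "levi A Ai \<in> carrier (SO_derived q m)" using r unfolding jA .
    show "levi g gi \<in> carrier (SO_derived q m)" by (rule levi_in_SO_derived[OF car(5,6) inv(3) g(1,2)])
    show "levi A1 A1i * levi g gi = levi g gi * levi A Ai"
      using car by (simp add: levi_mult g(3) gi)
    show "levi A Ai * levi Ai A = 1\<^sub>m m" "levi A1 A1i * levi A1i A1 = 1\<^sub>m m"
      using car by (simp_all add: levi_mult inv levi_one)
    show "L * incl1\<^sup>T * (incl1 * V) = 1\<^sub>m l"
    proof -
      have "L * incl1\<^sup>T * (incl1 * V) = L * ((incl1\<^sup>T * incl1) * V)" by (simp add: mat_ring)
      then show ?thesis unfolding incl_orth using V(3) by (simp add: mat_ring)
    qed
    show "levi A Ai * (incl1 * V) = incl1 * V * B"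
    proof -
      have "levi A Ai * (incl1 * V) = (levi A Ai * incl1) * V" by (simp add: mat_ring)
      then show ?thesis unfolding levi_incl1[OF car(1)] using B(3) by (simp add: mat_ring)
    qed
    show "levi A1 A1i * (incl1 * V) = incl1 * V * B'"
    proof -
      have "levi A1 A1i * (incl1 * V) = (levi A1 A1i * incl1) * V" by (simp add: mat_ring)
      then show ?thesis unfolding levi_incl1[OF car(3)] using B(4) by (simp add: mat_ring)
    qed
    show "levi A Ai * (levi A1 A1i * levi A Ai * levi A1i A1) \<noteq> levi A1 A1i * levi A Ai * levi A1i A1 * levi A Ai"
    proof
      assume "levi A Ai * (levi A1 A1i * levi A Ai * levi A1i A1) = levi A1 A1i * levi A Ai * levi A1i A1 * levi A Ai"
      then have "levi (A * (A1 * A * A1i)) (A1 * (Ai * A1i) * Ai) = levi (A1 * A * A1i * A) (Ai * (A1 * (Ai * A1i)))"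
        using car by (simp add: levi_mult p)
      then show False using nc(1) levi_inj car p by metis
    qed
    show "levi A1 A1i * (levi A Ai * levi A1 A1i * levi Ai A) \<noteq> levi A Ai * levi A1 A1i * levi Ai A * levi A1 A1i"
    proof
      assume "levi A1 A1i * (levi A Ai * levi A1 A1i * levi Ai A) = levi A Ai * levi A1 A1i * levi Ai A * levi A1 A1i"
      then have "levi (A1 * (A * A1 * Ai)) (A * (A1i * Ai) * A1i) = levi (A * A1 * Ai * A1) (A1i * (A * (A1i * Ai)))"
        using car by (simp add: levi_mult p)
      then show False using nc(2) levi_inj car p by metis
    qed
    fix i j assume "i < m" "j < l" "\<not> outer i"
    then show "(incl1 * V) $$ (i, j) = 0" using incl1_outer[OF V(1)] by blast
  qed (use V B in \<open>auto intro!: mult_carrier_mat[of _ _ n]\<close>)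
qed

lemma root_inverse:
  assumes ab: "root_pair a b"
  shows "root a b t * root a b (- t) = 1\<^sub>m m"
proof (rule eq_matI)
  fix i j assume "i < dim_row (1\<^sub>m m :: 'k mat)" "j < dim_col (1\<^sub>m m :: 'k mat)"
  then have ij: "i < m" "j < m" by auto
  note D = root_pairD[OF ab]
  show "(root a b t * root a b (- t)) $$ (i, j) = 1\<^sub>m m $$ (i, j)"
    unfolding root_mult_mat[OF ab root_carrier(1) ij] root_index[OF ij] root_index[OF D(2) ij(2)] root_index[OF D(3) ij(2)]
    using D ij by auto
qed simp_all

text \<open>Here s = u j(A1) u^-1 with u a Siegel root element. Since u fixes the first isotropic
  subspace, B and B' are the same as without u. The subquotient consists of that subspace modulo the
  kernel of \<open>\<xi>\<close> together with the vector c given by \<open>\<eta>\<close> in the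
  second one; r acts on it as diag(a, 1/b), and s has diagonal a1, 1/b1. The inequalities
  \<open>ne\<close> say that the diagonal entries differ.\<close>

lemma collapse_siegel:
  fixes A Ai A1 A1i g gi V L B B' \<xi> \<eta> :: "'k mat"
  assumes car: "A \<in> carrier_mat n n" "Ai \<in> carrier_mat n n" "A1 \<in> carrier_mat n n" "A1i \<in> carrier_mat n n"
      "g \<in> carrier_mat n n" "gi \<in> carrier_mat n n"
    and inv: "A * Ai = 1\<^sub>m n" "A1 * A1i = 1\<^sub>m n" "g * gi = 1\<^sub>m n"
    and g: "rational g" "det g = 1" "A1 * g = g * A"
    and r: "j_emb n m A \<in> carrier (SO_derived q m)"
    and V: "V \<in> carrier_mat n l" "L \<in> carrier_mat l n" "L * V = 1\<^sub>m l"
    and B: "B \<in> carrier_mat l l" "B' \<in> carrier_mat l l" "A * V = V * B" "A1 * V = V * B'"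
      "B * B' = B' * B \<or> B * B' = - (B' * B)" "B' \<noteq> B" "B' \<noteq> - B"
    and xi: "\<xi> \<in> carrier_mat 1 n" "\<xi> * A = a \<cdot>\<^sub>m \<xi>" "\<xi> * A1 = a1 \<cdot>\<^sub>m \<xi>"
    and eta: "\<eta> \<in> carrier_mat 1 n" "\<eta> * A = b \<cdot>\<^sub>m \<eta>" "\<eta> * A1 = b1 \<cdot>\<^sub>m \<eta>"
    and nz: "a \<noteq> 0" "b \<noteq> 0" "a1 \<noteq> 0" "b1 \<noteq> 0"
    and ne: "a * b \<noteq> 1" "a1 * b1 \<noteq> 1"
    and indep: "x < n" "y < n" "\<xi> $$ (0, x) * \<eta> $$ (0, y) \<noteq> \<xi> $$ (0, y) * \<eta> $$ (0, x)"
  shows "collapses (PSO_derived q m) (conj_class (PSO_derived q m) (proj q m (j_emb n m A)))"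
proof -
  have [simp]: "dim_row A = n" "dim_col A = n" "dim_row Ai = n" "dim_col Ai = n" "dim_row A1 = n" "dim_col A1 = n"
    "dim_row A1i = n" "dim_col A1i = n" "dim_row g = n" "dim_col g = n" "dim_row gi = n" "dim_col gi = n"
    "dim_row V = n" "dim_col V = l" "dim_row L = l" "dim_col L = n" "dim_row B = l" "dim_row B' = l"
    "dim_row \<xi> = 1" "dim_col \<xi> = n" "dim_row \<eta> = 1" "dim_col \<eta> = n"
    using car V B xi(1) eta(1) by auto
  have inv': "Ai * A = 1\<^sub>m n" "A1i * A1 = 1\<^sub>m n" "gi * g = 1\<^sub>m n"
    using mat_mult_left_right_inverse car inv by blast+
  have jA: "j_emb n m A = levi A Ai" by (rule j_emb_levi[OF car(1,2) inv(1)])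
  have gi: "Ai * gi = gi * A1i"
  proof -
    have "Ai * gi = Ai * gi * (A1 * A1i)" unfolding inv(2) by (simp add: mat_ring)
    also have "\<dots> = Ai * gi * (A1 * (g * gi)) * A1i" unfolding inv(3) by (simp add: mat_ring)
    also have "\<dots> = Ai * gi * (A1 * g) * gi * A1i" by (simp add: mat_ring)
    also have "\<dots> = Ai * (gi * g) * A * gi * A1i" unfolding g(3) by (simp add: mat_ring)
    also have "\<dots> = (Ai * A) * gi * A1i" unfolding inv'(3) by (simp add: mat_ring)
    finally show ?thesis unfolding inv'(1) by (simp add: mat_ring)
  qed
  have xy: "x \<noteq> y" using indep(3) by auto
  note sp = siegel_pair[OF indep(1,2) xy]
  define u ui where "u = root x (mir y) 1" and "ui = root x (mir y) (- 1)"
  have u_car [simp]: "u \<in> carrier_mat m m" "ui \<in> carrier_mat m m" "dim_row u = m" "dim_col u = m" "dim_row ui = m" "dim_col ui = m"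
    unfolding u_def ui_def by simp_all
  have uui: "u * ui = 1\<^sub>m m" "ui * u = 1\<^sub>m m"
    using root_inverse[OF sp(1), of 1] root_inverse[OF sp(1), of "- 1"] unfolding u_def ui_def by simp_all
  have u1: "u * incl1 = incl1" "ui * incl1 = incl1"
    unfolding u_def ui_def using siegel_incl1[OF indep(1,2) xy] by simp_all
  have u2: "u * incl2 = incl2 + incl1 * skew x y 1" "ui * incl2 = incl2 + incl1 * skew x y (- 1)"
    unfolding u_def ui_def using siegel_incl2[OF indep(1,2) xy] by simp_all
  have uG: "u \<in> carrier (SO_derived q m)" unfolding u_def by (rule root_in_SO_derived[OF sp(1)]) simp
  interpret G: group "SO_derived q m :: 'k mat monoid" by (rule group_SO_derived)
  define c where "c = incl2 * \<eta>\<^sup>T"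
  define \<rho> where "\<rho> = \<xi> * incl1\<^sup>T"
  have [simp]: "dim_row c = m" "dim_col c = 1" "dim_row \<rho> = 1" "dim_col \<rho> = m" unfolding c_def \<rho>_def by simp_all
  interpret S: subquotient incl1 \<xi> c \<rho> m n
  proof
    show "\<rho> * incl1 = \<xi>" unfolding \<rho>_def by (simp add: mat_ring incl_orth)
    have "\<rho> * c = \<xi> * ((incl1\<^sup>T * incl2) * \<eta>\<^sup>T)" unfolding \<rho>_def c_def by (simp add: mat_ring)
    also have "\<dots> = 0\<^sub>m 1 1" unfolding incl_orth by (intro eq_matI) auto
    finally show "\<rho> * c = 0\<^sub>m 1 1" .
  qed (auto intro: carrier_matI)
  \<comment> \<open>The skew matrix evaluated between \<open>\<xi>\<close> and \<open>\<eta>\<close>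
    is their minor in the columns x and y, nonzero by \<open>indep\<close>.\<close>
  define w where "w = \<xi> $$ (0, x) * \<eta> $$ (0, y) - \<xi> $$ (0, y) * \<eta> $$ (0, x)"
  have w: "w \<noteq> 0" using indep(3) unfolding w_def by simp
  have skew_w: "\<xi> * (skew x y t * \<eta>\<^sup>T) = (t * w) \<cdot>\<^sub>m 1\<^sub>m 1" for t
  proof (rule eq_matI)
    have sk: "(skew x y t * \<eta>\<^sup>T) $$ (i, 0) = (if i = x then t * \<eta> $$ (0, y) else 0) - (if i = y then t * \<eta> $$ (0, x) else 0)"
      if i: "i < n" for i
    proof -
      have "(skew x y t * \<eta>\<^sup>T) $$ (i, 0) = (\<Sum>j<n. skew x y t $$ (i, j) * \<eta> $$ (0, j))"
        using i by (simp add: scalar_prod_def lessThan_atLeast0 skew_def)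
      also have "\<dots> = (\<Sum>j<n. (if j = y then if i = x then t * \<eta> $$ (0, y) else 0 else 0) - (if j = x then if i = y then t * \<eta> $$ (0, x) else 0 else 0))"
        using i xy by (intro sum.cong) (auto simp: skew_def)
      finally show ?thesis using indep(1,2) by (simp add: sum_subtractf)
    qed
    fix i j assume "i < dim_row ((t * w) \<cdot>\<^sub>m 1\<^sub>m 1 :: 'k mat)" "j < dim_col ((t * w) \<cdot>\<^sub>m 1\<^sub>m 1 :: 'k mat)"
    then have ij: "i = 0" "j = 0" by auto
    have "(\<xi> * (skew x y t * \<eta>\<^sup>T)) $$ (0, 0) = (\<Sum>i<n. \<xi> $$ (0, i) * (skew x y t * \<eta>\<^sup>T) $$ (i, 0))"
      by (simp add: scalar_prod_def lessThan_atLeast0 skew_def)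
    also have "\<dots> = (\<Sum>i<n. (if i = x then \<xi> $$ (0, i) * (t * \<eta> $$ (0, y)) else 0) - (if i = y then \<xi> $$ (0, i) * (t * \<eta> $$ (0, x)) else 0))"
      by (intro sum.cong refl) (simp add: sk right_diff_distrib)
    also have "\<dots> = t * w" using indep(1,2) by (simp add: sum_subtractf w_def algebra_simps)
    finally show "(\<xi> * (skew x y t * \<eta>\<^sup>T)) $$ (i, j) = ((t * w) \<cdot>\<^sub>m 1\<^sub>m 1) $$ (i, j)" using ij by simp
  qed (auto simp: skew_def)
  have [simp]: "dim_row (skew x y t) = n" "dim_col (skew x y t) = n" for t unfolding skew_def by simp_all
  have up_M: "upper2 incl1 \<xi> c M 1 1 (t * w)"
    if M: "M \<in> carrier_mat m m" "M * incl1 = incl1" "M * incl2 = incl2 + incl1 * skew x y t" for M t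
  proof -
    have [simp]: "dim_row M = m" "dim_col M = m" using M(1) by auto
    have "M * c = (M * incl2) * \<eta>\<^sup>T" unfolding c_def by (simp add: mat_ring)
    then have Mc: "M * c = 1 \<cdot>\<^sub>m c + incl1 * (skew x y t * \<eta>\<^sup>T)" unfolding M(3) c_def by (simp add: mat_ring)
    have M1: "M * incl1 = incl1 * 1\<^sub>m n" unfolding M(2) by (simp add: mat_ring)
    have xi1: "\<xi> * 1\<^sub>m n = 1 \<cdot>\<^sub>m \<xi>" by (simp add: mat_ring)
    have "skew x y t * \<eta>\<^sup>T \<in> carrier_mat n 1" by (intro carrier_matI) simp_all
    then show ?thesis unfolding upper2_def using Mc M1 xi1 skew_w one_carrier_mat incl_dims(2) by metis
  qed
  have up_u: "upper2 incl1 \<xi> c u 1 1 w" "upper2 incl1 \<xi> c ui 1 1 (- w)"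
    using up_M[OF u_car(1) u1(1) u2(1)] up_M[OF u_car(2) u1(2) u2(2)] by simp_all
  \<comment> \<open>On the second isotropic subspace the transposed inverse acts, so a left
    eigenvector \<open>\<eta>\<close> for p' yields a right eigenvector c for 1/p'.\<close>
  have up_levi: "upper2 incl1 \<xi> c (levi C D) p (1 / p') 0"
    if C: "C \<in> carrier_mat n n" "D \<in> carrier_mat n n" "C * D = 1\<^sub>m n" and p: "\<xi> * C = p \<cdot>\<^sub>m \<xi>"
      and p': "\<eta> * C = p' \<cdot>\<^sub>m \<eta>" "p' \<noteq> 0" for C D p p'
  proof -
    have [simp]: "dim_row C = n" "dim_col C = n" "dim_row D = n" "dim_col D = n" using C by auto
    have "\<eta> = (\<eta> * C) * D" using C(3) by (simp add: mat_ring)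
    then have e: "\<eta> = p' \<cdot>\<^sub>m (\<eta> * D)" unfolding p'(1) by (simp add: smult_mat_mult_left)
    have "(1 / p') \<cdot>\<^sub>m \<eta> = (1 / p') \<cdot>\<^sub>m (p' \<cdot>\<^sub>m (\<eta> * D))" by (subst e) (rule refl)
    then have D: "\<eta> * D = (1 / p') \<cdot>\<^sub>m \<eta>" using p'(2) by (simp add: smult_smult_mat)
    have "levi C D * c = (levi C D * incl2) * \<eta>\<^sup>T" unfolding c_def by (simp add: mat_ring)
    also have "\<dots> = incl2 * (D\<^sup>T * \<eta>\<^sup>T)" unfolding levi_incl2[OF C(2)] by (simp add: mat_ring)
    also have "D\<^sup>T * \<eta>\<^sup>T = (\<eta> * D)\<^sup>T" by (simp add: mat_transpose_mult)
    also have "\<dots> = (1 / p') \<cdot>\<^sub>m \<eta>\<^sup>T" unfolding D by (intro eq_matI) auto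
    also have "incl2 * ((1 / p') \<cdot>\<^sub>m \<eta>\<^sup>T) = (1 / p') \<cdot>\<^sub>m c + incl1 * 0\<^sub>m n 1"
      unfolding c_def by (simp add: smult_mat_mult_right) (intro eq_matI; auto)
    finally have Mc: "levi C D * c = (1 / p') \<cdot>\<^sub>m c + incl1 * 0\<^sub>m n 1" .
    have "\<xi> * 0\<^sub>m n 1 = 0 \<cdot>\<^sub>m 1\<^sub>m 1" using xi(1) by (intro eq_matI) auto
    then show ?thesis unfolding upper2_def
      using Mc C(1) p levi_incl1[OF C(1)] zero_carrier_mat incl_dims(2) by metis
  qed
  have left_inv: "\<zeta> * Ci = (1 / p) \<cdot>\<^sub>m \<zeta>" if "\<zeta> * C = p \<cdot>\<^sub>m \<zeta>" "C * Ci = 1\<^sub>m n" "p \<noteq> 0" "\<zeta> \<in> carrier_mat 1 n" "C \<in> carrier_mat n n" "Ci \<in> carrier_mat n n" for \<zeta> C Ci :: "'k mat" and p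
  proof -
    have [simp]: "dim_row C = n" "dim_col C = n" "dim_row Ci = n" "dim_col Ci = n" "dim_row \<zeta> = 1" "dim_col \<zeta> = n" using that by auto
    have "\<zeta> = (\<zeta> * C) * Ci" using that(2) by (simp add: mat_ring)
    then have e: "\<zeta> = p \<cdot>\<^sub>m (\<zeta> * Ci)" unfolding that(1) by (simp add: smult_mat_mult_left)
    have "(1 / p) \<cdot>\<^sub>m \<zeta> = (1 / p) \<cdot>\<^sub>m (p \<cdot>\<^sub>m (\<zeta> * Ci))" by (subst e) (rule refl)
    then show ?thesis using that(3) by (simp add: smult_smult_mat)
  qed
  note L1 = left_inv[OF xi(2) inv(1) nz(1) xi(1) car(1,2)] left_inv[OF xi(3) inv(2) nz(3) xi(1) car(3,4)]
    left_inv[OF eta(2) inv(1) nz(2) eta(1) car(1,2)] left_inv[OF eta(3) inv(2) nz(4) eta(1) car(3,4)]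
  have up_r: "upper2 incl1 \<xi> c (levi A Ai) a (1 / b) 0" by (rule up_levi[OF car(1,2) inv(1) xi(2) eta(2) nz(2)])
  have up_r': "upper2 incl1 \<xi> c (levi Ai A) (1 / a) (1 / (1 / b)) 0"
    by (rule up_levi[OF car(2,1) inv'(1) L1(1,3)]) (use nz in simp)
  have up_1: "upper2 incl1 \<xi> c (levi A1 A1i) a1 (1 / b1) 0" by (rule up_levi[OF car(3,4) inv(2) xi(3) eta(3) nz(4)])
  have up_1': "upper2 incl1 \<xi> c (levi A1i A1) (1 / a1) (1 / (1 / b1)) 0"
    by (rule up_levi[OF car(4,3) inv'(2) L1(2,4)]) (use nz in simp)
  define s s' where "s = u * levi A1 A1i * ui" and "s' = u * levi A1i A1 * ui"
  have ul: "u * levi A1 A1i \<in> carrier_mat m m" "u * levi A1i A1 \<in> carrier_mat m m" by (auto intro: carrier_matI)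
  have s_car [simp]: "s \<in> carrier_mat m m" "s' \<in> carrier_mat m m" unfolding s_def s'_def by (auto intro: carrier_matI)
  have up_s: "upper2 incl1 \<xi> c s a1 (1 / b1) (w * (1 / b1) - a1 * w)"
    using S.upper2_mult[OF ul(1) S.upper2_mult[OF u_car(1) up_u(1) levi_carrier(1) up_1] u_car(2) up_u(2)]
    unfolding s_def by (simp add: mult.commute)
  have up_s': "upper2 incl1 \<xi> c s' (1 / a1) (1 / (1 / b1)) (w * (1 / (1 / b1)) - 1 / a1 * w)"
    using S.upper2_mult[OF ul(2) S.upper2_mult[OF u_car(1) up_u(1) levi_carrier(1) up_1'] u_car(2) up_u(2)]
    unfolding s'_def by (simp add: mult.commute)
  have l11: "levi A1 A1i * levi A1i A1 = 1\<^sub>m m" "levi A Ai * levi Ai A = 1\<^sub>m m"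
    using car by (simp_all add: levi_mult inv levi_one)
  have ss': "s * s' = 1\<^sub>m m"
  proof -
    have "s * s' = u * (levi A1 A1i * ((ui * u) * (levi A1i A1 * ui)))" unfolding s_def s'_def by (simp add: mat_ring)
    also have "\<dots> = u * ((levi A1 A1i * levi A1i A1) * ui)" unfolding uui by (simp add: mat_ring)
    finally show ?thesis unfolding l11 using uui by (simp add: mat_ring)
  qed
  have nz': "1 / b \<noteq> 0" "1 / b1 \<noteq> 0" "a \<noteq> 1 / b" "a1 \<noteq> 1 / b1" using nz ne by (auto simp: field_simps)
  \<comment> \<open>The corner of s is w (1/b1 - a1), nonzero because a1 b1 \<noteq> 1.\<close>
  have "w * (1 / b1) - a1 * w = w * (1 / b1 - a1)" by (simp add: algebra_simps)
  then have y0: "w * (1 / b1) - a1 * w \<noteq> 0" using w nz'(4) by simp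
  note NC = S.noncommuting[OF levi_carrier(1) levi_carrier(1) s_car ss' up_r up_r' up_s up_s' nz(1) nz'(1) nz(3) nz'(2,3,4) y0]
  show ?thesis unfolding jA
  proof (rule collapse_criterion[of "levi A Ai" "u * levi g gi" s "levi Ai A" s' "incl1 * V" l "L * incl1\<^sup>T" B B'])
    show "levi A Ai \<in> carrier (SO_derived q m)" using r unfolding jA .
    show "u * levi g gi \<in> carrier (SO_derived q m)"
      using G.m_closed[OF uG levi_in_SO_derived[OF car(5,6) inv(3) g(1,2)]] by simp
    have "s * (u * levi g gi) = u * (levi A1 A1i * ((ui * u) * levi g gi))" unfolding s_def by (simp add: mat_ring)
    also have "\<dots> = u * (levi A1 A1i * levi g gi)" unfolding uui by (simp add: mat_ring)
    also have "levi A1 A1i * levi g gi = levi g gi * levi A Ai" using car by (simp add: levi_mult g(3) gi)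
    finally show "s * (u * levi g gi) = u * levi g gi * levi A Ai" by (simp add: mat_ring)
    show "levi A Ai * levi Ai A = 1\<^sub>m m" "s * s' = 1\<^sub>m m" by (rule l11 ss')+
    show "L * incl1\<^sup>T * (incl1 * V) = 1\<^sub>m l"
    proof -
      have "L * incl1\<^sup>T * (incl1 * V) = L * ((incl1\<^sup>T * incl1) * V)" by (simp add: mat_ring)
      then show ?thesis unfolding incl_orth using V(3) by (simp add: mat_ring)
    qed
    show "levi A Ai * (incl1 * V) = incl1 * V * B"
    proof -
      have "levi A Ai * (incl1 * V) = (levi A Ai * incl1) * V" by (simp add: mat_ring)
      then show ?thesis unfolding levi_incl1[OF car(1)] using B(3) by (simp add: mat_ring)
    qed
    show "s * (incl1 * V) = incl1 * V * B'"
    proof -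
      have "s * (incl1 * V) = u * (levi A1 A1i * ((ui * incl1) * V))" unfolding s_def by (simp add: mat_ring)
      also have "\<dots> = u * ((levi A1 A1i * incl1) * V)" unfolding u1 by (simp add: mat_ring)
      also have "\<dots> = (u * incl1) * (A1 * V)" unfolding levi_incl1[OF car(3)] by (simp add: mat_ring)
      finally show ?thesis unfolding u1 B(4) by (simp add: mat_ring)
    qed
    fix i j assume "i < m" "j < l" "\<not> outer i"
    then show "(incl1 * V) $$ (i, j) = 0" using incl1_outer[OF V(1)] by blast
  qed (use V B NC in \<open>auto intro!: mult_carrier_mat[of _ _ n]\<close>)
qed

end

section \<open>Families of eigenvectors permuted by the Frobenius map\<close>

lemma mat_diag_dims [simp]: "dim_row (mat_diag k f) = k" "dim_col (mat_diag k f) = k"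
  unfolding mat_diag_def by simp_all

lemma mat_diag_index [simp]: "i < k \<Longrightarrow> j < k \<Longrightarrow> mat_diag k f $$ (i, j) = (if i = j then f j else 0)"
  unfolding mat_diag_def by simp

lemma det_mat_diag: "det (mat_diag k f) = (\<Prod>i<k. f i :: 'k::comm_ring_1)"
proof -
  have "upper_triangular (mat_diag k f)" by auto
  then have "det (mat_diag k f) = prod_list (diag_mat (mat_diag k f))" by (rule det_upper_triangular[OF _ mat_diag_dim])
  also have "\<dots> = (\<Prod>i<k. f i)" unfolding diag_mat_def
    by (simp add: prod.list_conv_set_nth lessThan_atLeast0)
  finally show ?thesis .
qed

lemma mult_col_index:
  assumes "A \<in> carrier_mat a n" "B \<in> carrier_mat n b" "i < a" "j < b"
  shows "(A * B) $$ (i, j) = (\<Sum>x<n. A $$ (i, x) * B $$ (x, j))"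
  using assms by (simp add: scalar_prod_def lessThan_atLeast0)

text \<open>A rank bound: after padding both factors with zeros to square matrices, V W = 1 would
  give W0 V0 = 1, although the last column of V0 is zero.\<close>

lemma no_wide_factorization:
  fixes V W :: "'k::field mat"
  assumes V: "V \<in> carrier_mat n k" and W: "W \<in> carrier_mat k n" and kn: "k < n"
  shows "V * W \<noteq> 1\<^sub>m n"
proof
  assume VW: "V * W = 1\<^sub>m n"
  define V0 where "V0 = mat n n (\<lambda>(i, j). if j < k then V $$ (i, j) else 0)"
  define W0 where "W0 = mat n n (\<lambda>(i, j). if i < k then W $$ (i, j) else 0)"
  have c: "V0 \<in> carrier_mat n n" "W0 \<in> carrier_mat n n" unfolding V0_def W0_def by simp_all
  have "V0 * W0 = V * W"
  proof (rule eq_matI)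
    fix i j assume "i < dim_row (V * W)" "j < dim_col (V * W)"
    then have ij: "i < n" "j < n" using V W by auto
    have "(V0 * W0) $$ (i, j) = (\<Sum>x<n. V0 $$ (i, x) * W0 $$ (x, j))" by (rule mult_col_index[OF c ij])
    also have "\<dots> = (\<Sum>x<k. V $$ (i, x) * W $$ (x, j))"
      using kn ij by (intro sum.mono_neutral_cong_right) (auto simp: V0_def W0_def)
    also have "\<dots> = (V * W) $$ (i, j)" by (rule mult_col_index[OF V W ij, symmetric])
    finally show "(V0 * W0) $$ (i, j) = (V * W) $$ (i, j)" .
  qed (use V W c in auto)
  then have "W0 * V0 = 1\<^sub>m n" using mat_mult_left_right_inverse[OF c] VW by simp
  then have "(W0 * V0) $$ (n - 1, n - 1) = 1" using kn by simp
  moreover have "(W0 * V0) $$ (n - 1, n - 1) = (\<Sum>x<n. W0 $$ (n - 1, x) * V0 $$ (x, n - 1))"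
    using kn by (intro mult_col_index[OF c(2,1)]) auto
  then have "(W0 * V0) $$ (n - 1, n - 1) = 0" using kn unfolding V0_def by (auto intro!: sum.neutral)
  ultimately show False by simp
qed

text \<open>Vectors are matrices with one column, and functionals matrices with one row, so that all
  computations stay within matrix algebra.\<close>

definition eigenpair :: "'k::field mat \<Rightarrow> 'k \<Rightarrow> 'k mat \<Rightarrow> bool" where
  "eigenpair A \<gamma> y \<longleftrightarrow> y \<in> carrier_mat (dim_row A) 1 \<and> y \<noteq> 0\<^sub>m (dim_row A) 1 \<and> A * y = \<gamma> \<cdot>\<^sub>m y"

text \<open>This is 1 - V W + V Y W. When W V = 1 it acts by Y in the basis V of the image of V and
  as the identity on the complement, the kernel of W.\<close>

definition twist :: "nat \<Rightarrow> 'k::field mat \<Rightarrow> 'k mat \<Rightarrow> 'k mat \<Rightarrow> 'k mat" where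
  "twist k V W Y = 1\<^sub>m (dim_row V) + V * (Y - 1\<^sub>m k) * W"

locale biorthogonal =
  fixes n k :: nat and V W :: "'k::field mat"
  assumes V: "V \<in> carrier_mat n k" and W: "W \<in> carrier_mat k n" and WV: "W * V = 1\<^sub>m k"
begin

lemma dims [simp]: "dim_row V = n" "dim_col V = k" "dim_row W = k" "dim_col W = n" using V W by auto

lemma WV_cancel: "dim_row M = k \<Longrightarrow> W * (V * M) = M"
  by (simp add: mult_mat_assoc[symmetric] WV mult_mat_unit_left)

lemma twist_carrier [simp]: "twist k V W Y \<in> carrier_mat n n" "dim_row (twist k V W Y) = n" "dim_col (twist k V W Y) = n"
  unfolding twist_def by (auto intro: carrier_matI)

lemma twist_mult:
  assumes Y: "Y \<in> carrier_mat k k" and Z: "Z \<in> carrier_mat k k"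
  shows "twist k V W Y * twist k V W Z = twist k V W (Y * Z)"
proof -
  have [simp]: "dim_row Y = k" "dim_col Y = k" "dim_row Z = k" "dim_col Z = k" using Y Z by auto
  define P where "P = V * (Y * W)"
  define Q where "Q = V * (Z * W)"
  define R where "R = V * (Y * (Z * W))"
  define S where "S = V * W"
  have [simp]: "dim_row P = n" "dim_col P = n" "dim_row Q = n" "dim_col Q = n" "dim_row R = n" "dim_col R = n" "dim_row S = n" "dim_col S = n"
    unfolding P_def Q_def R_def S_def by auto
  have "twist k V W Y * twist k V W Z = 1\<^sub>m n + (P - S) + (Q + (R - Q) - (S + (P - S)))"
    unfolding twist_def P_def Q_def R_def S_def by (simp add: mat_ring WV_cancel)
  also have "\<dots> = 1\<^sub>m n + (R - S)" by (intro eq_matI) auto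
  also have "\<dots> = twist k V W (Y * Z)" unfolding twist_def R_def S_def by (simp add: mat_ring)
  finally show ?thesis .
qed

lemma twist_one: "twist k V W (1\<^sub>m k) = 1\<^sub>m n"
proof -
  have z: "1\<^sub>m k - 1\<^sub>m k = (0\<^sub>m k k :: 'k mat)" by (intro eq_matI) auto
  have "V * 0\<^sub>m k k * W = 0\<^sub>m n n" using right_mult_zero_mat[OF V] left_mult_zero_mat[OF W] by simp
  then show ?thesis unfolding twist_def z by simp
qed

lemma twist_det:
  assumes Y: "Y \<in> carrier_mat k k"
  shows "det (twist k V W Y) = det Y"
proof -
  have [simp]: "dim_row Y = k" "dim_col Y = k" using Y by auto
  have "(Y - 1\<^sub>m k) * W \<in> carrier_mat k n" by (intro carrier_matI) auto
  from det_one_plus_mult[OF V this] have "det (twist k V W Y) = det (1\<^sub>m k + (Y - 1\<^sub>m k) * W * V)"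
    unfolding twist_def by (simp add: mult_mat_assoc)
  also have "(Y - 1\<^sub>m k) * W * V = Y - 1\<^sub>m k" by (simp add: mult_mat_assoc WV mult_mat_unit_right)
  also have "1\<^sub>m k + (Y - 1\<^sub>m k) = Y" by (intro eq_matI) auto
  finally show ?thesis .
qed

text \<open>If A acts by D on the image of V, this replaces D by D' there and leaves A as it is on
  the kernel of W.\<close>

definition perturb :: "'k mat \<Rightarrow> 'k mat \<Rightarrow> 'k mat \<Rightarrow> 'k mat" where
  "perturb A D D' = A + V * (D' - D) * W"

context
  fixes A D D' :: "'k mat"
  assumes A: "A \<in> carrier_mat n n" and D: "D \<in> carrier_mat k k" "D' \<in> carrier_mat k k"
    and AV: "A * V = V * D" and WA: "W * A = D * W"
begin

lemma ctx_dims [simp]: "dim_row A = n" "dim_col A = n" "dim_row D = k" "dim_col D = k" "dim_row D' = k" "dim_col D' = k"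
  using A D by auto

lemma perturb_carrier: "perturb A D D' \<in> carrier_mat n n"
  unfolding perturb_def by (intro carrier_matI) auto

lemma perturb_V: "perturb A D D' * V = V * D'"
proof -
  have "perturb A D D' * V = V * D + (V * D' - V * D)" unfolding perturb_def
    by (simp add: mat_ring WV AV)
  also have "\<dots> = V * D'" by (intro eq_matI) auto
  finally show ?thesis .
qed

lemma W_perturb: "W * perturb A D D' = D' * W"
proof -
  have "W * perturb A D D' = D * W + (D' * W - D * W)" unfolding perturb_def
    by (simp add: mat_ring WV_cancel WA)
  also have "\<dots> = D' * W" by (intro eq_matI) auto
  finally show ?thesis .
qed

lemma perturb_right:
  assumes "y \<in> carrier_mat n l" "W * y = 0\<^sub>m k l"
  shows "perturb A D D' * y = A * y"
proof -
  have [simp]: "dim_row y = n" "dim_col y = l" using assms by auto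
  have "V * (D' - D) * W * y = V * (D' - D) * (W * y)" by (simp add: mult_mat_assoc)
  also have "\<dots> = 0\<^sub>m n l" unfolding assms(2) by (simp add: right_mult_zero_mat[of _ _ k])
  finally show ?thesis unfolding perturb_def by (simp add: mult_mat_add_left) (intro eq_matI; simp)
qed

lemma perturb_left:
  assumes "y \<in> carrier_mat l n" "y * V = 0\<^sub>m l k"
  shows "y * perturb A D D' = y * A"
proof -
  have [simp]: "dim_row y = l" "dim_col y = n" using assms by auto
  have "y * (V * (D' - D) * W) = (y * V) * ((D' - D) * W)" by (simp add: mult_mat_assoc)
  also have "\<dots> = 0\<^sub>m l n" unfolding assms(2) by (intro eq_matI) auto
  finally show ?thesis unfolding perturb_def by (simp add: mult_mat_add_right) (intro eq_matI; simp)
qed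

text \<open>An intertwiner Y of D and D' extends by the identity on the complement to an intertwiner
  of A and its perturbation.\<close>

lemma twist_conj:
  assumes Y: "Y \<in> carrier_mat k k" "Y * D = D' * Y"
  shows "perturb A D D' * twist k V W Y = twist k V W Y * A"
proof -
  have [simp]: "dim_row Y = k" "dim_col Y = k" using Y by auto
  have YDW: "Y * (D * W) = D' * (Y * W)" using Y(2) by (simp add: mult_mat_assoc[symmetric])
  have "twist k V W Y * A = A + (V * (D' * (Y * W)) - V * (D * W))"
    unfolding twist_def by (simp add: mat_ring WA YDW)
  moreover have "perturb A D D' * twist k V W Y = perturb A D D' + (perturb A D D' * V) * (Y - 1\<^sub>m k) * W"
    unfolding twist_def using perturb_carrier by (simp add: mat_ring)
  then have "perturb A D D' * twist k V W Y
      = (A + (V * (D' * W) - V * (D * W))) + (V * (D' * (Y * W)) - V * (D' * W))"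
    unfolding perturb_V by (simp add: perturb_def mat_ring)
  ultimately show ?thesis by (simp add: mult_mat_assoc) (intro eq_matI; simp)
qed

end

end

section \<open>Frobenius powers and Frobenius-stable families of eigenvectors\<close>

context frobenius_field
begin

definition fpow :: "nat \<Rightarrow> 'k mat \<Rightarrow> 'k mat" where "fpow i M = map_mat (\<lambda>x. x ^ (q ^ i)) M"

lemma fpow_dims [simp]: "dim_row (fpow i M) = dim_row M" "dim_col (fpow i M) = dim_col M"
  unfolding fpow_def by simp_all

lemma fpow_index [simp]: "a < dim_row M \<Longrightarrow> b < dim_col M \<Longrightarrow> fpow i M $$ (a, b) = M $$ (a, b) ^ (q ^ i)"
  unfolding fpow_def by simp

lemma fpow_mult: "dim_col A = dim_row B \<Longrightarrow> fpow i (A * B) = fpow i A * fpow i B"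
proof -
  assume a: "dim_col A = dim_row B"
  interpret comm_ring_hom "\<lambda>x::'k. x ^ (q ^ i)" by (rule power_q_hom)
  show ?thesis unfolding fpow_def
    by (rule mat_hom_mult[of _ "dim_row A" "dim_col A" _ "dim_col B"]) (use a in auto)
qed

lemma fpow_smult: "fpow i (c \<cdot>\<^sub>m A) = c ^ (q ^ i) \<cdot>\<^sub>m fpow i A"
  by (intro eq_matI) (simp_all add: power_mult_distrib)

lemma power_q_zero [simp]: "(0::'k) ^ (q ^ i) = 0"
  using q_gt_1 by simp

lemma fpow_zero [simp]: "fpow i (0\<^sub>m a b) = 0\<^sub>m a b"
  by (intro eq_matI) simp_all

lemma power_q_fixed: "x ^ q = x \<Longrightarrow> x ^ (q ^ i) = (x::'k)"
  by (induction i) (simp_all add: power_mult)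

lemma fpow_rational: "rational A \<Longrightarrow> fpow i A = A"
  by (intro eq_matI) (simp_all add: power_q_fixed rationalD)

lemma fpow_nonzero: "M \<noteq> 0\<^sub>m a b \<Longrightarrow> M \<in> carrier_mat a b \<Longrightarrow> fpow i M \<noteq> 0\<^sub>m a b"
proof
  assume M: "M \<noteq> 0\<^sub>m a b" "M \<in> carrier_mat a b" and z: "fpow i M = 0\<^sub>m a b"
  have "M = 0\<^sub>m a b"
  proof (rule eq_matI)
    fix x y assume "x < dim_row (0\<^sub>m a b :: 'k mat)" "y < dim_col (0\<^sub>m a b :: 'k mat)"
    then have xy: "x < a" "y < b" by auto
    then have "M $$ (x, y) ^ (q ^ i) = 0" using arg_cong[OF z, of "\<lambda>N. N $$ (x, y)"] M(2) by simp
    then show "M $$ (x, y) = 0\<^sub>m a b $$ (x, y)" using xy by simp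
  qed (use M in auto)
  then show False using M by simp
qed

text \<open>An element of \<open>S\<close> of minimal support is fixed: otherwise the line through it
  and its image contains an element of smaller support.\<close>

lemma rationalize:
  assumes car: "S \<subseteq> carrier_mat a b" and ne: "S \<noteq> {}"
    and F: "\<And>x. x \<in> S \<Longrightarrow> fpow d x \<in> S"
    and aff: "\<And>x y t. x \<in> S \<Longrightarrow> y \<in> S \<Longrightarrow> x + t \<cdot>\<^sub>m (y - x) \<in> S"
  obtains x where "x \<in> S" "fpow d x = x"
proof -
  define supp where "supp x = {(i, j). i < a \<and> j < b \<and> x $$ (i, j) \<noteq> 0}" for x :: "'k mat"
  have fin: "finite (supp x)" for x
    by (rule finite_subset[of _ "{..<a} \<times> {..<b}"]) (auto simp: supp_def)
  obtain x where x: "x \<in> S" "\<And>y. y \<in> S \<Longrightarrow> card (supp x) \<le> card (supp y)"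
    using ne arg_min_natI[of "\<lambda>x. x \<in> S" _ "\<lambda>x. card (supp x)"] arg_min_nat_le[of "\<lambda>x. x \<in> S" _ "\<lambda>x. card (supp x)"]
    by blast
  have "fpow d x = x"
  proof (rule ccontr)
    assume neq: "fpow d x \<noteq> x"
    have xc: "x \<in> carrier_mat a b" using x(1) car by blast
    then obtain i j where ij: "i < a" "j < b" "fpow d x $$ (i, j) \<noteq> x $$ (i, j)"
      using neq by (metis carrier_matD eq_matI fpow_dims)
    \<comment> \<open>The parameter is chosen to make the entry (i, j) of y vanish; entries that are
      zero in x stay zero because Frobenius fixes 0.\<close>
    define t where "t = - x $$ (i, j) / (fpow d x $$ (i, j) - x $$ (i, j))"
    define y where "y = x + t \<cdot>\<^sub>m (fpow d x - x)"
    have y: "y \<in> S" unfolding y_def by (rule aff[OF x(1) F[OF x(1)]])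
    have yij: "y $$ (p, r) = x $$ (p, r) + t * (x $$ (p, r) ^ (q ^ d) - x $$ (p, r))" if "p < a" "r < b" for p r
      using that xc unfolding y_def by simp
    have "y $$ (i, j) = 0" using ij xc unfolding yij[OF ij(1,2)] t_def by simp
    moreover have "x $$ (i, j) \<noteq> 0" using ij xc by auto
    moreover have "y $$ (p, r) = 0" if "p < a" "r < b" "x $$ (p, r) = 0" for p r
      using that by (simp add: yij)
    ultimately have "supp y \<subset> supp x" using ij unfolding supp_def by fastforce
    then have "card (supp y) < card (supp x)" by (rule psubset_card_mono[OF fin])
    then show False using x(2)[OF y] by simp
  qed
  then show thesis using that x(1) by blast
qed

text \<open>Biorthogonal right and left eigenvectors permuted by Frobenius through the same
  \<open>\<pi>\<close>. The vectors need not be rational, but the image of V and the kernel of W are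
  defined over F_q.\<close>

definition eigenfamily :: "'k mat \<Rightarrow> nat \<Rightarrow> nat \<Rightarrow> (nat \<Rightarrow> nat) \<Rightarrow> (nat \<Rightarrow> 'k) \<Rightarrow> 'k mat \<Rightarrow> 'k mat \<Rightarrow> bool" where
  "eigenfamily A n k \<pi> \<delta> V W \<longleftrightarrow> V \<in> carrier_mat n k \<and> W \<in> carrier_mat k n \<and> W * V = 1\<^sub>m k \<and>
     A * V = V * mat_diag k \<delta> \<and> W * A = mat_diag k \<delta> * W \<and> bij_betw \<pi> {..<k} {..<k} \<and>
     (\<forall>i<n. \<forall>a<k. V $$ (i, a) ^ q = V $$ (i, \<pi> a)) \<and> (\<forall>a<k. \<forall>i<n. W $$ (a, i) ^ q = W $$ (\<pi> a, i))"

lemma eigenfamily_empty: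
  assumes "A \<in> carrier_mat n n"
  shows "eigenfamily A n 0 id (\<lambda>_. 0) (0\<^sub>m n 0) (0\<^sub>m 0 n)"
  using assms unfolding eigenfamily_def by (auto intro!: eq_matI)

text \<open>Frobenius applied to the entries of V Y W relabels the summation indices by
  \<open>\<pi>\<close>; the equivariance of Y makes the relabelled sum equal to the original
  one.\<close>

lemma twist_rational:
  assumes fam: "eigenfamily A n k \<pi> \<delta> V W" and Y: "Y \<in> carrier_mat k k"
    and Yq: "\<And>a b. a < k \<Longrightarrow> b < k \<Longrightarrow> Y $$ (\<pi> a, \<pi> b) = Y $$ (a, b) ^ q"
  shows "rational (twist k V W Y)"
proof -
  have V: "V \<in> carrier_mat n k" and W: "W \<in> carrier_mat k n" and bij: "bij_betw \<pi> {..<k} {..<k}"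
    and Vq: "\<And>i a. i < n \<Longrightarrow> a < k \<Longrightarrow> V $$ (i, a) ^ q = V $$ (i, \<pi> a)"
    and Wq: "\<And>i a. i < n \<Longrightarrow> a < k \<Longrightarrow> W $$ (a, i) ^ q = W $$ (\<pi> a, i)"
    using fam unfolding eigenfamily_def by auto
  define Z where "Z = Y - 1\<^sub>m k"
  have Z: "Z \<in> carrier_mat k k" unfolding Z_def using Y by (intro carrier_matI) auto
  have pik: "\<pi> a < k" if "a < k" for a using bij that by (auto dest: bij_betwE)
  have pi_inj: "\<pi> a = \<pi> b \<longleftrightarrow> a = b" if "a < k" "b < k" for a b
    using bij that unfolding bij_betw_def inj_on_def by auto
  have Zq: "Z $$ (a, b) ^ q = Z $$ (\<pi> a, \<pi> b)" if "a < k" "b < k" for a b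
    using that Y Yq[OF that] pik pi_inj q_gt_1 unfolding Z_def by (simp add: frob.hom_minus)
  have ent: "(V * Z * W) $$ (i, j) = (\<Sum>b<k. \<Sum>a<k. V $$ (i, a) * Z $$ (a, b) * W $$ (b, j))" if "i < n" "j < n" for i j
  proof -
    have "V * Z \<in> carrier_mat n k" using V Z by simp
    then have "(V * Z * W) $$ (i, j) = (\<Sum>b<k. (V * Z) $$ (i, b) * W $$ (b, j))"
      using mult_col_index[OF _ W that] by blast
    also have "\<dots> = (\<Sum>b<k. \<Sum>a<k. V $$ (i, a) * Z $$ (a, b) * W $$ (b, j))"
      by (intro sum.cong refl) (simp add: mult_col_index[OF V Z that(1)] sum_distrib_right)
    finally show ?thesis .
  qed
  show ?thesis unfolding rational_def
  proof (intro allI impI)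
    fix i j assume "i < dim_row (twist k V W Y)" "j < dim_col (twist k V W Y)"
    then have ij: "i < n" "j < n" using V W unfolding twist_def by auto
    have "(V * Z * W) $$ (i, j) ^ q = (\<Sum>b<k. \<Sum>a<k. V $$ (i, \<pi> a) * Z $$ (\<pi> a, \<pi> b) * W $$ (\<pi> b, j))"
      unfolding ent[OF ij] frob.hom_sum
      by (intro sum.cong refl) (simp add: frob.hom_sum power_mult_distrib Vq[OF ij(1)] Wq[OF ij(2)] Zq)
    also have "\<dots> = (\<Sum>b<k. \<Sum>a<k. V $$ (i, a) * Z $$ (a, \<pi> b) * W $$ (\<pi> b, j))"
      by (intro sum.cong refl sum.reindex_bij_betw[OF bij, of "\<lambda>a. V $$ (i, a) * Z $$ (a, \<pi> _) * W $$ (\<pi> _, j)"])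
    also have "\<dots> = (\<Sum>b<k. \<Sum>a<k. V $$ (i, a) * Z $$ (a, b) * W $$ (b, j))"
      by (rule sum.reindex_bij_betw[OF bij, of "\<lambda>b. \<Sum>a<k. V $$ (i, a) * Z $$ (a, b) * W $$ (b, j)"])
    finally have "(V * Z * W) $$ (i, j) ^ q = (V * Z * W) $$ (i, j)" unfolding ent[OF ij] .
    then show "twist k V W Y $$ (i, j) ^ q = twist k V W Y $$ (i, j)"
      using ij V W Z q_gt_1 unfolding twist_def Z_def[symmetric] by (simp add: add_power_q)
  qed
qed

text \<open>Frobenius permutes the rows of W and the columns of V, so it preserves the annihilator
  of either family.\<close>

lemma family_annihilates_fpow:
  assumes fam: "eigenfamily A n k \<pi> \<delta> V W"
  shows "y \<in> carrier_mat n l \<Longrightarrow> W * y = 0\<^sub>m k l \<Longrightarrow> W * fpow d y = 0\<^sub>m k l"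
    and "z \<in> carrier_mat l n \<Longrightarrow> z * V = 0\<^sub>m l k \<Longrightarrow> fpow d z * V = 0\<^sub>m l k"
proof -
  have V: "V \<in> carrier_mat n k" and W: "W \<in> carrier_mat k n" and bij: "bij_betw \<pi> {..<k} {..<k}"
    and Vq: "\<And>i a. i < n \<Longrightarrow> a < k \<Longrightarrow> V $$ (i, a) ^ q = V $$ (i, \<pi> a)"
    and Wq: "\<And>i a. i < n \<Longrightarrow> a < k \<Longrightarrow> W $$ (a, i) ^ q = W $$ (\<pi> a, i)"
    using fam unfolding eigenfamily_def by auto
  have pik: "(\<pi> ^^ d) a < k" if "a < k" for a d
    using that by (induction d) (use bij in \<open>auto dest: bij_betwE\<close>)
  have surj: "\<exists>a<k. (\<pi> ^^ d) a = b" if "b < k" for b d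
    using that
  proof (induction d arbitrary: b)
    case (Suc d)
    then obtain c where "c < k" "\<pi> c = b" using bij unfolding bij_betw_def by (metis imageE lessThan_iff)
    then show ?case using Suc.IH[of c] by auto
  qed auto
  have Vd: "V $$ (i, a) ^ (q ^ d) = V $$ (i, (\<pi> ^^ d) a)" and Wd: "W $$ (a, i) ^ (q ^ d) = W $$ ((\<pi> ^^ d) a, i)"
    if "i < n" "a < k" for i a d
  proof -
    have pow: "x ^ (q ^ Suc e) = (x ^ (q ^ e)) ^ q" for x :: 'k and e
      by (simp add: power_mult[symmetric] mult.commute)
    show "V $$ (i, a) ^ (q ^ d) = V $$ (i, (\<pi> ^^ d) a)"
      by (induction d) (simp, simp only: pow Vq[OF that(1) pik[OF that(2)]] funpow.simps o_apply)
    show "W $$ (a, i) ^ (q ^ d) = W $$ ((\<pi> ^^ d) a, i)"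
      by (induction d) (simp, simp only: pow Wq[OF that(1) pik[OF that(2)]] funpow.simps o_apply)
  qed
  {
    assume y: "y \<in> carrier_mat n l" "W * y = 0\<^sub>m k l"
    have "fpow d W * fpow d y = 0\<^sub>m k l" using y W by (simp add: fpow_mult[symmetric])
    show "W * fpow d y = 0\<^sub>m k l"
    proof (rule eq_matI)
      fix b j assume "b < dim_row (0\<^sub>m k l :: 'k mat)" "j < dim_col (0\<^sub>m k l :: 'k mat)"
      then have bj: "b < k" "j < l" by auto
      obtain a where a: "a < k" "(\<pi> ^^ d) a = b" using surj[OF bj(1)] by blast
      have cF: "fpow d W \<in> carrier_mat k n" "fpow d y \<in> carrier_mat n l" using W y by (auto intro: carrier_matI)
      have "(W * fpow d y) $$ (b, j) = (\<Sum>x<n. W $$ (b, x) * fpow d y $$ (x, j))"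
        by (rule mult_col_index[OF W cF(2) bj])
      also have "\<dots> = (\<Sum>x<n. fpow d W $$ (a, x) * fpow d y $$ (x, j))"
        using W a by (intro sum.cong refl) (simp add: Wd)
      also have "\<dots> = (fpow d W * fpow d y) $$ (a, j)" by (rule mult_col_index[OF cF a(1) bj(2), symmetric])
      finally show "(W * fpow d y) $$ (b, j) = 0\<^sub>m k l $$ (b, j)"
        unfolding \<open>fpow d W * fpow d y = 0\<^sub>m k l\<close> using a bj by simp
    qed (use W y in auto)
  }
  {
    assume z: "z \<in> carrier_mat l n" "z * V = 0\<^sub>m l k"
    have "fpow d z * fpow d V = 0\<^sub>m l k" using z V by (simp add: fpow_mult[symmetric])
    show "fpow d z * V = 0\<^sub>m l k"
    proof (rule eq_matI)
      fix j b assume "j < dim_row (0\<^sub>m l k :: 'k mat)" "b < dim_col (0\<^sub>m l k :: 'k mat)"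
      then have bj: "b < k" "j < l" by auto
      obtain a where a: "a < k" "(\<pi> ^^ d) a = b" using surj[OF bj(1)] by blast
      have cF: "fpow d V \<in> carrier_mat n k" "fpow d z \<in> carrier_mat l n" using V z by (auto intro: carrier_matI)
      have "(fpow d z * V) $$ (j, b) = (\<Sum>x<n. fpow d z $$ (j, x) * V $$ (x, b))"
        by (rule mult_col_index[OF cF(2) V bj(2,1)])
      also have "\<dots> = (\<Sum>x<n. fpow d z $$ (j, x) * fpow d V $$ (x, a))"
        using V a by (intro sum.cong refl) (simp add: Vd)
      also have "\<dots> = (fpow d z * fpow d V) $$ (j, a)" by (rule mult_col_index[OF cF(2,1) bj(2) a(1), symmetric])
      finally show "(fpow d z * V) $$ (j, b) = 0\<^sub>m l k $$ (j, b)"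
        unfolding \<open>fpow d z * fpow d V = 0\<^sub>m l k\<close> using a bj by simp
    qed (use V z in auto)
  }
qed

end

section \<open>Eigenvectors of a rational semisimple matrix and their Frobenius orbits\<close>

locale rational_semisimple = frobenius_field q field_type
  for q :: nat and field_type :: "'k::alg_closed_field itself" +
  fixes A :: "'k mat" and n :: nat
  assumes A_carrier: "A \<in> carrier_mat n n" and A_rational: "rational A" and A_semisimple: "semisimple_mat A"
begin

lemma A_dims [simp]: "dim_row A = n" "dim_col A = n" using A_carrier by auto

definition diagonalizes :: "'k mat \<Rightarrow> 'k mat \<Rightarrow> (nat \<Rightarrow> 'k) \<Rightarrow> bool" where
  "diagonalizes P Q \<epsilon> \<longleftrightarrow> P \<in> carrier_mat n n \<and> Q \<in> carrier_mat n n \<and> P * Q = 1\<^sub>m n \<and> Q * P = 1\<^sub>m n \<and>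
     A * P = P * mat_diag n \<epsilon> \<and> Q * A = mat_diag n \<epsilon> * Q"

lemma obtain_diagonalization:
  obtains P Q \<epsilon> where "diagonalizes P Q \<epsilon>"
proof -
  obtain D where D: "diagonal_mat D" "similar_mat A D" using A_semisimple unfolding semisimple_mat_def by blast
  then obtain P Q where PQ: "similar_mat_wit A D P Q" unfolding similar_mat_def by blast
  note w = similar_mat_witD2[OF A_carrier PQ]
  have [simp]: "dim_row P = n" "dim_col P = n" "dim_row Q = n" "dim_col Q = n" "dim_row D = n" "dim_col D = n" using w by auto
  define \<epsilon> where "\<epsilon> i = D $$ (i, i)" for i
  have De: "D = mat_diag n \<epsilon>"
    using D(1) unfolding diagonal_mat_def \<epsilon>_def by (intro eq_matI) auto
  have "A * P = P * D * (Q * P)" unfolding w(3) by (simp add: mult_mat_assoc)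
  then have 1: "A * P = P * D" unfolding w(2) by (simp add: mat_ring)
  have "Q * A = (Q * P) * (D * Q)" unfolding w(3) by (simp add: mult_mat_assoc)
  then have 2: "Q * A = D * Q" unfolding w(2) by (simp add: mat_ring)
  show thesis using that[of P Q \<epsilon>] w 1 2 unfolding diagonalizes_def De by blast
qed

lemma eigen_index:
  assumes d: "diagonalizes P Q \<epsilon>" and y: "eigenpair A \<gamma> y"
  obtains i where "i < n" "\<epsilon> i = \<gamma>" "(Q * y) $$ (i, 0) \<noteq> 0"
proof -
  have P: "P \<in> carrier_mat n n" "Q \<in> carrier_mat n n" "P * Q = 1\<^sub>m n" "Q * A = mat_diag n \<epsilon> * Q"
    using d unfolding diagonalizes_def by auto
  have yc: "y \<in> carrier_mat n 1" "y \<noteq> 0\<^sub>m n 1" "A * y = \<gamma> \<cdot>\<^sub>m y" using y unfolding eigenpair_def by auto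
  have [simp]: "dim_row P = n" "dim_col P = n" "dim_row Q = n" "dim_col Q = n" "dim_row y = n" "dim_col y = 1" using P yc by auto
  define c where "c = Q * y"
  have cc: "c \<in> carrier_mat n 1" unfolding c_def by (intro carrier_matI) auto
  have "P * c = (P * Q) * y" unfolding c_def by (simp add: mult_mat_assoc)
  then have Pc: "P * c = y" unfolding P(3) by (simp add: mat_ring)
  have "c \<noteq> 0\<^sub>m n 1"
  proof
    assume "c = 0\<^sub>m n 1"
    then have "y = 0\<^sub>m n 1" using Pc right_mult_zero_mat[OF P(1)] by simp
    then show False using yc by simp
  qed
  then obtain i where i: "i < n" "c $$ (i, 0) \<noteq> 0" using cc
    by (metis carrier_matD eq_matI index_zero_mat less_one)
  have "mat_diag n \<epsilon> * c = (Q * A) * y" unfolding c_def P(4) by (simp add: mult_mat_assoc)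
  also have "\<dots> = \<gamma> \<cdot>\<^sub>m c" unfolding c_def by (simp add: mult_mat_assoc yc(3) smult_mat_mult_right)
  finally have "(mat_diag n \<epsilon> * c) $$ (i, 0) = \<gamma> * c $$ (i, 0)" using i cc by simp
  then have "\<epsilon> i * c $$ (i, 0) = \<gamma> * c $$ (i, 0)" unfolding mat_diag_mult_left[OF cc] using i by simp
  then show thesis using that[of i] i unfolding c_def by simp
qed

lemma finite_eigenvalues: "finite {\<gamma>. \<exists>y. eigenpair A \<gamma> y}"
proof -
  obtain P Q \<epsilon> where d: "diagonalizes P Q \<epsilon>" by (rule obtain_diagonalization)
  have "{\<gamma>. \<exists>y. eigenpair A \<gamma> y} \<subseteq> \<epsilon> ` {..<n}" using eigen_index[OF d] by blast
  then show ?thesis by (rule finite_subset) simp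
qed

text \<open>The rows of Q are left eigenvectors; one of them, with eigenvalue \<gamma>, has a
  nonzero product with y and only needs scaling.\<close>

lemma left_eigenvector:
  assumes y: "eigenpair A \<gamma> y"
  obtains \<eta> where "\<eta> \<in> carrier_mat 1 n" "\<eta> * A = \<gamma> \<cdot>\<^sub>m \<eta>" "\<eta> * y = 1\<^sub>m 1"
proof -
  obtain P Q \<epsilon> where d: "diagonalizes P Q \<epsilon>" by (rule obtain_diagonalization)
  then have Q: "Q \<in> carrier_mat n n" "Q * A = mat_diag n \<epsilon> * Q" unfolding diagonalizes_def by auto
  obtain i where i: "i < n" "\<epsilon> i = \<gamma>" "(Q * y) $$ (i, 0) \<noteq> 0" using eigen_index[OF d y] .
  have yc: "y \<in> carrier_mat n 1" using y unfolding eigenpair_def by simp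
  have [simp]: "dim_row Q = n" "dim_col Q = n" "dim_row y = n" "dim_col y = 1" using Q yc by auto
  define e :: "'k mat" where "e = mat 1 n (\<lambda>(_, j). if j = i then 1 else 0)"
  have ec: "e \<in> carrier_mat 1 n" and [simp]: "dim_row e = 1" "dim_col e = n" unfolding e_def by simp_all
  have e_mult: "(e * M) $$ (0, j) = M $$ (i, j)" if "M \<in> carrier_mat n l" "j < l" for M j l
  proof -
    have "(e * M) $$ (0, j) = (\<Sum>x<n. e $$ (0, x) * M $$ (x, j))" by (rule mult_col_index[OF ec that(1) _ that(2)]) simp
    also have "\<dots> = (\<Sum>x<n. if x = i then M $$ (x, j) else 0)" by (intro sum.cong) (auto simp: e_def)
    finally show ?thesis using i by simp
  qed
  have eD: "e * mat_diag n \<epsilon> = \<gamma> \<cdot>\<^sub>m e" unfolding mat_diag_mult_right[OF ec] using i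
    by (intro eq_matI) (auto simp: e_def)
  define \<eta> where "\<eta> = (1 / (Q * y) $$ (i, 0)) \<cdot>\<^sub>m (e * Q)"
  have "\<eta> * A = (1 / (Q * y) $$ (i, 0)) \<cdot>\<^sub>m ((e * mat_diag n \<epsilon>) * Q)"
    unfolding \<eta>_def by (simp add: smult_mat_mult_left mult_mat_assoc Q(2))
  then have 1: "\<eta> * A = \<gamma> \<cdot>\<^sub>m \<eta>" unfolding eD \<eta>_def by (simp add: smult_mat_mult_left smult_smult_mat mult.commute)
  have "\<eta> * y = (1 / (Q * y) $$ (i, 0)) \<cdot>\<^sub>m (e * (Q * y))"
    unfolding \<eta>_def by (simp add: smult_mat_mult_left mult_mat_assoc)
  also have "\<dots> = 1\<^sub>m 1"
  proof (rule eq_matI)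
    fix a b assume "a < dim_row (1\<^sub>m 1 :: 'k mat)" "b < dim_col (1\<^sub>m 1 :: 'k mat)"
    then have ab: "a = 0" "b = 0" by auto
    have "Q * y \<in> carrier_mat n 1" by (intro carrier_matI) auto
    then have "(e * (Q * y)) $$ (0, 0) = (Q * y) $$ (i, 0)" by (rule e_mult) simp
    then show "((1 / (Q * y) $$ (i, 0)) \<cdot>\<^sub>m (e * (Q * y))) $$ (a, b) = 1\<^sub>m 1 $$ (a, b)"
      using i(3) unfolding ab by (simp del: index_mult_mat(1))
  qed simp_all
  finally have "\<eta> * y = 1\<^sub>m 1" .
  then show thesis using that[of \<eta>] 1 unfolding \<eta>_def by (simp add: carrier_matI)
qed

text \<open>The projection 1 - V W onto the kernel of W commutes with A, so it sends each column of
  an eigenbasis P to an eigenvector or to zero. Not all images vanish unless V W = 1.\<close>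

lemma complement_eigenvector:
  assumes fam: "eigenfamily A n k \<pi> \<delta> V W" and ne: "V * W \<noteq> 1\<^sub>m n"
  obtains \<gamma> y where "eigenpair A \<gamma> y" "W * y = 0\<^sub>m k 1"
proof -
  have V: "V \<in> carrier_mat n k" and W: "W \<in> carrier_mat k n" and WV: "W * V = 1\<^sub>m k"
    and AV: "A * V = V * mat_diag k \<delta>" and WA: "W * A = mat_diag k \<delta> * W"
    using fam unfolding eigenfamily_def by auto
  interpret biorthogonal n k V W by unfold_locales (fact V W WV)+
  obtain P Q \<epsilon> where d: "diagonalizes P Q \<epsilon>" by (rule obtain_diagonalization)
  then have P: "P \<in> carrier_mat n n" "Q \<in> carrier_mat n n" "P * Q = 1\<^sub>m n" "A * P = P * mat_diag n \<epsilon>" unfolding diagonalizes_def by auto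
  have [simp]: "dim_row P = n" "dim_col P = n" "dim_row Q = n" "dim_col Q = n" using P by auto
  define M where "M = P - V * (W * P)"
  have Mc: "M \<in> carrier_mat n n" unfolding M_def by (intro carrier_matI) auto
  then have [simp]: "dim_row M = n" "dim_col M = n" by auto
  have WM: "W * M = 0\<^sub>m k n" unfolding M_def by (simp add: mat_ring WV_cancel) (intro eq_matI; simp)
  have "A * M = P * mat_diag n \<epsilon> - (A * V) * (W * P)" unfolding M_def by (simp add: mat_ring P(4))
  also have "(A * V) * (W * P) = V * ((W * A) * P)" unfolding AV WA by (simp add: mat_ring)
  also have "\<dots> = V * (W * (P * mat_diag n \<epsilon>))" by (simp add: mat_ring P(4))
  also have "P * mat_diag n \<epsilon> - V * (W * (P * mat_diag n \<epsilon>)) = M * mat_diag n \<epsilon>"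
    unfolding M_def by (simp add: mat_ring)
  finally have AM: "A * M = M * mat_diag n \<epsilon>" .
  have "M \<noteq> 0\<^sub>m n n"
  proof
    assume z: "M = 0\<^sub>m n n"
    have "M * Q = 1\<^sub>m n - V * W" unfolding M_def by (simp add: mat_ring P(3))
    moreover have "M * Q = 0\<^sub>m n n" unfolding z using P(2) by simp
    ultimately have e: "1\<^sub>m n - V * W = 0\<^sub>m n n" by simp
    have "V * W = 1\<^sub>m n"
    proof (rule eq_matI)
      fix i j assume "i < dim_row (1\<^sub>m n :: 'k mat)" "j < dim_col (1\<^sub>m n :: 'k mat)"
      then have ij: "i < n" "j < n" by auto
      then have "(1\<^sub>m n - V * W) $$ (i, j) = 0" unfolding e by simp
      then show "(V * W) $$ (i, j) = 1\<^sub>m n $$ (i, j)" using ij by (simp del: index_mult_mat(1) index_one_mat)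
    qed auto
    then show False using ne by simp
  qed
  then obtain i j where ij: "i < n" "j < n" "M $$ (i, j) \<noteq> 0"
    by (metis Mc carrier_matD eq_matI index_zero_mat)
  define y where "y = mat n 1 (\<lambda>(a, _). M $$ (a, j))"
  have yc: "y \<in> carrier_mat n 1" unfolding y_def by simp
  have "y $$ (i, 0) \<noteq> 0" using ij unfolding y_def by simp
  then have "y \<noteq> 0\<^sub>m n 1" using ij by auto
  moreover have "A * y = \<epsilon> j \<cdot>\<^sub>m y"
  proof (rule eq_matI)
    fix a b assume "a < dim_row (\<epsilon> j \<cdot>\<^sub>m y)" "b < dim_col (\<epsilon> j \<cdot>\<^sub>m y)"
    then have ab: "a < n" "b = 0" using yc by auto
    have "(A * y) $$ (a, 0) = (\<Sum>x<n. A $$ (a, x) * y $$ (x, 0))" by (rule mult_col_index[OF A_carrier yc ab(1)]) simp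
    also have "\<dots> = (A * M) $$ (a, j)" unfolding mult_col_index[OF A_carrier Mc ab(1) ij(2)] by (simp add: y_def)
    also have "\<dots> = \<epsilon> j * y $$ (a, 0)" unfolding AM mat_diag_mult_right[OF Mc] using ab ij by (simp add: y_def)
    finally show "(A * y) $$ (a, b) = (\<epsilon> j \<cdot>\<^sub>m y) $$ (a, b)" using ab yc by simp
  qed (use yc in auto)
  moreover have "W * y = 0\<^sub>m k 1"
  proof (rule eq_matI)
    fix a b assume "a < dim_row (0\<^sub>m k 1 :: 'k mat)" "b < dim_col (0\<^sub>m k 1 :: 'k mat)"
    then have ab: "a < k" "b = 0" by auto
    have "(W * y) $$ (a, 0) = (\<Sum>x<n. W $$ (a, x) * y $$ (x, 0))" by (rule mult_col_index[OF W yc ab(1)]) simp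
    also have "\<dots> = (W * M) $$ (a, j)" unfolding mult_col_index[OF W Mc ab(1) ij(2)] by (simp add: y_def)
    finally show "(W * y) $$ (a, b) = 0\<^sub>m k 1 $$ (a, b)" unfolding WM using ab ij by simp
  qed (use yc in auto)
  ultimately show thesis using that[of "\<epsilon> j" y] yc unfolding eigenpair_def by simp
qed

lemma eigenpair_fpow: "eigenpair A \<gamma> y \<Longrightarrow> eigenpair A (\<gamma> ^ (q ^ i)) (fpow i y)"
proof -
  assume "eigenpair A \<gamma> y"
  then have y: "y \<in> carrier_mat n 1" "y \<noteq> 0\<^sub>m n 1" "A * y = \<gamma> \<cdot>\<^sub>m y" unfolding eigenpair_def by auto
  have "A * fpow i y = fpow i (A * y)" using y(1) by (simp add: fpow_mult fpow_rational[OF A_rational])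
  then have "A * fpow i y = \<gamma> ^ (q ^ i) \<cdot>\<^sub>m fpow i y" unfolding y(3) fpow_smult .
  moreover have "fpow i y \<in> carrier_mat n 1" using y(1) by (intro carrier_matI) auto
  ultimately show ?thesis using fpow_nonzero[OF y(2,1)] unfolding eigenpair_def by simp
qed

text \<open>All Frobenius images of \<gamma> are eigenvalues of A, of which there are finitely many;
  injectivity of Frobenius turns a coincidence among them into a period.\<close>

lemma orbit_length:
  assumes "eigenpair A \<gamma> y"
  obtains d where "d > 0" "\<gamma> ^ (q ^ d) = \<gamma>" "\<And>i. 0 < i \<Longrightarrow> i < d \<Longrightarrow> \<gamma> ^ (q ^ i) \<noteq> \<gamma>"
proof -
  have "range (\<lambda>i. \<gamma> ^ (q ^ i)) \<subseteq> {\<gamma>. \<exists>y. eigenpair A \<gamma> y}" using eigenpair_fpow[OF assms] by blast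
  then have "finite (range (\<lambda>i::nat. \<gamma> ^ (q ^ i)))" using finite_eigenvalues finite_subset by blast
  then have "\<not> inj (\<lambda>i::nat. \<gamma> ^ (q ^ i))" using finite_imageD infinite_UNIV_nat by blast
  then obtain i j where ij: "i < j" "\<gamma> ^ (q ^ i) = \<gamma> ^ (q ^ j)" unfolding inj_def by (metis linorder_neqE_nat)
  have "q ^ j = q ^ (j - i) * q ^ i" using ij(1) by (simp flip: power_add)
  then have "\<gamma> ^ (q ^ i) = (\<gamma> ^ (q ^ (j - i))) ^ (q ^ i)" using ij(2) by (simp only: power_mult)
  then have "\<gamma> ^ (q ^ (j - i)) = \<gamma>" by (metis power_q_inject)
  then have ex: "\<exists>d. d > 0 \<and> \<gamma> ^ (q ^ d) = \<gamma>" using ij(1) by (intro exI[of _ "j - i"]) auto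
  define d where "d = (LEAST d. d > 0 \<and> \<gamma> ^ (q ^ d) = \<gamma>)"
  have "d > 0 \<and> \<gamma> ^ (q ^ d) = \<gamma>" unfolding d_def by (rule LeastI_ex[OF ex])
  moreover have "\<gamma> ^ (q ^ i) \<noteq> \<gamma>" if "0 < i" "i < d" for i
    using not_less_Least[OF that(2)[unfolded d_def]] that(1) by blast
  ultimately show thesis using that[of d] by blast
qed

lemma orbit_distinct:
  assumes "\<And>i. 0 < i \<Longrightarrow> i < d \<Longrightarrow> \<gamma> ^ (q ^ i) \<noteq> (\<gamma>::'k)" "i < d" "j < d" "\<gamma> ^ (q ^ i) = \<gamma> ^ (q ^ j)"
  shows "i = j"
proof -
  have False if ij: "i < j" "j < d" "\<gamma> ^ (q ^ i) = \<gamma> ^ (q ^ j)" for i j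
  proof -
    have "q ^ j = q ^ (j - i) * q ^ i" using ij(1) by (simp flip: power_add)
    then have "\<gamma> ^ (q ^ i) = (\<gamma> ^ (q ^ (j - i))) ^ (q ^ i)" using ij(3) by (simp only: power_mult)
    then have "\<gamma> ^ (q ^ (j - i)) = \<gamma>" by (metis power_q_inject)
    then show False using assms(1)[of "j - i"] ij by simp
  qed
  then show ?thesis using assms(2-4) by (metis linorder_neqE_nat)
qed

text \<open>Let d be the length of the orbit of \<gamma>. An eigenvector w outside the family is
  chosen to be fixed by the d-th power of Frobenius, so that its images close up to a cycle of d
  vectors. A left eigenvector with the same invariance and product 1 with w provides the dual
  rows.\<close>

lemma extend_family:
  assumes fam: "eigenfamily A n k \<pi> \<delta> V W" and ep: "eigenpair A \<gamma> y" and Wy: "W * y = 0\<^sub>m k 1"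
  obtains d V' W' where "d > 0" "\<gamma> ^ (q ^ d) = \<gamma>" "\<And>i. 0 < i \<Longrightarrow> i < d \<Longrightarrow> \<gamma> ^ (q ^ i) \<noteq> \<gamma>"
    "eigenfamily A n (k + d) (\<lambda>a. if a < k then \<pi> a else k + Suc (a - k) mod d)
       (\<lambda>a. if a < k then \<delta> a else \<gamma> ^ (q ^ (a - k))) V' W'"
proof -
  have V: "V \<in> carrier_mat n k" and W: "W \<in> carrier_mat k n" and WV: "W * V = 1\<^sub>m k"
    and AV: "A * V = V * mat_diag k \<delta>" and WA: "W * A = mat_diag k \<delta> * W" and bij: "bij_betw \<pi> {..<k} {..<k}"
    and Vq: "\<And>i a. i < n \<Longrightarrow> a < k \<Longrightarrow> V $$ (i, a) ^ q = V $$ (i, \<pi> a)"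
    and Wq: "\<And>i a. i < n \<Longrightarrow> a < k \<Longrightarrow> W $$ (a, i) ^ q = W $$ (\<pi> a, i)"
    using fam unfolding eigenfamily_def by auto
  interpret biorthogonal n k V W by unfold_locales (fact V W WV)+
  note stable = family_annihilates_fpow[OF fam]
  obtain d where d: "d > 0" "\<gamma> ^ (q ^ d) = \<gamma>" "\<And>i. 0 < i \<Longrightarrow> i < d \<Longrightarrow> \<gamma> ^ (q ^ i) \<noteq> \<gamma>"
    using orbit_length[OF ep] by metis
  have y: "y \<in> carrier_mat n 1" "y \<noteq> 0\<^sub>m n 1" "A * y = \<gamma> \<cdot>\<^sub>m y" using ep unfolding eigenpair_def by auto
  have fpA: "A * fpow i x = fpow i (A * x)" if "x \<in> carrier_mat n l" for i x l
    using that by (simp add: fpow_mult fpow_rational[OF A_rational])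
  have fpA': "fpow i x * A = fpow i (x * A)" if "x \<in> carrier_mat l n" for i x l
    using that by (simp add: fpow_mult fpow_rational[OF A_rational])
  obtain i0 where i0: "i0 < n" "y $$ (i0, 0) \<noteq> 0" using y(1,2) by (metis carrier_matD eq_matI index_zero_mat less_one)
  \<comment> \<open>Normalizing the coordinate i0 to 1 gives an affine space that misses 0. The d-th
    power of Frobenius preserves it because it fixes \<gamma>.\<close>
  define S where "S = {x \<in> carrier_mat n 1. A * x = \<gamma> \<cdot>\<^sub>m x \<and> W * x = 0\<^sub>m k 1 \<and> x $$ (i0, 0) = 1}"
  have "(1 / y $$ (i0, 0)) \<cdot>\<^sub>m y \<in> S" unfolding S_def using y Wy i0
    by (auto simp: smult_mat_mult_right smult_smult_mat mult.commute intro!: eq_matI)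
  then have neS: "S \<noteq> {}" by blast
  have FS: "fpow d x \<in> S" if "x \<in> S" for x
  proof -
    have x: "x \<in> carrier_mat n 1" "A * x = \<gamma> \<cdot>\<^sub>m x" "W * x = 0\<^sub>m k 1" "x $$ (i0, 0) = 1" using that unfolding S_def by auto
    have "A * fpow d x = \<gamma> \<cdot>\<^sub>m fpow d x" unfolding fpA[OF x(1)] x(2) fpow_smult d(2) ..
    moreover have "fpow d x \<in> carrier_mat n 1" using x by (intro carrier_matI) auto
    ultimately show ?thesis unfolding S_def using stable(1)[OF x(1,3)] x i0 by simp
  qed
  have affS: "x + t \<cdot>\<^sub>m (z - x) \<in> S" if "x \<in> S" "z \<in> S" for x z t
  proof -
    have x: "x \<in> carrier_mat n 1" "A * x = \<gamma> \<cdot>\<^sub>m x" "W * x = 0\<^sub>m k 1" "x $$ (i0, 0) = 1" using that unfolding S_def by auto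
    have z: "z \<in> carrier_mat n 1" "A * z = \<gamma> \<cdot>\<^sub>m z" "W * z = 0\<^sub>m k 1" "z $$ (i0, 0) = 1" using that unfolding S_def by auto
    have [simp]: "dim_row x = n" "dim_col x = 1" "dim_row z = n" "dim_col z = 1" using x z by auto
    have "A * (x + t \<cdot>\<^sub>m (z - x)) = \<gamma> \<cdot>\<^sub>m x + t \<cdot>\<^sub>m (\<gamma> \<cdot>\<^sub>m z - \<gamma> \<cdot>\<^sub>m x)"
      by (simp add: mat_ring smult_mat_mult_right x(2) z(2))
    also have "\<dots> = \<gamma> \<cdot>\<^sub>m (x + t \<cdot>\<^sub>m (z - x))" by (intro eq_matI) (simp_all add: algebra_simps)
    finally have 1: "A * (x + t \<cdot>\<^sub>m (z - x)) = \<gamma> \<cdot>\<^sub>m (x + t \<cdot>\<^sub>m (z - x))" .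
    have "W * (x + t \<cdot>\<^sub>m (z - x)) = 0\<^sub>m k 1 + t \<cdot>\<^sub>m (0\<^sub>m k 1 - 0\<^sub>m k 1)"
      by (simp add: mat_ring smult_mat_mult_right x(3) z(3))
    also have "\<dots> = 0\<^sub>m k 1" by (intro eq_matI) simp_all
    finally have 2: "W * (x + t \<cdot>\<^sub>m (z - x)) = 0\<^sub>m k 1" .
    have "x + t \<cdot>\<^sub>m (z - x) \<in> carrier_mat n 1" by (intro carrier_matI) auto
    then show ?thesis unfolding S_def using 1 2 x z i0 by simp
  qed
  obtain w where wS: "w \<in> S" and wd: "fpow d w = w"
    by (rule rationalize[of S n 1 d]) (use neS FS affS in \<open>auto simp: S_def\<close>)
  have w: "w \<in> carrier_mat n 1" "A * w = \<gamma> \<cdot>\<^sub>m w" "W * w = 0\<^sub>m k 1" "w $$ (i0, 0) = 1" using wS unfolding S_def by auto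
  have [simp]: "dim_row w = n" "dim_col w = 1" using w by auto
  have "w \<noteq> 0\<^sub>m n 1" using w(4) i0 by auto
  then have "eigenpair A \<gamma> w" unfolding eigenpair_def using w by simp
  then obtain \<eta>0 where e0: "\<eta>0 \<in> carrier_mat 1 n" "\<eta>0 * A = \<gamma> \<cdot>\<^sub>m \<eta>0" "\<eta>0 * w = 1\<^sub>m 1" by (rule left_eigenvector)
  have [simp]: "dim_row \<eta>0 = 1" "dim_col \<eta>0 = n" using e0 by auto
  \<comment> \<open>The corresponding affine space of left eigenvectors, required to vanish on V and
    to be dual to w. Subtracting \<open>\<eta>0 * V * W\<close> from \<open>\<eta>0\<close> shows
    that it is not empty.\<close>
  define T where "T = {x \<in> carrier_mat 1 n. x * A = \<gamma> \<cdot>\<^sub>m x \<and> x * V = 0\<^sub>m 1 k \<and> x * w = 1\<^sub>m 1}"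
  have "\<eta>0 - \<eta>0 * V * W \<in> T"
  proof -
    have "(\<eta>0 - \<eta>0 * V * W) * A = \<gamma> \<cdot>\<^sub>m \<eta>0 - \<eta>0 * V * (W * A)" by (simp add: mat_ring e0(2))
    also have "\<eta>0 * V * (W * A) = \<eta>0 * (A * V) * W" unfolding WA AV by (simp add: mat_ring)
    also have "\<dots> = (\<eta>0 * A) * V * W" by (simp add: mat_ring)
    also have "\<gamma> \<cdot>\<^sub>m \<eta>0 - (\<eta>0 * A) * V * W = \<gamma> \<cdot>\<^sub>m (\<eta>0 - \<eta>0 * V * W)" unfolding e0(2)
      by (simp add: smult_mat_mult_left) (intro eq_matI; simp add: algebra_simps)
    finally have 1: "(\<eta>0 - \<eta>0 * V * W) * A = \<gamma> \<cdot>\<^sub>m (\<eta>0 - \<eta>0 * V * W)" .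
    have 2: "(\<eta>0 - \<eta>0 * V * W) * V = 0\<^sub>m 1 k" by (simp add: mat_ring WV) (intro eq_matI; simp)
    have "(\<eta>0 - \<eta>0 * V * W) * w = 1\<^sub>m 1 - \<eta>0 * V * 0\<^sub>m k 1" by (simp add: mat_ring e0(3) w(3))
    also have "\<dots> = 1\<^sub>m 1" by (intro eq_matI) simp_all
    finally have 3: "(\<eta>0 - \<eta>0 * V * W) * w = 1\<^sub>m 1" .
    have "\<eta>0 - \<eta>0 * V * W \<in> carrier_mat 1 n" by (intro carrier_matI) auto
    then show ?thesis unfolding T_def using 1 2 3 by blast
  qed
  then have neT: "T \<noteq> {}" by blast
  have FT: "fpow d x \<in> T" if "x \<in> T" for x
  proof -
    have x: "x \<in> carrier_mat 1 n" "x * A = \<gamma> \<cdot>\<^sub>m x" "x * V = 0\<^sub>m 1 k" "x * w = 1\<^sub>m 1" using that unfolding T_def by auto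
    have "fpow d x * A = \<gamma> \<cdot>\<^sub>m fpow d x" unfolding fpA'[OF x(1)] x(2) fpow_smult d(2) ..
    moreover have "fpow d x * w = fpow d (x * w)" using x(1) wd by (simp add: fpow_mult)
    then have "fpow d x * w = 1\<^sub>m 1" unfolding x(4) fpow_rational[OF rational_one] .
    moreover have "fpow d x \<in> carrier_mat 1 n" using x by (intro carrier_matI) auto
    ultimately show ?thesis unfolding T_def using stable(2)[OF x(1,3)] by simp
  qed
  have affT: "x + t \<cdot>\<^sub>m (z - x) \<in> T" if "x \<in> T" "z \<in> T" for x z t
  proof -
    have x: "x \<in> carrier_mat 1 n" "x * A = \<gamma> \<cdot>\<^sub>m x" "x * V = 0\<^sub>m 1 k" "x * w = 1\<^sub>m 1" using that unfolding T_def by auto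
    have z: "z \<in> carrier_mat 1 n" "z * A = \<gamma> \<cdot>\<^sub>m z" "z * V = 0\<^sub>m 1 k" "z * w = 1\<^sub>m 1" using that unfolding T_def by auto
    have [simp]: "dim_row x = 1" "dim_col x = n" "dim_row z = 1" "dim_col z = n" using x z by auto
    have "(x + t \<cdot>\<^sub>m (z - x)) * A = \<gamma> \<cdot>\<^sub>m x + t \<cdot>\<^sub>m (\<gamma> \<cdot>\<^sub>m z - \<gamma> \<cdot>\<^sub>m x)"
      by (simp add: mat_ring smult_mat_mult_left x(2) z(2))
    also have "\<dots> = \<gamma> \<cdot>\<^sub>m (x + t \<cdot>\<^sub>m (z - x))" by (intro eq_matI) (simp_all add: algebra_simps)
    finally have 1: "(x + t \<cdot>\<^sub>m (z - x)) * A = \<gamma> \<cdot>\<^sub>m (x + t \<cdot>\<^sub>m (z - x))" .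
    have "(x + t \<cdot>\<^sub>m (z - x)) * V = 0\<^sub>m 1 k + t \<cdot>\<^sub>m (0\<^sub>m 1 k - 0\<^sub>m 1 k)"
      by (simp add: mat_ring smult_mat_mult_left x(3) z(3))
    also have "\<dots> = 0\<^sub>m 1 k" by (intro eq_matI) simp_all
    finally have 2: "(x + t \<cdot>\<^sub>m (z - x)) * V = 0\<^sub>m 1 k" .
    have "(x + t \<cdot>\<^sub>m (z - x)) * w = 1\<^sub>m 1 + t \<cdot>\<^sub>m (1\<^sub>m 1 - 1\<^sub>m 1)"
      by (simp add: mat_ring smult_mat_mult_left x(4) z(4))
    also have "\<dots> = 1\<^sub>m 1" by (intro eq_matI) simp_all
    finally have 3: "(x + t \<cdot>\<^sub>m (z - x)) * w = 1\<^sub>m 1" .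
    have "x + t \<cdot>\<^sub>m (z - x) \<in> carrier_mat 1 n" by (intro carrier_matI) auto
    then show ?thesis unfolding T_def using 1 2 3 by blast
  qed
  obtain \<eta> where eT: "\<eta> \<in> T" and ed: "fpow d \<eta> = \<eta>"
    by (rule rationalize[of T 1 n d]) (use neT FT affT in \<open>auto simp: T_def\<close>)
  have e: "\<eta> \<in> carrier_mat 1 n" "\<eta> * A = \<gamma> \<cdot>\<^sub>m \<eta>" "\<eta> * V = 0\<^sub>m 1 k" "\<eta> * w = 1\<^sub>m 1" using eT unfolding T_def by auto
  have [simp]: "dim_row \<eta> = 1" "dim_col \<eta> = n" using e by auto
  \<comment> \<open>The indices from k on form a d-cycle: Frobenius sends the last new vector back
    to the first, since w is fixed by the d-th power.\<close>
  define \<pi>' where "\<pi>' a = (if a < k then \<pi> a else k + Suc (a - k) mod d)" for a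
  define \<delta>' where "\<delta>' a = (if a < k then \<delta> a else \<gamma> ^ (q ^ (a - k)))" for a
  define V' where "V' = mat n (k + d) (\<lambda>(i, a). if a < k then V $$ (i, a) else fpow (a - k) w $$ (i, 0))"
  define W' where "W' = mat (k + d) n (\<lambda>(a, i). if a < k then W $$ (a, i) else fpow (a - k) \<eta> $$ (0, i))"
  have V'c: "V' \<in> carrier_mat n (k + d)" and W'c: "W' \<in> carrier_mat (k + d) n" unfolding V'_def W'_def by simp_all
  have fw: "fpow i w \<in> carrier_mat n 1" and fe: "fpow i \<eta> \<in> carrier_mat 1 n" for i by (auto intro: carrier_matI)
  have ev: "A * fpow i w = \<gamma> ^ (q ^ i) \<cdot>\<^sub>m fpow i w" for i unfolding fpA[OF w(1)] w(2) fpow_smult ..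
  have ev': "fpow i \<eta> * A = \<gamma> ^ (q ^ i) \<cdot>\<^sub>m fpow i \<eta>" for i unfolding fpA'[OF e(1)] e(2) fpow_smult ..
  have z01: "(0::nat) < 1" by simp
  \<comment> \<open>Left and right eigenvectors for different eigenvalues are orthogonal, and the
    eigenvalues along the orbit differ; for i = j the product is a Frobenius image of 1.\<close>
  have pair: "(fpow i \<eta> * fpow j w) $$ (0, 0) = (if i = j then 1 else 0)" if "i < d" "j < d" for i j
  proof (cases "i = j")
    case True
    have "fpow i \<eta> * fpow i w = fpow i (\<eta> * w)" by (simp add: fpow_mult)
    also have "\<dots> = 1\<^sub>m 1" unfolding e(4) by (rule fpow_rational[OF rational_one])
    finally show ?thesis using True by (simp del: index_mult_mat(1))
  next
    case False
    have "\<gamma> ^ (q ^ i) \<cdot>\<^sub>m (fpow i \<eta> * fpow j w) = (fpow i \<eta> * A) * fpow j w" unfolding ev' by (simp add: smult_mat_mult_left)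
    also have "\<dots> = fpow i \<eta> * (A * fpow j w)" by (simp add: mat_ring)
    also have "\<dots> = \<gamma> ^ (q ^ j) \<cdot>\<^sub>m (fpow i \<eta> * fpow j w)" unfolding ev by (simp add: smult_mat_mult_right)
    finally have "(\<gamma> ^ (q ^ i) \<cdot>\<^sub>m (fpow i \<eta> * fpow j w)) $$ (0, 0) = (\<gamma> ^ (q ^ j) \<cdot>\<^sub>m (fpow i \<eta> * fpow j w)) $$ (0, 0)" by simp
    then have "\<gamma> ^ (q ^ i) * (fpow i \<eta> * fpow j w) $$ (0, 0) = \<gamma> ^ (q ^ j) * (fpow i \<eta> * fpow j w) $$ (0, 0)"
      by (simp del: index_mult_mat(1))
    moreover have "\<gamma> ^ (q ^ i) \<noteq> \<gamma> ^ (q ^ j)" using orbit_distinct[OF d(3) that] False by blast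
    ultimately show ?thesis using False by (simp del: index_mult_mat(1))
  qed
  have WV': "W' * V' = 1\<^sub>m (k + d)"
  proof (rule eq_matI)
    fix a b assume "a < dim_row (1\<^sub>m (k + d) :: 'k mat)" "b < dim_col (1\<^sub>m (k + d) :: 'k mat)"
    then have ab: "a < k + d" "b < k + d" by auto
    have s: "(W' * V') $$ (a, b) = (\<Sum>x<n. W' $$ (a, x) * V' $$ (x, b))" by (rule mult_col_index[OF W'c V'c ab])
    consider "a < k" "b < k" | "a < k" "\<not> b < k" | "\<not> a < k" "b < k" | "\<not> a < k" "\<not> b < k" by blast
    then show "(W' * V') $$ (a, b) = 1\<^sub>m (k + d) $$ (a, b)"
    proof cases
      case 1
      then have "(W' * V') $$ (a, b) = (W * V) $$ (a, b)" unfolding s mult_col_index[OF W V 1]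
        using ab by (intro sum.cong refl) (simp add: W'_def V'_def)
      then show ?thesis unfolding WV using 1 ab by simp
    next
      case 2
      then have "(W' * V') $$ (a, b) = (W * fpow (b - k) w) $$ (a, 0)" unfolding s mult_col_index[OF W fw 2(1) z01]
        using ab by (intro sum.cong refl) (simp add: W'_def V'_def)
      then show ?thesis unfolding stable(1)[OF w(1,3)] using 2 ab by simp
    next
      case 3
      then have "(W' * V') $$ (a, b) = (fpow (a - k) \<eta> * V) $$ (0, b)" unfolding s mult_col_index[OF fe V z01 3(2)]
        using ab by (intro sum.cong refl) (simp add: W'_def V'_def)
      then show ?thesis unfolding stable(2)[OF e(1,3)] using 3 ab by simp
    next
      case 4
      then have "(W' * V') $$ (a, b) = (fpow (a - k) \<eta> * fpow (b - k) w) $$ (0, 0)"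
        unfolding s mult_col_index[OF fe fw z01 z01]
        using ab by (intro sum.cong refl) (simp add: W'_def V'_def)
      also have "\<dots> = (if a - k = b - k then 1 else 0)" using 4 ab by (intro pair) auto
      finally show ?thesis using 4 ab by auto
    qed
  qed (use V'c W'c in auto)
  have AV': "A * V' = V' * mat_diag (k + d) \<delta>'"
    unfolding mat_diag_mult_right[OF V'c]
  proof (rule eq_matI, goal_cases)
    case (1 i a)
    then have ia: "i < n" "a < k + d" by auto
    show ?case
    proof (cases "a < k")
      case True
      then have "(A * V') $$ (i, a) = (A * V) $$ (i, a)" unfolding mult_col_index[OF A_carrier V'c ia] mult_col_index[OF A_carrier V ia(1) True]
        using ia by (intro sum.cong refl) (simp add: V'_def)
      then show ?thesis unfolding AV mat_diag_mult_right[OF V] using True ia by (simp add: V'_def \<delta>'_def)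
    next
      case False
      then have "(A * V') $$ (i, a) = (A * fpow (a - k) w) $$ (i, 0)"
        unfolding mult_col_index[OF A_carrier V'c ia] mult_col_index[OF A_carrier fw ia(1) z01]
        using ia by (intro sum.cong refl) (simp add: V'_def)
      then show ?thesis unfolding ev using False ia by (simp add: V'_def \<delta>'_def)
    qed
  qed (use V'c in auto)
  have WA': "W' * A = mat_diag (k + d) \<delta>' * W'"
    unfolding mat_diag_mult_left[OF W'c]
  proof (rule eq_matI, goal_cases)
    case (1 a i)
    then have ia: "i < n" "a < k + d" by auto
    show ?case
    proof (cases "a < k")
      case True
      then have "(W' * A) $$ (a, i) = (W * A) $$ (a, i)" unfolding mult_col_index[OF W'c A_carrier ia(2,1)] mult_col_index[OF W A_carrier True ia(1)]
        using ia by (intro sum.cong refl) (simp add: W'_def)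
      then show ?thesis unfolding WA mat_diag_mult_left[OF W] using True ia by (simp add: W'_def \<delta>'_def)
    next
      case False
      then have "(W' * A) $$ (a, i) = (fpow (a - k) \<eta> * A) $$ (0, i)"
        unfolding mult_col_index[OF W'c A_carrier ia(2,1)] mult_col_index[OF fe A_carrier z01 ia(1)]
        using ia by (intro sum.cong refl) (simp add: W'_def)
      then show ?thesis unfolding ev' using False ia by (simp add: W'_def \<delta>'_def)
    qed
  qed (use W'c in auto)
  have pow_Suc: "(x ^ (q ^ i)) ^ q = x ^ (q ^ Suc i)" for x :: 'k and i by (simp add: power_mult[symmetric] mult.commute)
  have cyc: "x ^ (q ^ Suc i) = x ^ (q ^ (Suc i mod d))" if "x ^ (q ^ d) = x" "i < d" for x :: 'k and i
    using that d(1) by (cases "Suc i = d") auto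
  have V'q: "V' $$ (i, a) ^ q = V' $$ (i, \<pi>' a)" if ia: "i < n" "a < k + d" for i a
  proof (cases "a < k")
    case True
    have "\<pi> a < k" using bij True by (auto dest: bij_betwE)
    then show ?thesis using True ia Vq by (simp add: V'_def \<pi>'_def)
  next
    case False
    have "w $$ (i, 0) ^ (q ^ d) = w $$ (i, 0)" using arg_cong[OF wd, of "\<lambda>M. M $$ (i, 0)"] ia by simp
    from cyc[OF this, of "a - k"] have "(w $$ (i, 0) ^ (q ^ (a - k))) ^ q = w $$ (i, 0) ^ (q ^ (Suc (a - k) mod d))"
      unfolding pow_Suc using False ia by simp
    moreover have "Suc (a - k) mod d < d" using d(1) by simp
    ultimately show ?thesis using False ia by (simp add: V'_def \<pi>'_def)
  qed
  have W'q: "W' $$ (a, i) ^ q = W' $$ (\<pi>' a, i)" if ia: "i < n" "a < k + d" for i a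
  proof (cases "a < k")
    case True
    have "\<pi> a < k" using bij True by (auto dest: bij_betwE)
    then show ?thesis using True ia Wq by (simp add: W'_def \<pi>'_def)
  next
    case False
    have "\<eta> $$ (0, i) ^ (q ^ d) = \<eta> $$ (0, i)" using arg_cong[OF ed, of "\<lambda>M. M $$ (0, i)"] ia by simp
    from cyc[OF this, of "a - k"] have "(\<eta> $$ (0, i) ^ (q ^ (a - k))) ^ q = \<eta> $$ (0, i) ^ (q ^ (Suc (a - k) mod d))"
      unfolding pow_Suc using False ia by simp
    moreover have "Suc (a - k) mod d < d" using d(1) by simp
    ultimately show ?thesis using False ia by (simp add: W'_def \<pi>'_def)
  qed
  have bij': "bij_betw \<pi>' {..<k + d} {..<k + d}"
  proof -
    have pik: "\<pi> a < k" if "a < k" for a using bij that by (auto dest: bij_betwE)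
    have "inj_on \<pi>' {..<k + d}"
    proof (rule inj_onI)
      fix a b assume ab: "a \<in> {..<k + d}" "b \<in> {..<k + d}" "\<pi>' a = \<pi>' b"
      show "a = b"
      proof (cases "a < k")
        case True
        then have "b < k" using ab(3) pik[OF True] unfolding \<pi>'_def by (auto split: if_splits)
        then show ?thesis using True ab(3) bij unfolding \<pi>'_def bij_betw_def inj_on_def by simp
      next
        case False
        then have b: "\<not> b < k" using ab(3) pik[of b] unfolding \<pi>'_def by (auto split: if_splits)
        then have "Suc (a - k) mod d = Suc (b - k) mod d" using ab(3) False unfolding \<pi>'_def by simp
        moreover have "a - k < d" "b - k < d" using ab False b by auto
        ultimately have "a - k = b - k" by (metis mod_Suc mod_less nat.inject nat.simps(3))
        then show ?thesis using False b by simp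
      qed
    qed
    moreover have "\<pi>' ` {..<k + d} \<subseteq> {..<k + d}"
      using pik d(1) by (auto simp: \<pi>'_def trans_less_add1)
    ultimately show ?thesis unfolding bij_betw_def by (simp add: endo_inj_surj)
  qed
  have "eigenfamily A n (k + d) \<pi>' \<delta>' V' W'" unfolding eigenfamily_def
    using V'c W'c WV' AV' WA' bij' V'q W'q by blast
  then show thesis using that[OF d] unfolding \<pi>'_def \<delta>'_def by blast
qed

lemma right_eigen_annihilated:
  assumes fam: "eigenfamily A n k \<pi> \<delta> V W" and y: "y \<in> carrier_mat n 1" "A * y = \<gamma> \<cdot>\<^sub>m y" and ne: "\<And>a. a < k \<Longrightarrow> \<delta> a \<noteq> \<gamma>"
  shows "W * y = 0\<^sub>m k 1"
proof -
  have W: "W \<in> carrier_mat k n" and WA: "W * A = mat_diag k \<delta> * W" using fam unfolding eigenfamily_def by auto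
  have [simp]: "dim_row W = k" "dim_col W = n" "dim_row y = n" "dim_col y = 1" using W y by auto
  have c: "W * y \<in> carrier_mat k 1" by (intro carrier_matI) auto
  have e: "mat_diag k \<delta> * (W * y) = \<gamma> \<cdot>\<^sub>m (W * y)"
  proof -
    have "mat_diag k \<delta> * (W * y) = (W * A) * y" unfolding WA by (simp add: mult_mat_assoc)
    then show ?thesis by (simp add: mult_mat_assoc y(2) smult_mat_mult_right)
  qed
  show ?thesis
  proof (rule eq_matI)
    fix a b assume "a < dim_row (0\<^sub>m k 1 :: 'k mat)" "b < dim_col (0\<^sub>m k 1 :: 'k mat)"
    then have ab: "a < k" "b < 1" by auto
    have "(mat_diag k \<delta> * (W * y)) $$ (a, b) = \<delta> a * (W * y) $$ (a, b)"
      unfolding mat_diag_mult_left[OF c] using ab by simp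
    moreover have "(mat_diag k \<delta> * (W * y)) $$ (a, b) = \<gamma> * (W * y) $$ (a, b)" unfolding e using ab by simp
    ultimately show "(W * y) $$ (a, b) = 0\<^sub>m k 1 $$ (a, b)" using ne[OF ab(1)] ab by (simp del: index_mult_mat(1))
  qed auto
qed

lemma left_eigen_annihilated:
  assumes fam: "eigenfamily A n k \<pi> \<delta> V W" and y: "y \<in> carrier_mat 1 n" "y * A = \<gamma> \<cdot>\<^sub>m y" and ne: "\<And>a. a < k \<Longrightarrow> \<delta> a \<noteq> \<gamma>"
  shows "y * V = 0\<^sub>m 1 k"
proof -
  have V: "V \<in> carrier_mat n k" and AV: "A * V = V * mat_diag k \<delta>" using fam unfolding eigenfamily_def by auto
  have [simp]: "dim_row V = n" "dim_col V = k" "dim_row y = 1" "dim_col y = n" using V y by auto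
  have c: "y * V \<in> carrier_mat 1 k" by (intro carrier_matI) auto
  have e: "y * V * mat_diag k \<delta> = \<gamma> \<cdot>\<^sub>m (y * V)"
  proof -
    have "y * V * mat_diag k \<delta> = y * (A * V)" unfolding AV by (simp add: mult_mat_assoc)
    also have "\<dots> = (y * A) * V" by (simp add: mult_mat_assoc)
    finally show ?thesis by (simp add: y(2) smult_mat_mult_left)
  qed
  show ?thesis
  proof (rule eq_matI)
    fix b a assume "b < dim_row (0\<^sub>m 1 k :: 'k mat)" "a < dim_col (0\<^sub>m 1 k :: 'k mat)"
    then have ab: "a < k" "b < 1" by auto
    have "(y * V * mat_diag k \<delta>) $$ (b, a) = (y * V) $$ (b, a) * \<delta> a"
      unfolding mat_diag_mult_right[OF c] using ab by simp
    moreover have "(y * V * mat_diag k \<delta>) $$ (b, a) = \<gamma> * (y * V) $$ (b, a)" unfolding e using ab by simp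
    ultimately show "(y * V) $$ (b, a) = 0\<^sub>m 1 k $$ (b, a)" using ne[OF ab(1)] ab by (simp del: index_mult_mat(1))
  qed auto
qed

lemma geometric_sum: "(\<Sum>i<d. q ^ i) * (q - 1) + 1 = q ^ d"
proof (induction d)
  case (Suc d)
  have "(\<Sum>i<Suc d. q ^ i) * (q - 1) + 1 = ((\<Sum>i<d. q ^ i) * (q - 1) + 1) + q ^ d * (q - 1)" by (simp add: algebra_simps)
  also have "\<dots> = q ^ d + q ^ d * (q - 1)" unfolding Suc ..
  also have "\<dots> = q ^ d * (1 + (q - 1))" by (simp add: distrib_left)
  also have "\<dots> = q ^ Suc d" using q_gt_1 by simp
  finally show ?case .
qed simp

text \<open>Surjectivity of the norm of \<open>F\<^bsub>q^d\<^esub>\<close> over \<open>F\<^bsub>q\<^esub>\<close>, applied to one Frobenius orbit of eigenvectors.\<close>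

lemma centralizer_det:
  assumes n: "n > 0" and t: "t \<noteq> 0" "t ^ q = t"
  obtains c where "c \<in> carrier_mat n n" "rational c" "det c = t" "c * A = A * c"
proof -
  have emp: "0\<^sub>m n 0 * 0\<^sub>m 0 n \<noteq> (1\<^sub>m n :: 'k mat)" by (rule no_wide_factorization[OF _ _ n]) auto
  note f0 = eigenfamily_empty[OF A_carrier]
  obtain \<gamma> y where y: "eigenpair A \<gamma> y" "0\<^sub>m 0 n * y = 0\<^sub>m 0 1" by (rule complement_eigenvector[OF f0 emp])
  obtain d V W where d: "d > 0" and fam: "eigenfamily A n (0 + d) (\<lambda>a. if a < 0 then id a else 0 + Suc (a - 0) mod d)
       (\<lambda>a. if a < 0 then 0 else \<gamma> ^ (q ^ (a - 0))) V W"
    by (rule extend_family[OF f0 y]) (rule that)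
  define \<pi> where "\<pi> a = Suc a mod d" for a
  define \<delta> where "\<delta> a = \<gamma> ^ (q ^ a)" for a :: nat
  have fam: "eigenfamily A n d \<pi> \<delta> V W" using fam unfolding \<pi>_def \<delta>_def by simp
  have V: "V \<in> carrier_mat n d" and W: "W \<in> carrier_mat d n" and WV: "W * V = 1\<^sub>m d"
    and AV: "A * V = V * mat_diag d \<delta>" and WA: "W * A = mat_diag d \<delta> * W" using fam unfolding eigenfamily_def by auto
  interpret biorthogonal n d V W by unfold_locales (fact V W WV)+
  have N: "(\<Sum>i<d. q ^ i) > 0" using d q_gt_1 by (intro sum_pos) auto
  \<comment> \<open>The exponent 1 + q + ... + q^(d-1) is that of the norm. A root z exists in the
    algebraically closed field, and t^(q-1) = 1 puts it into F_(q^d).\<close>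
  obtain z where z: "z ^ (\<Sum>i<d. q ^ i) = t" using nth_root_exists[OF N, of t] by blast
  have "t ^ (q - 1) * t = t" using t(2) q_gt_1 by (simp flip: power_Suc2)
  then have t1: "t ^ (q - 1) = 1" using t(1) by simp
  have "z ^ (q ^ d) = z ^ ((\<Sum>i<d. q ^ i) * (q - 1) + 1)" unfolding geometric_sum ..
  also have "\<dots> = z" by (simp only: power_add power_mult power_one_right z t1 mult_1_left)
  finally have zd: "z ^ (q ^ d) = z" .
  \<comment> \<open>The conjugates of z along the cycle: equivariant under Frobenius, commuting with
    the diagonal matrix of eigenvalues, and with the norm of z, which is t, as determinant.\<close>
  define Y where "Y = mat_diag d (\<lambda>i. z ^ (q ^ i))"
  have Yc: "Y \<in> carrier_mat d d" unfolding Y_def by simp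
  have "rational (twist d V W Y)"
  proof (rule twist_rational[OF fam Yc])
    fix a b assume ab: "a < d" "b < d"
    have "Suc a mod d = Suc b mod d \<longleftrightarrow> a = b" using ab by (metis mod_Suc mod_less nat.inject nat.simps(3))
    moreover have "z ^ (q ^ (Suc b mod d)) = (z ^ (q ^ b)) ^ q"
    proof -
      have "z ^ (q ^ (Suc b mod d)) = z ^ (q ^ Suc b)" using ab d zd by (cases "Suc b = d") auto
      then show ?thesis by (simp add: power_mult[symmetric] mult.commute)
    qed
    moreover have "Suc a mod d < d" "Suc b mod d < d" using d by auto
    ultimately show "Y $$ (\<pi> a, \<pi> b) = Y $$ (a, b) ^ q" using ab q_gt_1 unfolding Y_def \<pi>_def by simp
  qed
  moreover have "det (twist d V W Y) = t"
  proof -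
    have "det Y = t" unfolding Y_def det_mat_diag using z by (simp add: power_sum)
    then show ?thesis by (simp add: twist_det[OF Yc])
  qed
  moreover have "twist d V W Y * A = A * twist d V W Y"
  proof -
    have "Y * mat_diag d \<delta> = mat_diag d \<delta> * Y" unfolding Y_def by (simp add: mult.commute)
    from twist_conj[OF A_carrier mat_diag_dim mat_diag_dim AV WA Yc this]
    have "perturb A (mat_diag d \<delta>) (mat_diag d \<delta>) * twist d V W Y = twist d V W Y * A" .
    moreover have "perturb A (mat_diag d \<delta>) (mat_diag d \<delta>) = A"
    proof -
      have z: "mat_diag d \<delta> - mat_diag d \<delta> = 0\<^sub>m d d" by (intro eq_matI) auto
      have "V * 0\<^sub>m d d * W = 0\<^sub>m n n" using right_mult_zero_mat[OF V] left_mult_zero_mat[OF W] by simp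
      then show ?thesis unfolding perturb_def z by (intro eq_matI) auto
    qed
    ultimately show ?thesis by simp
  qed
  ultimately show thesis using that[of "twist d V W Y"] by simp
qed

text \<open>B is A with its action on the family replaced by D'. The twist by Y carries A to B over
  F_q but has determinant det Y; multiplying it by an element of the centralizer of A with the
  inverse determinant puts the conjugating element into SL_n(q).\<close>

lemma conjugate_family:
  assumes n: "n > 0" and Ai: "Ai \<in> carrier_mat n n" "A * Ai = 1\<^sub>m n"
    and fam: "eigenfamily A n k \<pi> \<delta> V W" and D': "D' \<in> carrier_mat k k"
    and Y: "Y \<in> carrier_mat k k" "Yi \<in> carrier_mat k k" "Y * Yi = 1\<^sub>m k" "Y * mat_diag k \<delta> = D' * Y"
    and Yq: "\<And>a b. a < k \<Longrightarrow> b < k \<Longrightarrow> Y $$ (\<pi> a, \<pi> b) = Y $$ (a, b) ^ q"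
  obtains g gi B Bi where "g \<in> carrier_mat n n" "gi \<in> carrier_mat n n" "g * gi = 1\<^sub>m n" "rational g" "det g = 1"
    "B \<in> carrier_mat n n" "Bi \<in> carrier_mat n n" "B * Bi = 1\<^sub>m n" "B * g = g * A"
    "B * V = V * D'" "W * B = D' * W"
    "\<And>y. y \<in> carrier_mat n 1 \<Longrightarrow> W * y = 0\<^sub>m k 1 \<Longrightarrow> B * y = A * y"
    "\<And>z. z \<in> carrier_mat 1 n \<Longrightarrow> z * V = 0\<^sub>m 1 k \<Longrightarrow> z * B = z * A"
proof -
  have V: "V \<in> carrier_mat n k" and W: "W \<in> carrier_mat k n" and WV: "W * V = 1\<^sub>m k"
    and AV: "A * V = V * mat_diag k \<delta>" and WA: "W * A = mat_diag k \<delta> * W" using fam unfolding eigenfamily_def by auto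
  interpret biorthogonal n k V W by unfold_locales (fact V W WV)+
  note ctx = A_carrier mat_diag_dim D' AV WA
  define B where "B = perturb A (mat_diag k \<delta>) D'"
  have Bc: "B \<in> carrier_mat n n" unfolding B_def by (rule perturb_carrier[OF ctx])
  define h where "h = twist k V W Y"
  have hc: "h \<in> carrier_mat n n" unfolding h_def by simp
  have hr: "rational h" unfolding h_def by (rule twist_rational[OF fam Y(1) Yq])
  have Bh: "B * h = h * A" unfolding B_def h_def by (rule twist_conj[OF ctx Y(1,4)])
  have "det h * det (twist k V W Yi) = 1"
    unfolding h_def det_mult[OF twist_carrier(1) twist_carrier(1), symmetric] twist_mult[OF Y(1,2)] Y(3) twist_one by simp
  then have h0: "det h \<noteq> 0" by auto
  have "(1 / det h) ^ q = 1 / det h" using rational_det[OF hr] by (simp add: power_divide)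
  then obtain c where c: "c \<in> carrier_mat n n" "rational c" "det c = 1 / det h" "c * A = A * c"
    using centralizer_det[OF n, of "1 / det h"] h0 by auto
  define g where "g = h * c"
  have gc: "g \<in> carrier_mat n n" unfolding g_def using hc c by simp
  have gr: "rational g" unfolding g_def using hr c hc by (intro rational_mult) auto
  have gd: "det g = 1" unfolding g_def det_mult[OF hc c(1)] c(3) using h0 by simp
  obtain gi where gi: "gi \<in> carrier_mat n n" "g * gi = 1\<^sub>m n" using invertible_obtain[OF gc] gd by auto
  have [simp]: "dim_row h = n" "dim_col h = n" "dim_row c = n" "dim_col c = n" "dim_row B = n" "dim_col B = n"
    "dim_row gi = n" "dim_col gi = n" "dim_row g = n" "dim_col g = n" "dim_row Ai = n" "dim_col Ai = n"
    using hc c Bc gi gc Ai by auto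
  have "B * g = (B * h) * c" unfolding g_def by (simp add: mat_ring)
  also have "\<dots> = h * (A * c)" unfolding Bh by (simp add: mat_ring)
  also have "\<dots> = g * A" unfolding c(4)[symmetric] g_def by (simp add: mat_ring)
  finally have Bg: "B * g = g * A" .
  have "B * (g * Ai * gi) = (B * g) * Ai * gi" by (simp add: mat_ring)
  also have "\<dots> = g * (A * Ai) * gi" unfolding Bg by (simp add: mat_ring)
  also have "\<dots> = 1\<^sub>m n" unfolding Ai(2) using gi(2) by (simp add: mat_ring)
  finally have Bi: "B * (g * Ai * gi) = 1\<^sub>m n" .
  have Bic: "g * Ai * gi \<in> carrier_mat n n" by (intro carrier_matI) auto
  show thesis
    by (rule that[OF gc gi gr gd Bc Bic Bi Bg])
      (auto simp: B_def intro: perturb_V[OF ctx] W_perturb[OF ctx] perturb_right[OF ctx] perturb_left[OF ctx])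
qed

text \<open>Y is the permutation matrix of \<open>\<pi>\<close> itself. It commutes with the
  permutation and has entries 0 and 1, so it meets the Frobenius condition, and it moves every
  eigenvalue one step along its cycle.\<close>

lemma conjugate_family_shift:
  assumes n: "n > 0" and Ai: "Ai \<in> carrier_mat n n" "A * Ai = 1\<^sub>m n"
    and fam: "eigenfamily A n k \<pi> \<delta> V W" and \<delta>': "\<And>a. a < k \<Longrightarrow> \<delta>' (\<pi> a) = \<delta> a"
  obtains g gi B Bi where "g \<in> carrier_mat n n" "gi \<in> carrier_mat n n" "g * gi = 1\<^sub>m n" "rational g" "det g = 1"
    "B \<in> carrier_mat n n" "Bi \<in> carrier_mat n n" "B * Bi = 1\<^sub>m n" "B * g = g * A"
    "B * V = V * mat_diag k \<delta>'" "W * B = mat_diag k \<delta>' * W"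
    "\<And>y. y \<in> carrier_mat n 1 \<Longrightarrow> W * y = 0\<^sub>m k 1 \<Longrightarrow> B * y = A * y"
    "\<And>z. z \<in> carrier_mat 1 n \<Longrightarrow> z * V = 0\<^sub>m 1 k \<Longrightarrow> z * B = z * A"
proof -
  have bij: "bij_betw \<pi> {..<k} {..<k}" using fam unfolding eigenfamily_def by blast
  have pik: "\<pi> a < k" if "a < k" for a using bij that by (auto dest: bij_betwE)
  have pinj: "\<pi> a = \<pi> b \<longleftrightarrow> a = b" if "a < k" "b < k" for a b
    using bij that unfolding bij_betw_def inj_on_def by auto
  define Y :: "'k mat" where "Y = mat k k (\<lambda>(i, j). if i = \<pi> j then 1 else 0)"
  define Yi :: "'k mat" where "Yi = mat k k (\<lambda>(i, j). if j = \<pi> i then 1 else 0)"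
  have c: "Y \<in> carrier_mat k k" "Yi \<in> carrier_mat k k" unfolding Y_def Yi_def by simp_all
  have 1: "Y * Yi = 1\<^sub>m k"
  proof (rule eq_matI)
    fix i j assume "i < dim_row (1\<^sub>m k :: 'k mat)" "j < dim_col (1\<^sub>m k :: 'k mat)"
    then have ij: "i < k" "j < k" by auto
    have "(Y * Yi) $$ (i, j) = (\<Sum>x<k. Y $$ (i, x) * Yi $$ (x, j))" by (rule mult_col_index[OF c ij])
    also have "\<dots> = (\<Sum>x<k. if i = \<pi> x \<and> j = \<pi> x then 1 else 0)" using ij by (intro sum.cong) (auto simp: Y_def Yi_def)
    also have "\<dots> = (\<Sum>x<k. if i = x \<and> j = x then 1 else 0)"
      by (rule sum.reindex_bij_betw[OF bij, of "\<lambda>x. if i = x \<and> j = x then 1 else 0"])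
    also have "\<dots> = (\<Sum>x<k. if x = i then if j = i then 1 else 0 else 0)" by (intro sum.cong) auto
    finally show "(Y * Yi) $$ (i, j) = 1\<^sub>m k $$ (i, j)" using ij by simp
  qed (use c in auto)
  have 2: "Y * mat_diag k \<delta> = mat_diag k \<delta>' * Y"
    unfolding mat_diag_mult_left[OF c(1)] mat_diag_mult_right[OF c(1)] using \<delta>' by (intro eq_matI) (auto simp: Y_def)
  have 3: "Y $$ (\<pi> a, \<pi> b) = Y $$ (a, b) ^ q" if "a < k" "b < k" for a b
    using that pik pinj q_gt_1 unfolding Y_def by simp
  show thesis by (rule conjugate_family[OF n Ai fam mat_diag_dim c 1 2 3]) (assumption | rule that)+
qed

end

section \<open>Single vectors of a family and independence of functionals\<close>

definition unit_col :: "nat \<Rightarrow> nat \<Rightarrow> 'k::field mat" where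
  "unit_col k a = mat k 1 (\<lambda>(i, _). if i = a then 1 else 0)"

definition unit_row :: "nat \<Rightarrow> nat \<Rightarrow> 'k::field mat" where
  "unit_row k a = mat 1 k (\<lambda>(_, i). if i = a then 1 else 0)"

lemma unit_dims [simp]: "dim_row (unit_col k a) = k" "dim_col (unit_col k a) = 1"
  "dim_row (unit_row k a) = 1" "dim_col (unit_row k a) = k"
  "unit_col k a \<in> carrier_mat k 1" "unit_row k a \<in> carrier_mat 1 k"
  unfolding unit_col_def unit_row_def by simp_all

lemma mat_diag_unit_col: "a < k \<Longrightarrow> mat_diag k \<delta> * unit_col k a = \<delta> a \<cdot>\<^sub>m unit_col k a"
  unfolding mat_diag_mult_left[OF unit_dims(5)] by (intro eq_matI) (auto simp: unit_col_def)

lemma unit_row_mat_diag: "a < k \<Longrightarrow> unit_row k a * mat_diag k \<delta> = \<delta> a \<cdot>\<^sub>m unit_row k a"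
  unfolding mat_diag_mult_right[OF unit_dims(6)] by (intro eq_matI) (auto simp: unit_row_def)

lemma unit_row_col: "a < k \<Longrightarrow> b < k \<Longrightarrow> unit_row k a * unit_col k b = (if a = b then 1\<^sub>m 1 else 0\<^sub>m 1 1 :: 'k::field mat)"
proof (rule eq_matI)
  assume ab: "a < k" "b < k"
  fix i j assume "i < dim_row (if a = b then 1\<^sub>m 1 else 0\<^sub>m 1 1 :: 'k mat)" "j < dim_col (if a = b then 1\<^sub>m 1 else 0\<^sub>m 1 1 :: 'k mat)"
  then have ij: "i < 1" "j < 1" by (auto split: if_splits)
  have "(unit_row k a * unit_col k b :: 'k mat) $$ (i, j) = (\<Sum>x<k. unit_row k a $$ (i, x) * (unit_col k b :: 'k mat) $$ (x, j))"
    by (rule mult_col_index[OF unit_dims(6,5) ij])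
  also have "\<dots> = (\<Sum>x<k. if x = a then if a = b then 1 else 0 else 0 :: 'k)"
    using ij by (intro sum.cong) (auto simp: unit_row_def unit_col_def)
  also have "\<dots> = (if a = b then 1 else 0)" using ab by simp
  finally have e: "(unit_row k a * unit_col k b :: 'k mat) $$ (i, j) = (if a = b then 1 else 0 :: 'k)" .
  show "(unit_row k a * unit_col k b :: 'k mat) $$ (i, j) = (if a = b then 1\<^sub>m 1 else 0\<^sub>m 1 1) $$ (i, j)"
    unfolding e using ij by simp
qed (auto split: if_splits)

text \<open>Take a column y in which \<open>\<eta>\<close> is nonzero. If all minors with this
  column vanished, \<open>\<xi>\<close> would be a multiple of \<open>\<eta>\<close>, contradicting
  their values 1 and 0 at v.\<close>

lemma dual_independent:
  fixes \<xi> \<eta> v :: "'k::field mat"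
  assumes c: "\<xi> \<in> carrier_mat 1 n" "\<eta> \<in> carrier_mat 1 n" "v \<in> carrier_mat n 1"
    and p: "\<xi> * v = 1\<^sub>m 1" "\<eta> * v = 0\<^sub>m 1 1" "\<eta> \<noteq> 0\<^sub>m 1 n"
  obtains x y where "x < n" "y < n" "\<xi> $$ (0, x) * \<eta> $$ (0, y) \<noteq> \<xi> $$ (0, y) * \<eta> $$ (0, x)"
proof -
  have "\<exists>y<n. \<eta> $$ (0, y) \<noteq> 0"
  proof (rule ccontr)
    assume "\<not> (\<exists>y<n. \<eta> $$ (0, y) \<noteq> 0)"
    then have "\<eta> = 0\<^sub>m 1 n" using c(2) by (intro eq_matI) auto
    then show False using p(3) by simp
  qed
  then obtain y where y: "y < n" "\<eta> $$ (0, y) \<noteq> 0" by blast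
  have "\<exists>x<n. \<xi> $$ (0, x) * \<eta> $$ (0, y) \<noteq> \<xi> $$ (0, y) * \<eta> $$ (0, x)"
  proof (rule ccontr)
    assume "\<not> ?thesis"
    then have eq: "\<xi> $$ (0, x) * \<eta> $$ (0, y) = \<xi> $$ (0, y) * \<eta> $$ (0, x)" if "x < n" for x using that by blast
    have z: "(0::nat) < 1" by simp
    have "\<eta> $$ (0, y) = (\<xi> * v) $$ (0, 0) * \<eta> $$ (0, y)" unfolding p(1) by simp
    also have "\<dots> = (\<Sum>x<n. \<xi> $$ (0, y) * (\<eta> $$ (0, x) * v $$ (x, 0)))"
      unfolding mult_col_index[OF c(1,3) z z] sum_distrib_right
    proof (intro sum.cong refl)
      fix x assume "x \<in> {..<n}"
      then have "\<xi> $$ (0, x) * \<eta> $$ (0, y) * v $$ (x, 0) = \<xi> $$ (0, y) * \<eta> $$ (0, x) * v $$ (x, 0)" using eq by simp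
      then show "\<xi> $$ (0, x) * v $$ (x, 0) * \<eta> $$ (0, y) = \<xi> $$ (0, y) * (\<eta> $$ (0, x) * v $$ (x, 0))"
        by (simp add: ac_simps)
    qed
    also have "\<dots> = \<xi> $$ (0, y) * (\<eta> * v) $$ (0, 0)"
      unfolding mult_col_index[OF c(2,3) z z] sum_distrib_left ..
    finally show False using y(2) unfolding p(2) by simp
  qed
  then show thesis using that y(1) by blast
qed

section \<open>Suitable conjugates of A according to its eigenvalues\<close>

locale semisimple_case = orthogonal_setting q field_type n m + rational_semisimple q field_type A n
  for q :: nat and field_type :: "'k::alg_closed_field itself" and n m :: nat and A :: "'k mat" +
  fixes Ai :: "'k mat"
  assumes Ai: "Ai \<in> carrier_mat n n" "A * Ai = 1\<^sub>m n"
    and j_derived: "j_emb n m A \<in> carrier (SO_derived q m)"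
begin

abbreviation class_collapses :: bool where
  "class_collapses \<equiv> collapses (PSO_derived q m) (conj_class (PSO_derived q m) (proj q m (j_emb n m A)))"

lemma n_pos: "n > 0" using n_ge_3 by simp

lemma Ai_A: "Ai * A = 1\<^sub>m n" by (rule mat_mult_left_right_inverse[OF A_carrier Ai])

lemma Ai_dims [simp]: "dim_row Ai = n" "dim_col Ai = n" using Ai by auto

lemma eigen_nonzero:
  assumes "eigenpair A \<gamma> y"
  shows "\<gamma> \<noteq> 0"
proof
  assume z: "\<gamma> = 0"
  have y: "y \<in> carrier_mat n 1" "y \<noteq> 0\<^sub>m n 1" "A * y = \<gamma> \<cdot>\<^sub>m y" using assms unfolding eigenpair_def by auto
  have [simp]: "dim_row y = n" "dim_col y = 1" using y by auto
  have "A * y = 0\<^sub>m n 1" unfolding y(3) z by (intro eq_matI) auto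
  moreover have "y = (Ai * A) * y" unfolding Ai_A by (simp add: mat_ring)
  then have "y = Ai * (A * y)" by (simp add: mat_ring)
  ultimately have "y = Ai * 0\<^sub>m n 1" by simp
  then show False using y(2) right_mult_zero_mat[OF Ai(1)] by simp
qed

lemma row_eigen_nonzero:
  fixes M Mi y :: "'k mat"
  assumes M: "M \<in> carrier_mat n n" "Mi \<in> carrier_mat n n" "M * Mi = 1\<^sub>m n"
    and y: "y \<in> carrier_mat 1 n" "y * M = \<gamma> \<cdot>\<^sub>m y" "y \<noteq> 0\<^sub>m 1 n"
  shows "\<gamma> \<noteq> 0"
proof
  assume z: "\<gamma> = 0"
  have [simp]: "dim_row y = 1" "dim_col y = n" "dim_row M = n" "dim_col M = n" "dim_row Mi = n" "dim_col Mi = n" using y M by auto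
  have "y * M = 0\<^sub>m 1 n" unfolding y(2) z by (intro eq_matI) auto
  moreover have "y = y * (M * Mi)" unfolding M(3) by (simp add: mat_ring)
  then have "y = (y * M) * Mi" by (simp add: mat_ring)
  ultimately have "y = 0\<^sub>m 1 n * Mi" by simp
  then show False using y(3) left_mult_zero_mat[OF M(2)] by simp
qed

text \<open>The invariant subspace by which \<open>A\<close> and its conjugate \<open>B\<close> are told apart modulo the center.\<close>

definition separated :: "'k mat \<Rightarrow> bool" where
  "separated B \<longleftrightarrow> (\<exists>l V L C C'. V \<in> carrier_mat n l \<and> L \<in> carrier_mat l n \<and> L * V = 1\<^sub>m l \<and>
     C \<in> carrier_mat l l \<and> C' \<in> carrier_mat l l \<and> A * V = V * C \<and> B * V = V * C' \<and>
     (C * C' = C' * C \<or> C * C' = - (C' * C)) \<and> C' \<noteq> C \<and> C' \<noteq> - C)"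

lemma separated_single:
  assumes B: "B \<in> carrier_mat n n" and x: "x \<in> carrier_mat n 1" and xi: "\<xi> \<in> carrier_mat 1 n" "\<xi> * x = 1\<^sub>m 1"
    and ev: "A * x = a \<cdot>\<^sub>m x" "B * x = b \<cdot>\<^sub>m x" and ne: "b \<noteq> a" "b \<noteq> - a"
  shows "separated B"
proof -
  have [simp]: "dim_row x = n" "dim_col x = 1" using x by auto
  have e: "x * (c \<cdot>\<^sub>m 1\<^sub>m 1) = c \<cdot>\<^sub>m x" for c by (simp add: smult_mat_mult_right mat_ring)
  have "(b \<cdot>\<^sub>m 1\<^sub>m 1 :: 'k mat) $$ (0, 0) \<noteq> (a \<cdot>\<^sub>m 1\<^sub>m 1) $$ (0, 0)" "(b \<cdot>\<^sub>m 1\<^sub>m 1 :: 'k mat) $$ (0, 0) \<noteq> (- (a \<cdot>\<^sub>m 1\<^sub>m 1)) $$ (0, 0)"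
    using ne by simp_all
  then have "b \<cdot>\<^sub>m 1\<^sub>m 1 \<noteq> (a \<cdot>\<^sub>m 1\<^sub>m 1 :: 'k mat)" "b \<cdot>\<^sub>m 1\<^sub>m 1 \<noteq> - (a \<cdot>\<^sub>m 1\<^sub>m 1 :: 'k mat)" by metis+
  moreover have "(a \<cdot>\<^sub>m 1\<^sub>m 1) * (b \<cdot>\<^sub>m 1\<^sub>m 1) = (b \<cdot>\<^sub>m 1\<^sub>m 1) * (a \<cdot>\<^sub>m (1\<^sub>m 1 :: 'k mat))"
    by (simp add: smult_mat_mult_left smult_mat_mult_right smult_smult_mat mult.commute)
  ultimately show ?thesis unfolding separated_def using x xi ev e
    by (intro exI[of _ 1] exI[of _ x] exI[of _ \<xi>] exI[of _ "a \<cdot>\<^sub>m 1\<^sub>m 1"] exI[of _ "b \<cdot>\<^sub>m 1\<^sub>m 1"]) simp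
qed

text \<open>This covers b = -a. An eigenvector y on which A and B agree excludes B = -A on the span
  of x and y: its nonzero eigenvalue would be its own negative, which forces characteristic 2, and
  there -a = a.\<close>

lemma separated_pair:
  assumes B: "B \<in> carrier_mat n n" and x: "x \<in> carrier_mat n 1" and xi: "\<xi> \<in> carrier_mat 1 n"
    and y: "eigenpair A \<gamma> y" and eta: "\<eta> \<in> carrier_mat 1 n"
    and dual: "\<xi> * x = 1\<^sub>m 1" "\<xi> * y = 0\<^sub>m 1 1" "\<eta> * x = 0\<^sub>m 1 1" "\<eta> * y = 1\<^sub>m 1"
    and ev: "A * x = a \<cdot>\<^sub>m x" "B * x = b \<cdot>\<^sub>m x" "B * y = A * y" and ne: "b \<noteq> a"
  shows "separated B"
proof -
  have yc: "y \<in> carrier_mat n 1" "A * y = \<gamma> \<cdot>\<^sub>m y" using y unfolding eigenpair_def by auto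
  define V where "V = mat n 2 (\<lambda>(i, j). if j = 0 then x $$ (i, 0) else y $$ (i, 0))"
  define L where "L = mat 2 n (\<lambda>(j, i). if j = 0 then \<xi> $$ (0, i) else \<eta> $$ (0, i))"
  have V: "V \<in> carrier_mat n 2" and L: "L \<in> carrier_mat 2 n" unfolding V_def L_def by simp_all
  have z: "(0::nat) < 1" by simp
  have MV: "(M * V) $$ (i, j) = (M * (if j = 0 then x else y)) $$ (i, 0)" if "M \<in> carrier_mat n n" "i < n" "j < 2" for M i j
  proof -
    have c: "(if j = 0 then x else y) \<in> carrier_mat n 1" using x yc by simp
    show ?thesis unfolding mult_col_index[OF that(1) V that(2,3)] mult_col_index[OF that(1) c that(2) z]
      using that by (intro sum.cong refl) (simp add: V_def)
  qed
  have LV: "(L * V) $$ (i, j) = ((if i = 0 then \<xi> else \<eta>) * (if j = 0 then x else y)) $$ (0, 0)" if "i < 2" "j < 2" for i j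
  proof -
    have c: "(if i = 0 then \<xi> else \<eta>) \<in> carrier_mat 1 n" "(if j = 0 then x else y) \<in> carrier_mat n 1" using x yc xi eta by auto
    show ?thesis unfolding mult_col_index[OF L V that] mult_col_index[OF c z z]
      using that by (intro sum.cong refl) (simp add: V_def L_def)
  qed
  have "L * V = 1\<^sub>m 2"
  proof (rule eq_matI)
    fix i j assume "i < dim_row (1\<^sub>m 2 :: 'k mat)" "j < dim_col (1\<^sub>m 2 :: 'k mat)"
    then have ij: "i < 2" "j < 2" by auto
    then consider "i = 0" "j = 0" | "i = 0" "j = 1" | "i = 1" "j = 0" | "i = 1" "j = 1" by linarith
    then show "(L * V) $$ (i, j) = 1\<^sub>m 2 $$ (i, j)" unfolding LV[OF ij] by cases (simp_all add: dual del: index_mult_mat(1))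
  qed (use L V in auto)
  moreover have diag: "M * V = V * mat_diag 2 (\<lambda>j. if j = 0 then c else \<gamma>)"
    if M: "M \<in> carrier_mat n n" "M * x = c \<cdot>\<^sub>m x" "M * y = \<gamma> \<cdot>\<^sub>m y" for M c
    unfolding mat_diag_mult_right[OF V]
  proof (rule eq_matI, goal_cases)
    case (1 i j)
    then have ij: "i < n" "j < 2" by auto
    show ?case using x yc ij unfolding MV[OF M(1) ij] by (auto simp: M(2,3) V_def simp del: index_mult_mat(1))
  qed (use M V in auto)
  note diag[OF A_carrier ev(1) yc(2)] diag[OF B ev(2) ev(3)[unfolded yc(2)]]
  moreover have "\<gamma> \<noteq> 0" by (rule eigen_nonzero[OF y])
  have "mat_diag 2 (\<lambda>j. if j = 0 then b else \<gamma>) $$ (0, 0) \<noteq> mat_diag 2 (\<lambda>j. if j = 0 then a else \<gamma>) $$ (0, 0)"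
    using ne by simp
  then have "mat_diag 2 (\<lambda>j. if j = 0 then b else \<gamma>) \<noteq> mat_diag 2 (\<lambda>j. if j = 0 then a else \<gamma>)" by metis
  moreover have "mat_diag 2 (\<lambda>j. if j = 0 then b else \<gamma>) \<noteq> - mat_diag 2 (\<lambda>j. if j = 0 then a else \<gamma>)"
  proof
    assume e: "mat_diag 2 (\<lambda>j. if j = 0 then b else \<gamma>) = - mat_diag 2 (\<lambda>j. if j = 0 then a else \<gamma>)"
    have "b = - a" using arg_cong[OF e, of "\<lambda>M. M $$ (0, 0)"] by simp
    moreover have "\<gamma> = - \<gamma>" using arg_cong[OF e, of "\<lambda>M. M $$ (1, 1)"] by simp
    then have "\<gamma> + \<gamma> = 0" by (metis add.right_inverse)
    then have "\<gamma> * (1 + 1) = 0" by (simp only: distrib_left mult_1_right)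
    then have "(1 + 1 :: 'k) = 0" using \<open>\<gamma> \<noteq> 0\<close> mult_eq_0_iff by blast
    then have "a * (1 + 1) = 0" by (metis mult_zero_right)
    then have "- a = a" by (simp only: distrib_left mult_1_right) (simp add: neg_eq_iff_add_eq_0)
    ultimately show False using ne by simp
  qed
  moreover have "mat_diag 2 (\<lambda>j. if j = 0 then a else \<gamma>) * mat_diag 2 (\<lambda>j. if j = 0 then b else \<gamma>)
      = mat_diag 2 (\<lambda>j. if j = 0 then b else \<gamma>) * mat_diag 2 (\<lambda>j. if j = 0 then a else \<gamma>)"
    by (simp add: mult.commute)
  ultimately show ?thesis unfolding separated_def using V L mat_diag_dim by blast
qed

lemma complement_dual:
  assumes fam: "eigenfamily A n k \<pi> \<delta> V W" and y: "eigenpair A \<gamma> y" "W * y = 0\<^sub>m k 1"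
  obtains \<eta> where "\<eta> \<in> carrier_mat 1 n" "\<eta> * y = 1\<^sub>m 1" "\<eta> * V = 0\<^sub>m 1 k"
proof -
  have V: "V \<in> carrier_mat n k" and W: "W \<in> carrier_mat k n" and WV: "W * V = 1\<^sub>m k" using fam unfolding eigenfamily_def by auto
  obtain \<eta>0 where e: "\<eta>0 \<in> carrier_mat 1 n" "\<eta>0 * A = \<gamma> \<cdot>\<^sub>m \<eta>0" "\<eta>0 * y = 1\<^sub>m 1" by (rule left_eigenvector[OF y(1)])
  have yc: "y \<in> carrier_mat n 1" using y(1) unfolding eigenpair_def by simp
  have [simp]: "dim_row V = n" "dim_col V = k" "dim_row W = k" "dim_col W = n" "dim_row \<eta>0 = 1" "dim_col \<eta>0 = n"
    "dim_row y = n" "dim_col y = 1" using V W e yc by auto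
  have 1: "(\<eta>0 - \<eta>0 * V * W) * V = 0\<^sub>m 1 k" by (simp add: mat_ring WV) (intro eq_matI; simp)
  have "(\<eta>0 - \<eta>0 * V * W) * y = 1\<^sub>m 1 - \<eta>0 * V * 0\<^sub>m k 1" by (simp add: mat_ring e(3) y(2))
  also have "\<dots> = 1\<^sub>m 1" by (intro eq_matI) simp_all
  finally have 2: "(\<eta>0 - \<eta>0 * V * W) * y = 1\<^sub>m 1" .
  have "\<eta>0 - \<eta>0 * V * W \<in> carrier_mat 1 n" by (intro carrier_matI) auto
  then show thesis using that 1 2 by blast
qed

text \<open>The vector v, where \<open>\<xi>\<close> is 1 and \<open>\<eta>\<close> is 0, supplies
  the nonzero minor of the two left eigenvectors; invertibility of A and B makes their eigenvalues
  nonzero.\<close>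

lemma siegel_case:
  assumes g: "g \<in> carrier_mat n n" "gi \<in> carrier_mat n n" "g * gi = 1\<^sub>m n" "rational g" "det g = 1"
    and B: "B \<in> carrier_mat n n" "Bi \<in> carrier_mat n n" "B * Bi = 1\<^sub>m n" "B * g = g * A" and sep: "separated B"
    and xi: "\<xi> \<in> carrier_mat 1 n" "\<xi> * A = a \<cdot>\<^sub>m \<xi>" "\<xi> * B = a1 \<cdot>\<^sub>m \<xi>"
    and eta: "\<eta> \<in> carrier_mat 1 n" "\<eta> * A = b \<cdot>\<^sub>m \<eta>" "\<eta> * B = b1 \<cdot>\<^sub>m \<eta>"
    and v: "v \<in> carrier_mat n 1" "\<xi> * v = 1\<^sub>m 1" "\<eta> * v = 0\<^sub>m 1 1" "\<eta> \<noteq> 0\<^sub>m 1 n"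
    and ne: "a * b \<noteq> 1" "a1 * b1 \<noteq> 1"
  shows class_collapses
proof -
  have "\<xi> \<noteq> 0\<^sub>m 1 n"
  proof
    assume z: "\<xi> = 0\<^sub>m 1 n"
    have "(0\<^sub>m 1 1 :: 'k mat) $$ (0, 0) = 1\<^sub>m 1 $$ (0, 0)" using v(2) left_mult_zero_mat[OF v(1), of 1] unfolding z by metis
    then show False by simp
  qed
  then have nz: "a \<noteq> 0" "a1 \<noteq> 0" "b \<noteq> 0" "b1 \<noteq> 0"
    using row_eigen_nonzero[OF A_carrier Ai xi(1,2)] row_eigen_nonzero[OF B(1-3) xi(1,3)]
      row_eigen_nonzero[OF A_carrier Ai eta(1,2) v(4)] row_eigen_nonzero[OF B(1-3) eta(1,3) v(4)] by auto
  obtain x y where xy: "x < n" "y < n" "\<xi> $$ (0, x) * \<eta> $$ (0, y) \<noteq> \<xi> $$ (0, y) * \<eta> $$ (0, x)"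
    by (rule dual_independent[OF xi(1) eta(1) v])
  obtain l V L C C' where s: "V \<in> carrier_mat n l" "L \<in> carrier_mat l n" "L * V = 1\<^sub>m l"
     "C \<in> carrier_mat l l" "C' \<in> carrier_mat l l" "A * V = V * C" "B * V = V * C'"
     "C * C' = C' * C \<or> C * C' = - (C' * C)" "C' \<noteq> C" "C' \<noteq> - C" using sep unfolding separated_def by blast
  show ?thesis
    by (rule collapse_siegel[OF A_carrier Ai(1) B(1,2) g(1,2) Ai(2) B(3) g(3,4,5) B(4) j_derived s xi eta nz(1,3,2,4) ne xy])
qed

lemma family_col:
  assumes "V \<in> carrier_mat n k" "M \<in> carrier_mat n n" "M * V = V * mat_diag k \<delta>" "a < k"
  shows "M * (V * unit_col k a) = \<delta> a \<cdot>\<^sub>m (V * unit_col k a :: 'k mat)"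
proof -
  have [simp]: "dim_row V = n" "dim_col V = k" "dim_row M = n" "dim_col M = n" using assms by auto
  have "M * (V * unit_col k a) = (M * V) * unit_col k a" by (simp add: mat_ring)
  also have "\<dots> = V * (mat_diag k \<delta> * unit_col k a)" unfolding assms(3) by (simp add: mat_ring)
  finally show ?thesis unfolding mat_diag_unit_col[OF assms(4)] by (simp add: smult_mat_mult_right)
qed

lemma family_row:
  assumes "W \<in> carrier_mat k n" "M \<in> carrier_mat n n" "W * M = mat_diag k \<delta> * W" "a < k"
  shows "(unit_row k a * W) * M = \<delta> a \<cdot>\<^sub>m (unit_row k a * W :: 'k mat)"
proof -
  have [simp]: "dim_row W = k" "dim_col W = n" "dim_row M = n" "dim_col M = n" using assms by auto
  have "(unit_row k a * W) * M = unit_row k a * (W * M)" by (simp add: mat_ring)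
  also have "\<dots> = (unit_row k a * mat_diag k \<delta>) * W" unfolding assms(3) by (simp add: mat_ring)
  finally show ?thesis unfolding unit_row_mat_diag[OF assms(4)] by (simp add: smult_mat_mult_left)
qed

lemma family_dual:
  assumes "V \<in> carrier_mat n k" "W \<in> carrier_mat k n" "W * V = 1\<^sub>m k" "a < k" "b < k"
  shows "(unit_row k a * W) * (V * unit_col k b) = (if a = b then 1\<^sub>m 1 else 0\<^sub>m 1 1 :: 'k mat)"
proof -
  have [simp]: "dim_row V = n" "dim_col V = k" "dim_row W = k" "dim_col W = n" using assms by auto
  have "(unit_row k a * W) * (V * unit_col k b) = unit_row k a * ((W * V) * unit_col k b)" by (simp add: mat_ring)
  also have "\<dots> = unit_row k a * unit_col k b" unfolding assms(3) by (simp add: mat_ring)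
  finally show ?thesis unfolding unit_row_col[OF assms(4,5)] .
qed

lemma unit_products:
  assumes "V \<in> carrier_mat n k" "W \<in> carrier_mat k n"
  shows "V * unit_col k a \<in> carrier_mat n 1" "unit_row k a * W \<in> carrier_mat 1 n"
  using assms by (auto intro!: carrier_matI)

lemma row_nonzero:
  assumes "\<eta> * v = (1\<^sub>m 1 :: 'k mat)" "v \<in> carrier_mat n 1"
  shows "\<eta> \<noteq> 0\<^sub>m 1 n"
proof
  assume z: "\<eta> = 0\<^sub>m 1 n"
  have "(0\<^sub>m 1 1 :: 'k mat) $$ (0, 0) = 1\<^sub>m 1 $$ (0, 0)" using assms(1) left_mult_zero_mat[OF assms(2), of 1] unfolding z by metis
  then show False by simp
qed

lemma orbit_family:
  assumes "eigenpair A \<alpha> y"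
  obtains d V W where "d > 0" "\<alpha> ^ (q ^ d) = \<alpha>" "\<And>i. 0 < i \<Longrightarrow> i < d \<Longrightarrow> \<alpha> ^ (q ^ i) \<noteq> \<alpha>"
    "eigenfamily A n d (\<lambda>a. Suc a mod d) (\<lambda>a. \<alpha> ^ (q ^ a)) V W"
proof -
  have "y \<in> carrier_mat n 1" using assms unfolding eigenpair_def by simp
  then have y: "0\<^sub>m 0 n * y = 0\<^sub>m 0 1" by (intro eq_matI) auto
  obtain d V W where d: "d > 0" "\<alpha> ^ (q ^ d) = \<alpha>" "\<And>i. 0 < i \<Longrightarrow> i < d \<Longrightarrow> \<alpha> ^ (q ^ i) \<noteq> \<alpha>"
    and fam: "eigenfamily A n (0 + d) (\<lambda>a. if a < 0 then id a else 0 + Suc (a - 0) mod d)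
       (\<lambda>a. if a < 0 then 0 else \<alpha> ^ (q ^ (a - 0))) V W"
    by (rule extend_family[OF eigenfamily_empty[OF A_carrier] assms y]) (rule that)
  have "eigenfamily A n d (\<lambda>a. Suc a mod d) (\<lambda>a. \<alpha> ^ (q ^ a)) V W" using fam by simp
  with d show thesis by (rule that)
qed

text \<open>The rows 1 and 2 serve as \<open>\<xi>\<close> and \<open>\<eta>\<close>: A has the
  eigenvalues \<alpha>^q and \<alpha>^(q^2) on them, its shift \<alpha> and \<alpha>^q. If one of
  the products were 1, or if \<alpha> = -\<alpha>^q, then the second power of Frobenius would fix
  \<alpha>, against d \<ge> 3.\<close>

lemma collapse_long_orbit:
  assumes d: "d \<ge> 3" "\<alpha> ^ (q ^ d) = \<alpha>" "\<And>i. 0 < i \<Longrightarrow> i < d \<Longrightarrow> \<alpha> ^ (q ^ i) \<noteq> \<alpha>"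
    and fam: "eigenfamily A n d (\<lambda>a. Suc a mod d) (\<lambda>a. \<alpha> ^ (q ^ a)) V W"
  shows class_collapses
proof -
  have V: "V \<in> carrier_mat n d" and W: "W \<in> carrier_mat d n" and WV: "W * V = 1\<^sub>m d"
    and AV: "A * V = V * mat_diag d (\<lambda>a. \<alpha> ^ (q ^ a))" and WA: "W * A = mat_diag d (\<lambda>a. \<alpha> ^ (q ^ a)) * W"
    using fam unfolding eigenfamily_def by auto
  \<comment> \<open>Adding d - 1 modulo d is the predecessor in the cycle, so every index receives
    the eigenvalue of the one before it.\<close>
  define \<delta>' where "\<delta>' a = \<alpha> ^ (q ^ ((a + (d - 1)) mod d))" for a
  have "\<delta>' (Suc a mod d) = \<alpha> ^ (q ^ a)" if "a < d" for a
  proof -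
    have "(Suc a mod d + (d - 1)) mod d = (Suc a + (d - 1)) mod d" by (simp add: mod_simps)
    also have "Suc a + (d - 1) = a + d" using d(1) by simp
    finally show ?thesis using that unfolding \<delta>'_def by simp
  qed
  note \<delta>'_shift = this
  obtain g gi B Bi where c: "g \<in> carrier_mat n n" "gi \<in> carrier_mat n n" "g * gi = 1\<^sub>m n" "rational g" "det g = 1"
    "B \<in> carrier_mat n n" "Bi \<in> carrier_mat n n" "B * Bi = 1\<^sub>m n" "B * g = g * A"
    "B * V = V * mat_diag d \<delta>'" "W * B = mat_diag d \<delta>' * W"
    and "\<And>y. y \<in> carrier_mat n 1 \<Longrightarrow> W * y = 0\<^sub>m d 1 \<Longrightarrow> B * y = A * y"
    and "\<And>z. z \<in> carrier_mat 1 n \<Longrightarrow> z * V = 0\<^sub>m 1 d \<Longrightarrow> z * B = z * A"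
    by (rule conjugate_family_shift[OF n_pos Ai fam, of \<delta>']) (rule \<delta>'_shift that; assumption)+
  have i: "1 < d" "2 < d" "(1::nat) \<noteq> 2" "(2::nat) \<noteq> 1" using d(1) by auto
  have "(1 + (d - 1)) mod d = 0" "(2 + (d - 1)) mod d = 1"
  proof -
    have "1 + (d - 1) = d" "2 + (d - 1) = 1 + d" using d(1) by auto
    moreover have "(1 + d) mod d = 1" using mod_add_self2[of 1 d] i by simp
    ultimately show "(1 + (d - 1)) mod d = 0" "(2 + (d - 1)) mod d = 1" by (simp_all only: mod_self)
  qed
  then have d': "\<delta>' 1 = \<alpha>" "\<delta>' 2 = \<alpha> ^ q" unfolding \<delta>'_def by simp_all
  have q2: "\<alpha> ^ (q ^ 2) = (\<alpha> ^ q) ^ q" by (simp add: power2_eq_square power_mult)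
  have aq: "\<alpha> ^ q \<noteq> \<alpha>" "(\<alpha> ^ q) ^ q \<noteq> \<alpha>" using d(3)[of 1] d(3)[of 2] i unfolding q2 by auto
  have m: "\<alpha> * \<alpha> ^ q \<noteq> 1"
  proof
    assume e: "\<alpha> * \<alpha> ^ q = 1"
    then have "\<alpha> ^ q * (\<alpha> ^ q) ^ q = 1" by (metis power_mult_distrib power_one)
    then show False using e aq(2) by (metis mult.commute mult_cancel_left1 mult.assoc mult_1_right)
  qed
  have m': "\<alpha> ^ q * (\<alpha> ^ q) ^ q \<noteq> 1"
  proof
    assume "\<alpha> ^ q * (\<alpha> ^ q) ^ q = 1"
    then have "(\<alpha> * \<alpha> ^ q) ^ q ^ 1 = 1 ^ q ^ 1" by (simp add: power_mult_distrib)
    then show False using m unfolding power_q_inject by simp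
  qed
  note colA = family_col[OF V A_carrier AV] and colB = family_col[OF V c(6,10)]
  note rowA = family_row[OF W A_carrier WA] and rowB = family_row[OF W c(6,11)]
  note up = unit_products[OF V W] and dual = family_dual[OF V W WV]
  have ne: "\<alpha> \<noteq> - (\<alpha> ^ q)"
  proof
    assume "\<alpha> = - (\<alpha> ^ q)"
    then have "\<alpha> ^ q = - \<alpha>" by (metis minus_minus)
    then have "(\<alpha> ^ q) ^ q = - (\<alpha> ^ q)" by (simp add: frob.hom_uminus)
    then show False using aq(2) \<open>\<alpha> = - (\<alpha> ^ q)\<close> by simp
  qed
  have sep: "separated B"
    by (rule separated_single[OF c(6) up(1) up(2) _ colA[OF i(1)] colB[OF i(1)]])
      (use dual[OF i(1,1)] d' aq ne in auto)
  show ?thesis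
  proof (rule siegel_case[OF c(1-9) sep up(2) rowA[OF i(1)] rowB[OF i(1)] up(2) rowA[OF i(2)] rowB[OF i(2)] up(1)[of 1]])
    show "unit_row d 1 * W * (V * unit_col d 1) = 1\<^sub>m 1" using dual[OF i(1,1)] by simp
    show "unit_row d 2 * W * (V * unit_col d 1) = 0\<^sub>m 1 1" using dual[OF i(2,1)] by simp
    have "unit_row d 2 * W * (V * unit_col d 2) = 1\<^sub>m 1" using dual[OF i(2,2)] by simp
    then show "unit_row d 2 * W \<noteq> 0\<^sub>m 1 n" by (rule row_nonzero[OF _ up(1)])
    show "\<alpha> ^ q ^ 1 * \<alpha> ^ q ^ 2 \<noteq> 1" using m' unfolding q2 by simp
    show "\<delta>' 1 * \<delta>' 2 \<noteq> 1" unfolding d' by (rule m)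
  qed
qed

text \<open>The orbit spans two dimensions, so n \<ge> 3 leaves an eigenvector on which A and its
  shift agree; it removes the sign ambiguity. The two rows of the orbit serve as
  \<open>\<xi>\<close> and \<open>\<eta>\<close> unless their eigenvalues are inverse to each other.
  Then \<open>\<eta>\<close> belongs to an eigenvalue \<beta> outside the orbit, which is inverse to
  neither.\<close>

lemma collapse_short_orbit:
  assumes aq: "\<alpha> ^ q \<noteq> \<alpha>" "(\<alpha> ^ q) ^ q = \<alpha>"
    and fam: "eigenfamily A n 2 (\<lambda>a. Suc a mod 2) (\<lambda>a. \<alpha> ^ (q ^ a)) V W"
    and other: "\<alpha> * \<alpha> ^ q \<noteq> 1 \<or> (\<exists>\<beta> y. eigenpair A \<beta> y \<and> \<beta> \<noteq> \<alpha> \<and> \<beta> \<noteq> \<alpha> ^ q)"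
  shows class_collapses
proof -
  have V: "V \<in> carrier_mat n 2" and W: "W \<in> carrier_mat 2 n" and WV: "W * V = 1\<^sub>m 2"
    and AV: "A * V = V * mat_diag 2 (\<lambda>a. \<alpha> ^ (q ^ a))" and WA: "W * A = mat_diag 2 (\<lambda>a. \<alpha> ^ (q ^ a)) * W"
    using fam unfolding eigenfamily_def by auto
  \<comment> \<open>On the two indices 0 and 1 that matter, a \<mapsto> 1 - a is the swap.\<close>
  define \<delta>' where "\<delta>' a = \<alpha> ^ (q ^ (1 - a))" for a :: nat
  have "\<delta>' (Suc a mod 2) = \<alpha> ^ (q ^ a)" if "a < 2" for a
  proof -
    have "a = 0 \<or> a = 1" using that by auto
    then show ?thesis unfolding \<delta>'_def by auto
  qed
  note \<delta>'_shift = this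
  obtain g gi B Bi where c: "g \<in> carrier_mat n n" "gi \<in> carrier_mat n n" "g * gi = 1\<^sub>m n" "rational g" "det g = 1"
    "B \<in> carrier_mat n n" "Bi \<in> carrier_mat n n" "B * Bi = 1\<^sub>m n" "B * g = g * A"
    "B * V = V * mat_diag 2 \<delta>'" "W * B = mat_diag 2 \<delta>' * W"
    and cy: "\<And>y. y \<in> carrier_mat n 1 \<Longrightarrow> W * y = 0\<^sub>m 2 1 \<Longrightarrow> B * y = A * y"
    and cz: "\<And>z. z \<in> carrier_mat 1 n \<Longrightarrow> z * V = 0\<^sub>m 1 2 \<Longrightarrow> z * B = z * A"
    by (rule conjugate_family_shift[OF n_pos Ai fam, of \<delta>']) (rule \<delta>'_shift that; assumption)+
  have i: "(0::nat) < 2" "(1::nat) < 2" by auto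
  have d': "\<delta>' 0 = \<alpha> ^ q" "\<delta>' 1 = \<alpha>" unfolding \<delta>'_def by simp_all
  note colA = family_col[OF V A_carrier AV] and colB = family_col[OF V c(6,10)]
  note rowA = family_row[OF W A_carrier WA] and rowB = family_row[OF W c(6,11)]
  note up = unit_products[OF V W] and dual = family_dual[OF V W WV]
  have sep: "separated B"
  proof -
    have "V * W \<noteq> 1\<^sub>m n" by (rule no_wide_factorization[OF V W]) (use n_ge_3 in simp)
    then obtain \<gamma> y where y: "eigenpair A \<gamma> y" "W * y = 0\<^sub>m 2 1" by (rule complement_eigenvector[OF fam])
    obtain \<eta> where e: "\<eta> \<in> carrier_mat 1 n" "\<eta> * y = 1\<^sub>m 1" "\<eta> * V = 0\<^sub>m 1 2" by (rule complement_dual[OF fam y])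
    have yc: "y \<in> carrier_mat n 1" using y(1) unfolding eigenpair_def by simp
    have [simp]: "dim_row V = n" "dim_col V = 2" "dim_row W = 2" "dim_col W = n" "dim_row y = n" "dim_row \<eta> = 1" "dim_col \<eta> = n" using V W yc e by auto
    have 1: "unit_row 2 0 * W * y = 0\<^sub>m 1 1"
      using y(2) by (simp add: mult_mat_assoc right_mult_zero_mat[OF unit_dims(6)])
    have "\<eta> * (V * unit_col 2 0) = (\<eta> * V) * unit_col 2 0" by (simp add: mult_mat_assoc)
    then have 2: "\<eta> * (V * unit_col 2 0) = 0\<^sub>m 1 1" unfolding e(3) by (simp add: left_mult_zero_mat[OF unit_dims(5)])
    show ?thesis
      by (rule separated_pair[OF c(6) up(1)[of 0] up(2)[of 0] y(1) e(1) _ 1 2 e(2) colA[OF i(1)] colB[OF i(1)] cy[OF yc y(2)]])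
        (use dual[OF i(1,1)] d' aq in auto)
  qed
  show ?thesis
  proof (cases "\<alpha> * \<alpha> ^ q = 1")
    case False
    show ?thesis
    proof (rule siegel_case[OF c(1-9) sep up(2) rowA[OF i(1)] rowB[OF i(1)] up(2) rowA[OF i(2)] rowB[OF i(2)] up(1)[of 0]])
      show "unit_row 2 0 * W * (V * unit_col 2 0) = 1\<^sub>m 1" using dual[OF i(1,1)] by simp
      show "unit_row 2 1 * W * (V * unit_col 2 0) = 0\<^sub>m 1 1" using dual[OF i(2,1)] by simp
      have "unit_row 2 1 * W * (V * unit_col 2 1) = 1\<^sub>m 1" using dual[OF i(2,2)] by simp
      then show "unit_row 2 1 * W \<noteq> 0\<^sub>m 1 n" by (rule row_nonzero[OF _ up(1)])
      show "\<alpha> ^ q ^ 0 * \<alpha> ^ q ^ 1 \<noteq> 1" "\<delta>' 0 * \<delta>' 1 \<noteq> 1" using False unfolding d' by (simp_all add: mult.commute)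
    qed
  next
    case True
    then obtain \<beta> y where y: "eigenpair A \<beta> y" "\<beta> \<noteq> \<alpha>" "\<beta> \<noteq> \<alpha> ^ q" using other by blast
    obtain \<eta> where e: "\<eta> \<in> carrier_mat 1 n" "\<eta> * A = \<beta> \<cdot>\<^sub>m \<eta>" "\<eta> * y = 1\<^sub>m 1" by (rule left_eigenvector[OF y(1)])
    have yc: "y \<in> carrier_mat n 1" using y(1) unfolding eigenpair_def by simp
    have [simp]: "dim_row V = n" "dim_col V = 2" "dim_row \<eta> = 1" "dim_col \<eta> = n" using V e by auto
    have eV: "\<eta> * V = 0\<^sub>m 1 2"
    proof (rule left_eigen_annihilated[OF fam e(1,2)])
      fix a :: nat assume "a < 2"
      then have "a = 0 \<or> a = 1" by auto
      then show "\<alpha> ^ q ^ a \<noteq> \<beta>" using y by auto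
    qed
    have eB: "\<eta> * B = \<beta> \<cdot>\<^sub>m \<eta>" using cz[OF e(1) eV] e(2) by simp
    have "\<eta> * (V * unit_col 2 0) = (\<eta> * V) * unit_col 2 0" by (simp add: mult_mat_assoc)
    then have e0: "\<eta> * (V * unit_col 2 0) = 0\<^sub>m 1 1" unfolding eV by (simp add: left_mult_zero_mat[OF unit_dims(5)])
    show ?thesis
    proof (rule siegel_case[OF c(1-9) sep up(2) rowA[OF i(1)] rowB[OF i(1)] e(1,2) eB up(1)[of 0] _ e0])
      show "unit_row 2 0 * W * (V * unit_col 2 0) = 1\<^sub>m 1" using dual[OF i(1,1)] by simp
      show "\<eta> \<noteq> 0\<^sub>m 1 n" by (rule row_nonzero[OF e(3) yc])
      have a0: "\<alpha> \<noteq> 0" using True by auto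
      show "\<alpha> ^ q ^ 0 * \<beta> \<noteq> 1"
      proof
        assume "\<alpha> ^ q ^ 0 * \<beta> = 1"
        then have "\<alpha> * \<beta> = \<alpha> * \<alpha> ^ q" using True by simp
        then show False using a0 y(3) mult_left_cancel by blast
      qed
      show "\<delta>' 0 * \<beta> \<noteq> 1"
      proof
        assume "\<delta>' 0 * \<beta> = 1"
        then have "\<alpha> ^ q * \<beta> = \<alpha> ^ q * \<alpha>" using True unfolding d' by (simp add: mult.commute)
        moreover have "\<alpha> ^ q \<noteq> 0" using a0 by simp
        ultimately show False using y(2) mult_left_cancel by blast
      qed
    qed
  qed
qed

lemma levi_case:
  assumes g: "g \<in> carrier_mat n n" "gi \<in> carrier_mat n n" "g * gi = 1\<^sub>m n" "rational g" "det g = 1"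
    and B: "B \<in> carrier_mat n n" "Bi \<in> carrier_mat n n" "B * Bi = 1\<^sub>m n" "B * g = g * A" and sep: "separated B"
    and nc: "A * (B * A * Bi) \<noteq> B * A * Bi * A" "B * (A * B * Ai) \<noteq> A * B * Ai * B"
  shows class_collapses
proof -
  obtain l V L C C' where s: "V \<in> carrier_mat n l" "L \<in> carrier_mat l n" "L * V = 1\<^sub>m l"
     "C \<in> carrier_mat l l" "C' \<in> carrier_mat l l" "A * V = V * C" "B * V = V * C'"
     "C * C' = C' * C \<or> C * C' = - (C' * C)" "C' \<noteq> C" "C' \<noteq> - C" using sep unfolding separated_def by blast
  show ?thesis
    by (rule collapse_levi[OF A_carrier Ai(1) B(1,2) g(1,2) Ai(2) B(3) g(3,4,5) B(4) j_derived s nc])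
qed

lemma upper2_line:
  fixes x c M :: "'k mat"
  assumes "x \<in> carrier_mat n 1" "c \<in> carrier_mat n 1" "M * x = p \<cdot>\<^sub>m x" "M * c = r \<cdot>\<^sub>m c + t \<cdot>\<^sub>m x"
  shows "upper2 x (1\<^sub>m 1) c M p r t"
proof -
  have [simp]: "dim_row x = n" "dim_col x = 1" using assms by auto
  have e: "x * (a \<cdot>\<^sub>m 1\<^sub>m 1) = a \<cdot>\<^sub>m x" "1\<^sub>m 1 * (a \<cdot>\<^sub>m 1\<^sub>m 1) = a \<cdot>\<^sub>m (1\<^sub>m 1 :: 'k mat)" for a
    by (simp_all add: smult_mat_mult_right mat_ring)
  show ?thesis unfolding upper2_def
    by (rule exI[of _ "p \<cdot>\<^sub>m 1\<^sub>m 1"], rule exI[of _ "t \<cdot>\<^sub>m 1\<^sub>m 1"])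
      (simp add: e assms(3,4) del: One_nat_def)
qed

lemma upper2_line_inverse:
  fixes x c M Mi :: "'k mat"
  assumes x: "x \<in> carrier_mat n 1" and c: "c \<in> carrier_mat n 1" and M: "M \<in> carrier_mat n n" "Mi \<in> carrier_mat n n" "M * Mi = 1\<^sub>m n"
    and e: "M * x = p \<cdot>\<^sub>m x" "M * c = r \<cdot>\<^sub>m c + t \<cdot>\<^sub>m x" and nz: "p \<noteq> 0" "r \<noteq> 0"
  shows "upper2 x (1\<^sub>m 1) c Mi (1 / p) (1 / r) (- t / (p * r))"
proof (rule upper2_line[OF x c])
  have [simp]: "dim_row x = n" "dim_col x = 1" "dim_row c = n" "dim_col c = 1" "dim_row M = n" "dim_col M = n" "dim_row Mi = n" "dim_col Mi = n"
    using x c M by auto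
  have MiM: "Mi * M = 1\<^sub>m n" by (rule mat_mult_left_right_inverse[OF M])
  have "Mi * (M * x) = (Mi * M) * x" by (simp add: mult_mat_assoc)
  then have px: "p \<cdot>\<^sub>m (Mi * x) = x" unfolding e(1) MiM by (simp add: smult_mat_mult_right mult_mat_unit_left)
  have "(1 / p) \<cdot>\<^sub>m (p \<cdot>\<^sub>m (Mi * x)) = (1 / p) \<cdot>\<^sub>m x" unfolding px ..
  then show mx: "Mi * x = (1 / p) \<cdot>\<^sub>m x" using nz by (simp add: smult_smult_mat)
  have "Mi * (M * c) = (Mi * M) * c" by (simp add: mult_mat_assoc)
  then have rc: "r \<cdot>\<^sub>m (Mi * c) + t \<cdot>\<^sub>m ((1 / p) \<cdot>\<^sub>m x) = c"
    unfolding e(2) MiM by (simp add: smult_mat_mult_right mult_mat_unit_left mult_mat_add_right mx)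
  have d: "dim_row (Mi * c) = n" "dim_col (Mi * c) = 1" by simp_all
  show "Mi * c = (1 / r) \<cdot>\<^sub>m c + (- t / (p * r)) \<cdot>\<^sub>m x"
  proof (rule eq_matI)
    fix i j assume "i < dim_row ((1 / r) \<cdot>\<^sub>m c + (- t / (p * r)) \<cdot>\<^sub>m x)" "j < dim_col ((1 / r) \<cdot>\<^sub>m c + (- t / (p * r)) \<cdot>\<^sub>m x)"
    then have ij: "i < n" "j < 1" by auto
    have "r * (Mi * c) $$ (i, j) + t * (1 / p * x $$ (i, j)) = c $$ (i, j)"
      using arg_cong[OF rc, of "\<lambda>N. N $$ (i, j)"] ij d by (simp del: index_mult_mat(1))
    then have "(Mi * c) $$ (i, j) = 1 / r * c $$ (i, j) + (- t / (p * r)) * x $$ (i, j)"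
      using nz by (simp add: field_simps del: index_mult_mat(1))
    then show "(Mi * c) $$ (i, j) = ((1 / r) \<cdot>\<^sub>m c + (- t / (p * r)) \<cdot>\<^sub>m x) $$ (i, j)"
      using ij by (simp del: index_mult_mat(1))
  qed simp_all
qed

text \<open>Orbits of rational eigenvalues have length one, so Frobenius fixes both indices. In the
  basis x, y the matrix A is diag(a, b), and its conjugate B is upper triangular with diagonal b, a
  and corner a - b; the line of x is stable under both. An eigenvector outside the plane of x and y,
  which exists since n \<ge> 3, takes care of b = -a.\<close>

lemma collapse_rational_eigenvalues:
  assumes ev: "eigenpair A a v" "eigenpair A b w" and r: "a ^ q = a" "b ^ q = b" and ne: "a \<noteq> b"
  shows class_collapses
proof -
  obtain d V1 W1 where d: "d > 0" "\<And>i. 0 < i \<Longrightarrow> i < d \<Longrightarrow> a ^ (q ^ i) \<noteq> a"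
    and fam1: "eigenfamily A n d (\<lambda>i. Suc i mod d) (\<lambda>i. a ^ (q ^ i)) V1 W1"
    by (rule orbit_family[OF ev(1)]) (rule that)
  have "d = 1" using d(1) d(2)[of 1] r by fastforce
  note fam1 = fam1[unfolded this]
  have w: "w \<in> carrier_mat n 1" "A * w = b \<cdot>\<^sub>m w" using ev(2) unfolding eigenpair_def by auto
  have W1w: "W1 * w = 0\<^sub>m 1 1" by (rule right_eigen_annihilated[OF fam1 w]) (use ne in simp)
  obtain d' V W where d': "d' > 0" "\<And>i. 0 < i \<Longrightarrow> i < d' \<Longrightarrow> b ^ (q ^ i) \<noteq> b"
    and fam: "eigenfamily A n (1 + d') (\<lambda>a. if a < 1 then Suc a mod 1 else 1 + Suc (a - 1) mod d')
       (\<lambda>i. if i < 1 then a ^ (q ^ i) else b ^ (q ^ (i - 1))) V W"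
    by (rule extend_family[OF fam1 ev(2) W1w]) (rule that)
  have "d' = 1" using d'(1) d'(2)[of 1] r by fastforce
  then have d2: "1 + d' = 2" by simp
  define \<pi> where "\<pi> i = (if i < 1 then Suc i mod 1 else 1 + Suc (i - 1) mod d')" for i :: nat
  define \<delta> where "\<delta> i = (if i < 1 then a ^ (q ^ i) else b ^ (q ^ (i - 1)))" for i :: nat
  have fam: "eigenfamily A n 2 \<pi> \<delta> V W" using fam unfolding d2 \<pi>_def \<delta>_def .
  have pd: "\<pi> 0 = 0" "\<pi> 1 = 1" "\<delta> 0 = a" "\<delta> 1 = b" unfolding \<pi>_def \<delta>_def using \<open>d' = 1\<close> by simp_all
  have V: "V \<in> carrier_mat n 2" and W: "W \<in> carrier_mat 2 n" and WV: "W * V = 1\<^sub>m 2"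
    and AV: "A * V = V * mat_diag 2 \<delta>" using fam unfolding eigenfamily_def by auto
  define D' :: "'k mat" where "D' = mat 2 2 (\<lambda>(i, j). if j = 0 then if i = 0 then b else 0 else if i = 0 then a - b else a)"
  \<comment> \<open>Its columns (1, 1) and (1, 0) are eigenvectors of D' for a and b, so it carries
    diag(a, b) to D'; the entries 0 and 1 are fixed by Frobenius.\<close>
  define Y :: "'k mat" where "Y = mat 2 2 (\<lambda>(i, j). if i = 1 \<and> j = 1 then 0 else 1)"
  define Yi :: "'k mat" where "Yi = mat 2 2 (\<lambda>(i, j). if i = 0 \<and> j = 0 then 0 else if i = 1 \<and> j = 1 then - 1 else 1)"
  have c2: "D' \<in> carrier_mat 2 2" "Y \<in> carrier_mat 2 2" "Yi \<in> carrier_mat 2 2" unfolding D'_def Y_def Yi_def by simp_all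
  have two: "(\<Sum>x<2. f x) = f 0 + f 1" for f :: "nat \<Rightarrow> 'k" by (simp add: numeral_2_eq_2)
  have eq2: "M = N" if "M \<in> carrier_mat 2 2" "N \<in> carrier_mat 2 2" "M $$ (0, 0) = N $$ (0, 0)" "M $$ (0, 1) = N $$ (0, 1)"
    "M $$ (1, 0) = N $$ (1, 0)" "M $$ (1, 1) = N $$ (1, 1)" for M N :: "'k mat"
    using that by (intro eq_matI) (auto simp: less_2_cases_iff)
  have entries: "Y $$ (0, 0) = 1" "Y $$ (0, 1) = 1" "Y $$ (1, 0) = 1" "Y $$ (1, 1) = 0"
    "Yi $$ (0, 0) = 0" "Yi $$ (0, 1) = 1" "Yi $$ (1, 0) = 1" "Yi $$ (1, 1) = - 1"
    "D' $$ (0, 0) = b" "D' $$ (0, 1) = a - b" "D' $$ (1, 0) = 0" "D' $$ (1, 1) = a"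
    unfolding Y_def Yi_def D'_def by simp_all
  have Y1: "Y * Yi = 1\<^sub>m 2"
    by (rule eq2[OF mult_carrier_mat[OF c2(2,3)] one_carrier_mat])
      (simp_all add: mult_col_index[OF c2(2,3)] two entries del: index_mult_mat(1) One_nat_def)
  have Y2: "Y * mat_diag 2 \<delta> = D' * Y"
    by (rule eq2[OF mult_carrier_mat[OF c2(2) mat_diag_dim] mult_carrier_mat[OF c2(1,2)]])
      (simp_all add: mult_col_index[OF c2(1,2)] mult_col_index[OF c2(2) mat_diag_dim] two entries pd del: index_mult_mat(1) One_nat_def)
  have Y3: "Y $$ (\<pi> i, \<pi> j) = Y $$ (i, j) ^ q" if "i < 2" "j < 2" for i j
  proof -
    have "\<pi> i = i" if "i < 2" for i using that pd by (auto simp: less_2_cases_iff)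
    moreover have "Y $$ (i, j) = 0 \<or> Y $$ (i, j) = 1" using that unfolding Y_def by simp
    ultimately show ?thesis using that q_gt_1 by auto
  qed
  obtain g gi B Bi where c: "g \<in> carrier_mat n n" "gi \<in> carrier_mat n n" "g * gi = 1\<^sub>m n" "rational g" "det g = 1"
    "B \<in> carrier_mat n n" "Bi \<in> carrier_mat n n" "B * Bi = 1\<^sub>m n" "B * g = g * A"
    "B * V = V * D'"
    and cy: "\<And>y. y \<in> carrier_mat n 1 \<Longrightarrow> W * y = 0\<^sub>m 2 1 \<Longrightarrow> B * y = A * y"
    by (rule conjugate_family[OF n_pos Ai fam c2 Y1 Y2 Y3]) (assumption | rule that)+
  have i: "(0::nat) < 2" "(1::nat) < 2" by auto
  note up = unit_products[OF V W] and dual = family_dual[OF V W WV] and colA = family_col[OF V A_carrier AV]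
  have [simp]: "dim_row V = n" "dim_col V = 2" "dim_row W = 2" "dim_col W = n" "dim_row B = n" "dim_col B = n" "dim_row D' = 2" "dim_col D' = 2"
    using V W c c2 by auto
  define x y where "x = V * unit_col 2 0" and "y = V * unit_col 2 1"
  have xc: "x \<in> carrier_mat n 1" and yc: "y \<in> carrier_mat n 1" unfolding x_def y_def by (rule up)+
  have Ax: "A * x = a \<cdot>\<^sub>m x" and Ay: "A * y = b \<cdot>\<^sub>m y" unfolding x_def y_def colA[OF i(1)] colA[OF i(2)] pd by simp_all
  have col: "D' * unit_col 2 0 = b \<cdot>\<^sub>m unit_col 2 0" "D' * unit_col 2 1 = a \<cdot>\<^sub>m unit_col 2 1 + (a - b) \<cdot>\<^sub>m unit_col 2 0"
  proof -
    have eq: "M = N" if "M \<in> carrier_mat 2 1" "N \<in> carrier_mat 2 1" "M $$ (0, 0) = N $$ (0, 0)" "M $$ (1, 0) = N $$ (1, 0)" for M N :: "'k mat"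
      using that by (intro eq_matI) (auto simp: less_2_cases_iff)
    have u: "unit_col 2 j $$ (i, 0) = (if i = j then 1 else 0 :: 'k)" if "i < 2" for i j :: nat
      using that unfolding unit_col_def by simp
    show "D' * unit_col 2 0 = b \<cdot>\<^sub>m unit_col 2 0"
      by (rule eq) (simp_all add: mult_col_index[OF c2(1) unit_dims(5)] two entries u carrier_matI del: index_mult_mat(1) One_nat_def)
    show "D' * unit_col 2 1 = a \<cdot>\<^sub>m unit_col 2 1 + (a - b) \<cdot>\<^sub>m unit_col 2 0"
      by (rule eq) (simp_all add: mult_col_index[OF c2(1) unit_dims(5)] two entries u carrier_matI del: index_mult_mat(1) One_nat_def)
  qed
  have BV: "B * (V * u) = V * (D' * u)" if "dim_row u = 2" for u :: "'k mat"
    using that c(10) by (simp add: mult_mat_assoc[symmetric])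
  have Bx: "B * x = b \<cdot>\<^sub>m x" unfolding x_def by (simp add: BV col smult_mat_mult_right)
  have By: "B * y = a \<cdot>\<^sub>m y + (a - b) \<cdot>\<^sub>m x" unfolding x_def y_def
    by (simp add: BV col smult_mat_mult_right mult_mat_add_right del: One_nat_def)
  have z0: "M + 0 \<cdot>\<^sub>m x = M" if "M \<in> carrier_mat n 1" for M using that xc by (intro eq_matI) auto
  have Ay0: "A * y = b \<cdot>\<^sub>m y + 0 \<cdot>\<^sub>m x" using Ay z0[of "b \<cdot>\<^sub>m y"] yc by simp
  have nz: "a \<noteq> 0" "b \<noteq> 0" by (rule eigen_nonzero[OF ev(1)], rule eigen_nonzero[OF ev(2)])
  have sep: "separated B"
  proof -
    have "V * W \<noteq> 1\<^sub>m n" by (rule no_wide_factorization[OF V W]) (use n_ge_3 in simp)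
    then obtain \<gamma> u where u: "eigenpair A \<gamma> u" "W * u = 0\<^sub>m 2 1" by (rule complement_eigenvector[OF fam])
    obtain \<eta> where e: "\<eta> \<in> carrier_mat 1 n" "\<eta> * u = 1\<^sub>m 1" "\<eta> * V = 0\<^sub>m 1 2" by (rule complement_dual[OF fam u])
    have uc: "u \<in> carrier_mat n 1" using u(1) unfolding eigenpair_def by simp
    have [simp]: "dim_row u = n" "dim_row \<eta> = 1" "dim_col \<eta> = n" using uc e by auto
    have 1: "unit_row 2 0 * W * u = 0\<^sub>m 1 1"
      using u(2) by (simp add: mult_mat_assoc right_mult_zero_mat[OF unit_dims(6)])
    have "\<eta> * x = (\<eta> * V) * unit_col 2 0" unfolding x_def by (simp add: mult_mat_assoc)
    then have 2: "\<eta> * x = 0\<^sub>m 1 1" unfolding e(3) by (simp add: left_mult_zero_mat[OF unit_dims(5)])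
    show ?thesis
      by (rule separated_pair[OF c(6) xc up(2)[of 0] u(1) e(1) _ 1 2 e(2) Ax Bx cy[OF uc u(2)]])
        (use dual[OF i(1,1)] ne in \<open>auto simp: x_def\<close>)
  qed
  interpret S: subquotient x "1\<^sub>m 1" y "unit_row 2 0 * W" n 1
    by unfold_locales (use xc yc up dual[OF i(1,1)] dual[OF i(1,2)] in \<open>auto simp: x_def y_def\<close>)
  have ab: "a - b \<noteq> 0" using ne by simp
  have upAi: "upper2 x (1\<^sub>m 1) y Ai (1 / a) (1 / b) 0"
    using upper2_line_inverse[OF xc yc A_carrier Ai Ax Ay0 nz] by simp
  note NC = S.noncommuting[OF A_carrier Ai(1) c(6,7,8) upper2_line[OF xc yc Ax Ay0] upAi
      upper2_line[OF xc yc Bx By] upper2_line_inverse[OF xc yc c(6-8) Bx By nz(2,1)] nz nz(2,1) ne ne[symmetric] ab]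
  show ?thesis by (rule levi_case[OF c(1-9) sep NC])
qed

end

section \<open>Explicit matrices of size four\<close>

lemma sum_less_4: "(\<Sum>x<4::nat. f x) = f 0 + f 1 + f 2 + (f 3 :: 'k::comm_monoid_add)"
proof -
  have "{..<4} = {0, 1, 2, 3 :: nat}" by auto
  then show ?thesis by (simp add: add.assoc)
qed

lemma less_4_cases: "(i::nat) < 4 \<longleftrightarrow> i = 0 \<or> i = 1 \<or> i = 2 \<or> i = 3" by auto

lemma mat_of_rows_list_index: "i < length xs \<Longrightarrow> j < k \<Longrightarrow> mat_of_rows_list k xs $$ (i, j) = xs ! i ! j"
  unfolding mat_of_rows_list_def by simp

lemma mat_of_rows_list_4 [simp]:
  "mat_of_rows_list 4 [a, b, c, d] \<in> carrier_mat 4 4"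
  "dim_row (mat_of_rows_list 4 [a, b, c, d]) = 4" "dim_col (mat_of_rows_list 4 [a, b, c, d]) = 4"
proof -
  have "length [a, b, c, d] = 4" by simp
  then show "mat_of_rows_list 4 [a, b, c, d] \<in> carrier_mat 4 4"
    "dim_row (mat_of_rows_list 4 [a, b, c, d]) = 4" "dim_col (mat_of_rows_list 4 [a, b, c, d]) = 4"
    unfolding mat_of_rows_list_def by (simp_all only: mat_carrier dim_row_mat dim_col_mat)
qed

lemma mult_mat_4:
  fixes a0 :: "'k::comm_ring_1"
  shows "mat_of_rows_list 4 [[a0, a1, a2, a3], [b0, b1, b2, b3], [c0, c1, c2, c3], [d0, d1, d2, d3]] *
    mat_of_rows_list 4 [[p0, p1, p2, p3], [q0, q1, q2, q3], [r0, r1, r2, r3], [s0, s1, s2, s3]] =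
    mat_of_rows_list 4
     [[a0*p0 + a1*q0 + a2*r0 + a3*s0, a0*p1 + a1*q1 + a2*r1 + a3*s1, a0*p2 + a1*q2 + a2*r2 + a3*s2, a0*p3 + a1*q3 + a2*r3 + a3*s3],
      [b0*p0 + b1*q0 + b2*r0 + b3*s0, b0*p1 + b1*q1 + b2*r1 + b3*s1, b0*p2 + b1*q2 + b2*r2 + b3*s2, b0*p3 + b1*q3 + b2*r3 + b3*s3],
      [c0*p0 + c1*q0 + c2*r0 + c3*s0, c0*p1 + c1*q1 + c2*r1 + c3*s1, c0*p2 + c1*q2 + c2*r2 + c3*s2, c0*p3 + c1*q3 + c2*r3 + c3*s3],
      [d0*p0 + d1*q0 + d2*r0 + d3*s0, d0*p1 + d1*q1 + d2*r1 + d3*s1, d0*p2 + d1*q2 + d2*r2 + d3*s2, d0*p3 + d1*q3 + d2*r3 + d3*s3]]"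
    (is "?M * ?N = ?R")
proof (rule eq_matI)
  have M: "?M \<in> carrier_mat 4 4" and N: "?N \<in> carrier_mat 4 4" by (rule mat_of_rows_list_4)+
  fix i j assume "i < dim_row ?R" "j < dim_col ?R"
  then have ij: "i < 4" "j < 4" unfolding mat_of_rows_list_4 .
  show "(?M * ?N) $$ (i, j) = ?R $$ (i, j)" unfolding mult_col_index[OF M N ij] sum_less_4
    using ij unfolding less_4_cases by (elim disjE) (simp_all add: mat_of_rows_list_index)
qed (simp_all only: mat_of_rows_list_4 index_mult_mat)

lemma mat_diag_4:
  "mat_diag 4 \<delta> = mat_of_rows_list 4 [[\<delta> 0, 0, 0, 0], [0, \<delta> 1, 0, 0], [0, 0, \<delta> 2, 0], [0, 0, 0, \<delta> 3 :: 'k::zero]]"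
proof (rule eq_matI)
  fix i j assume "i < dim_row (mat_of_rows_list 4 [[\<delta> 0, 0, 0, 0], [0, \<delta> 1, 0, 0], [0, 0, \<delta> 2, 0], [0, 0, 0, \<delta> 3]])"
    "j < dim_col (mat_of_rows_list 4 [[\<delta> 0, 0, 0, 0], [0, \<delta> 1, 0, 0], [0, 0, \<delta> 2, 0], [0, 0, 0, \<delta> 3]])"
  then have "i < 4" "j < 4" unfolding mat_of_rows_list_4 .
  then show "mat_diag 4 \<delta> $$ (i, j) = mat_of_rows_list 4 [[\<delta> 0, 0, 0, 0], [0, \<delta> 1, 0, 0], [0, 0, \<delta> 2, 0], [0, 0, 0, \<delta> 3]] $$ (i, j)"
    unfolding less_4_cases by (elim disjE) (simp_all add: mat_of_rows_list_index mat_diag_def)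
qed simp_all

context semisimple_case
begin

text \<open>In 2 x 2 blocks D is (C, 0; 0, -C) and D' is (C', C'; 0, -C'), where C and C'
  anticommute and have square -1. On the first two basis vectors this is the quaternion relation,
  and it tells A and B apart up to sign. The corner block C' prevents A and B from anticommuting on
  the whole space, which makes the conjugates fail to commute.\<close>

lemma collapse_quaternion:
  assumes aa: "\<alpha> * \<alpha> = - 1" and ne: "\<alpha> \<noteq> - \<alpha>"
    and pi: "\<pi> 0 = 1" "\<pi> 1 = 0" "\<pi> 2 = 3" "\<pi> 3 = 2"
    and de: "\<delta> 0 = \<alpha>" "\<delta> 1 = - \<alpha>" "\<delta> 2 = - \<alpha>" "\<delta> 3 = \<alpha>"
    and fam: "eigenfamily A n 4 \<pi> \<delta> V W" and VW: "V * W = 1\<^sub>m n"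
  shows class_collapses
proof -
  have V: "V \<in> carrier_mat n 4" and W: "W \<in> carrier_mat 4 n" and WV: "W * V = 1\<^sub>m 4"
    and AV: "A * V = V * mat_diag 4 \<delta>" using fam unfolding eigenfamily_def by auto
  have two: "(1 + 1 :: 'k) \<noteq> 0"
  proof
    assume "(1 + 1 :: 'k) = 0"
    then have "\<alpha> * (1 + 1) = 0" by simp
    then have "\<alpha> + \<alpha> = 0" by (simp only: distrib_left mult_1_right)
    then show False using ne by (simp add: eq_neg_iff_add_eq_0)
  qed
  have q1: "q + 1 > 0" by simp
  \<comment> \<open>The off-diagonal entries of C' are -\<alpha> p and -\<alpha> r. Square -1
    requires p r = 1, and equivariance under Frobenius, which swaps the basis vectors and the
    eigenvalues \<alpha> and -\<alpha>, requires r^q = -p; together these mean r^(q+1) = -1.\<close>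
  obtain r :: 'k where rq: "r ^ (q + 1) = - 1" using nth_root_exists[OF q1, of "- 1 :: 'k"] by blast
  define p where "p = - (r ^ q)"
  have pr: "p * r = 1" unfolding p_def using rq by (simp add: mult.commute)
  have r0: "r \<noteq> 0" using rq by auto
  have rqq: "(r ^ q) ^ q = r"
  proof -
    have "(r ^ q) ^ q * r ^ q = (r ^ q * r) ^ q" by (simp add: power_mult_distrib)
    also have "r ^ q * r = - 1" using rq by (simp add: mult.commute)
    also have "(- 1 :: 'k) ^ q = - 1" by (simp add: frob.hom_uminus)
    also have "(- 1 :: 'k) = r * r ^ q" using rq by simp
    finally show ?thesis using r0 by simp
  qed
  have pq: "p ^ q = - r" and rq': "r ^ q = - p" unfolding p_def by (simp_all add: frob.hom_uminus rqq)
  \<comment> \<open>The diagonal blocks of Y have determinant 1 + p r = 2, so its inverse needs one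
    half.\<close>
  define h where "h = (1 :: 'k) / (1 + 1)"
  have hh: "h + h = 1"
  proof -
    have "h * (1 + 1) = 1" unfolding h_def using two by simp
    then show ?thesis by (simp only: distrib_left mult_1_right)
  qed
  define D where "D = mat_diag 4 \<delta>"
  define D' where "D' = mat_of_rows_list 4 [[0, - (\<alpha> * p), 0, - (\<alpha> * p)], [- (\<alpha> * r), 0, - (\<alpha> * r), 0], [0, 0, 0, \<alpha> * p], [0, 0, \<alpha> * r, 0]]"
  define Y where "Y = mat_of_rows_list 4 [[1, p, 0, - p], [- r, 1, r, 0], [0, 0, 1, p], [0, 0, - r, 1]]"
  define Yi where "Yi = mat_of_rows_list 4 [[h, - (h * p), h, 0], [h * r, h, 0, h], [0, 0, h, - (h * p)], [0, 0, h * r, h]]"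
  have D: "D = mat_of_rows_list 4 [[\<alpha>, 0, 0, 0], [0, - \<alpha>, 0, 0], [0, 0, - \<alpha>, 0], [0, 0, 0, \<alpha>]]"
    unfolding D_def mat_diag_4 de ..
  have one: "1\<^sub>m 4 = mat_of_rows_list 4 [[1, 0, 0, 0], [0, 1, 0, 0], [0, 0, 1, 0], [0, 0, 0, 1 :: 'k]]"
    using mat_diag_4[of "\<lambda>_. 1 :: 'k"] by simp
  have c4: "D \<in> carrier_mat 4 4" "D' \<in> carrier_mat 4 4" "Y \<in> carrier_mat 4 4" "Yi \<in> carrier_mat 4 4"
    unfolding D_def D'_def Y_def Yi_def by simp_all
  have rules: "p * r = 1" "r * p = 1" "\<alpha> * \<alpha> = - 1" "\<alpha> * (\<alpha> * z) = - z" "p * (r * z) = z" "r * (p * z) = z"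
    "p * (\<alpha> * z) = \<alpha> * (p * z)" "r * (\<alpha> * z) = \<alpha> * (r * z)" "p * \<alpha> = \<alpha> * p" "r * \<alpha> = \<alpha> * r"
    "p * (h * z) = h * (p * z)" "r * (h * z) = h * (r * z)" "p * h = h * p" "r * h = h * r" for z
    using pr aa by (simp_all add: ac_simps) (simp_all add: mult.assoc[symmetric] aa pr mult.commute[of r p])
  have Y1: "Y * Yi = 1\<^sub>m 4"
    unfolding Y_def Yi_def mult_mat_4 one by (rule arg_cong[where f = "mat_of_rows_list 4"]) (simp add: rules hh)
  have Y2: "Y * mat_diag 4 \<delta> = D' * Y"
    unfolding D_def[symmetric] D Y_def D'_def mult_mat_4
    by (rule arg_cong[where f = "mat_of_rows_list 4"]) (simp add: rules mult.assoc)
  have DD': "D' * D' = - 1\<^sub>m 4" "D * D = - 1\<^sub>m 4"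
  proof -
    have m: "- 1\<^sub>m 4 = mat_of_rows_list 4 [[- 1, 0, 0, 0], [0, - 1, 0, 0], [0, 0, - 1, 0], [0, 0, 0, - 1 :: 'k]]"
    proof -
      have "- 1\<^sub>m 4 = mat_diag 4 (\<lambda>_. - 1 :: 'k)" by (intro eq_matI) auto
      then show ?thesis unfolding mat_diag_4 .
    qed
    show "D' * D' = - 1\<^sub>m 4" unfolding D'_def mult_mat_4 m
      by (rule arg_cong[where f = "mat_of_rows_list 4"]) (simp add: rules mult.assoc)
    show "D * D = - 1\<^sub>m 4" unfolding D mult_mat_4 m
      by (rule arg_cong[where f = "mat_of_rows_list 4"]) (simp add: rules)
  qed
  have Yq: "Y $$ (\<pi> a, \<pi> b) = Y $$ (a, b) ^ q" if "a < 4" "b < 4" for a b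
    using that unfolding less_4_cases
    by (elim disjE) (use q_gt_1 in \<open>simp_all add: pi[unfolded One_nat_def] pi Y_def mat_of_rows_list_index frob.hom_uminus pq rq'\<close>)
  obtain g gi B Bi where c: "g \<in> carrier_mat n n" "gi \<in> carrier_mat n n" "g * gi = 1\<^sub>m n" "rational g" "det g = 1"
    "B \<in> carrier_mat n n" "Bi \<in> carrier_mat n n" "B * Bi = 1\<^sub>m n" "B * g = g * A" "B * V = V * D'"
    by (rule conjugate_family[OF n_pos Ai fam c4(2-4) Y1 Y2 Yq]) (assumption | rule that)+
  have [simp]: "dim_row V = n" "dim_col V = 4" "dim_row W = 4" "dim_col W = n" "dim_row B = n" "dim_col B = n"
    "dim_row Bi = n" "dim_col Bi = n" "dim_row D = 4" "dim_col D = 4" "dim_row D' = 4" "dim_col D' = 4"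
    using V W c c4 by auto
  have AV': "A * V = V * D" using AV unfolding D_def .
  \<comment> \<open>A matrix of square -1 has its negative as inverse. This turns the two
    non-commutation conditions into one inequality between words in A and B.\<close>
  have neg_inv: "Mi = - M" if M: "M \<in> carrier_mat n n" "Mi \<in> carrier_mat n n" "M * Mi = 1\<^sub>m n" "M * V = V * E"
    and E: "E \<in> carrier_mat 4 4" "E * E = - 1\<^sub>m 4" for M Mi E
  proof -
    have [simp]: "dim_row M = n" "dim_col M = n" "dim_row Mi = n" "dim_col Mi = n" "dim_row E = 4" "dim_col E = 4" using M E by auto
    have "M * (M * V) = (M * V) * E" unfolding M(4) by (simp add: mult_mat_assoc[symmetric] M(4))
    then have mm: "M * (M * V) = V * (E * E)" unfolding M(4) by (simp add: mult_mat_assoc)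
    have "M * M = M * (M * V) * W" using VW by (simp add: mat_ring)
    also have "\<dots> = V * (E * E) * W" unfolding mm ..
    also have "\<dots> = - 1\<^sub>m n" unfolding E(2) using VW by (simp add: mat_ring)
    finally have MM: "M * M = - 1\<^sub>m n" .
    have "Mi * M = 1\<^sub>m n" by (rule mat_mult_left_right_inverse[OF M(1-3)])
    then have "M = Mi * (M * M)" by (simp add: mult_mat_assoc[symmetric] mult_mat_unit_left)
    also have "\<dots> = - Mi" unfolding MM by (simp add: mat_ring)
    finally show ?thesis by simp
  qed
  have Aim: "Ai = - A" by (rule neg_inv[OF A_carrier Ai AV' c4(1) DD'(2)])
  have Bim: "Bi = - B" by (rule neg_inv[OF c(6-8) c(10) c4(2) DD'(1)])
  have word: "(M1 * (M2 * (M3 * M4))) * V = V * (E1 * (E2 * (E3 * E4)))"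
    if "M1 * V = V * E1" "M2 * V = V * E2" "M3 * V = V * E3" "M4 * V = V * E4"
      "M1 \<in> carrier_mat n n" "M2 \<in> carrier_mat n n" "M3 \<in> carrier_mat n n" "M4 \<in> carrier_mat n n"
      "E1 \<in> carrier_mat 4 4" "E2 \<in> carrier_mat 4 4" "E3 \<in> carrier_mat 4 4" "E4 \<in> carrier_mat 4 4" for M1 M2 M3 M4 E1 E2 E3 E4
  proof -
    have [simp]: "dim_row M1 = n" "dim_col M1 = n" "dim_row M2 = n" "dim_col M2 = n" "dim_row M3 = n" "dim_col M3 = n" "dim_row M4 = n" "dim_col M4 = n"
      "dim_row E1 = 4" "dim_col E1 = 4" "dim_row E2 = 4" "dim_col E2 = 4" "dim_row E3 = 4" "dim_col E3 = 4" "dim_row E4 = 4" "dim_col E4 = 4"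
      using that by auto
    have "(M1 * (M2 * (M3 * M4))) * V = M1 * (M2 * (M3 * (M4 * V)))" by (simp add: mult_mat_assoc)
    also have "\<dots> = M1 * (M2 * ((M3 * V) * E4))" unfolding that(4) by (simp add: mult_mat_assoc)
    also have "\<dots> = M1 * ((M2 * V) * (E3 * E4))" unfolding that(3) by (simp add: mult_mat_assoc)
    also have "\<dots> = (M1 * V) * (E2 * (E3 * E4))" unfolding that(2) by (simp add: mult_mat_assoc)
    finally show ?thesis unfolding that(1) by (simp add: mult_mat_assoc)
  qed
  \<comment> \<open>The squares of D D' and D' D have opposite corner blocks: their entries at (0,
    2) are -2 and 2, which differ because the characteristic is not 2.\<close>
  have words: "D * (D' * (D * D')) \<noteq> D' * (D * (D' * D))"
  proof
    assume e: "D * (D' * (D * D')) = D' * (D * (D' * D))"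
    have "(D * (D' * (D * D'))) $$ (0, 2) = (D' * (D * (D' * D))) $$ (0, 2)" unfolding e ..
    then have "(2 :: 'k) = 0"
      unfolding D D'_def mult_mat_4 by (auto simp: mat_of_rows_list_index rules mult.assoc)
    then show False using two by simp
  qed
  have wordsAB: "A * (B * (A * B)) \<noteq> B * (A * (B * A))"
  proof
    assume e: "A * (B * (A * B)) = B * (A * (B * A))"
    have "V * (D * (D' * (D * D'))) = V * (D' * (D * (D' * D)))"
      using word[OF AV' c(10) AV' c(10) A_carrier c(6) A_carrier c(6) c4(1,2,1,2)]
        word[OF c(10) AV' c(10) AV' c(6) A_carrier c(6) A_carrier c4(2,1,2,1)] e by simp
    then have "W * (V * (D * (D' * (D * D')))) = W * (V * (D' * (D * (D' * D))))" by simp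
    then have "D * (D' * (D * D')) = D' * (D * (D' * D))"
      by (simp add: mult_mat_assoc[symmetric] WV mult_mat_unit_left)
    then show False using words by simp
  qed
  have nc: "A * (B * A * Bi) \<noteq> B * A * Bi * A" "B * (A * B * Ai) \<noteq> A * B * Ai * B"
  proof -
    have uminus_inj: "- M = - N \<longleftrightarrow> M = N" for M N :: "'k mat" by (metis uminus_uminus_mat)
    show "A * (B * A * Bi) \<noteq> B * A * Bi * A" "B * (A * B * Ai) \<noteq> A * B * Ai * B"
      unfolding Aim Bim using wordsAB by (auto simp: mat_ring uminus_inj)
  qed
  \<comment> \<open>D and D' are block upper triangular, so the first two columns of V span a
    subspace stable under A and B.\<close>
  define V0 L0 C C' where "V0 = mat n 2 (\<lambda>(i, j). V $$ (i, j))" and "L0 = mat 2 n (\<lambda>(i, j). W $$ (i, j))"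
    and "C = mat 2 2 (\<lambda>(i, j). D $$ (i, j))" and "C' = mat 2 2 (\<lambda>(i, j). D' $$ (i, j))"
  have cc: "V0 \<in> carrier_mat n 2" "L0 \<in> carrier_mat 2 n" "C \<in> carrier_mat 2 2" "C' \<in> carrier_mat 2 2"
    unfolding V0_def L0_def C_def C'_def by simp_all
  have "L0 * V0 = 1\<^sub>m 2"
  proof (rule eq_matI)
    fix i j assume "i < dim_row (1\<^sub>m 2 :: 'k mat)" "j < dim_col (1\<^sub>m 2 :: 'k mat)"
    then have ij: "i < 2" "j < 2" "i < 4" "j < 4" by auto
    have "(L0 * V0) $$ (i, j) = (W * V) $$ (i, j)"
      unfolding mult_col_index[OF cc(2,1) ij(1,2)] mult_col_index[OF W V ij(3,4)]
      using ij by (intro sum.cong refl) (simp add: L0_def V0_def)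
    then show "(L0 * V0) $$ (i, j) = 1\<^sub>m 2 $$ (i, j)" unfolding WV using ij by simp
  qed (use cc in auto)
  moreover have sub: "M * V0 = V0 * mat 2 2 (\<lambda>(i, j). E $$ (i, j))"
    if M: "M \<in> carrier_mat n n" "M * V = V * E" and E: "E \<in> carrier_mat 4 4" "\<And>j. j < 2 \<Longrightarrow> E $$ (2, j) = 0 \<and> E $$ (3, j) = 0" for M E
  proof (rule eq_matI)
    have m2: "mat 2 2 (\<lambda>(i, j). E $$ (i, j)) \<in> carrier_mat 2 2" by simp
    fix i j assume "i < dim_row (V0 * mat 2 2 (\<lambda>(i, j). E $$ (i, j)))" "j < dim_col (V0 * mat 2 2 (\<lambda>(i, j). E $$ (i, j)))"
    then have ij: "i < n" "j < 2" "j < 4" using cc by auto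
    have "(M * V0) $$ (i, j) = (M * V) $$ (i, j)"
      unfolding mult_col_index[OF M(1) cc(1) ij(1,2)] mult_col_index[OF M(1) V ij(1,3)]
      using ij by (intro sum.cong refl) (simp add: V0_def)
    also have "\<dots> = (\<Sum>x<4. V $$ (i, x) * E $$ (x, j))" unfolding M(2) by (rule mult_col_index[OF V E(1) ij(1,3)])
    also have "\<dots> = (\<Sum>x<2. V0 $$ (i, x) * mat 2 2 (\<lambda>(i, j). E $$ (i, j)) $$ (x, j))"
      unfolding sum_less_4 using E(2)[OF ij(2)] ij by (simp add: numeral_2_eq_2 V0_def)
    also have "\<dots> = (V0 * mat 2 2 (\<lambda>(i, j). E $$ (i, j))) $$ (i, j)" by (rule mult_col_index[OF cc(1) m2 ij(1,2), symmetric])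
    finally show "(M * V0) $$ (i, j) = (V0 * mat 2 2 (\<lambda>(i, j). E $$ (i, j))) $$ (i, j)" .
  qed (use M cc in auto)
  have lt2: "(j::nat) < 2 \<Longrightarrow> j = 0 \<or> j = 1" for j by auto
  have "A * V0 = V0 * C" unfolding C_def
    by (rule sub[OF A_carrier AV' c4(1)]) (auto dest!: lt2 simp: D mat_of_rows_list_index)
  moreover have "B * V0 = V0 * C'" unfolding C'_def
    by (rule sub[OF c(6) c(10) c4(2)]) (auto dest!: lt2 simp: D'_def mat_of_rows_list_index)
  moreover have Ce: "C $$ (0, 0) = \<alpha>" "C $$ (0, 1) = 0" "C $$ (1, 0) = 0" "C $$ (1, 1) = - \<alpha>"
    "C' $$ (0, 0) = 0" "C' $$ (0, 1) = - (\<alpha> * p)" "C' $$ (1, 0) = - (\<alpha> * r)" "C' $$ (1, 1) = 0"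
    unfolding C_def C'_def by (simp_all add: D D'_def mat_of_rows_list_index)
  have a0: "\<alpha> \<noteq> 0" using ne by auto
  have "C' \<noteq> C" "C' \<noteq> - C"
  proof -
    have "C' $$ (0, 0) \<noteq> C $$ (0, 0)" using Ce a0 by simp
    moreover have "(- C) $$ (0, 0) = - C $$ (0, 0)" using cc by simp
    then have "C' $$ (0, 0) \<noteq> (- C) $$ (0, 0)" using Ce a0 by simp
    ultimately show "C' \<noteq> C" "C' \<noteq> - C" by metis+
  qed
  moreover have "C * C' = - (C' * C)"
  proof (rule eq_matI)
    fix i j assume "i < dim_row (- (C' * C))" "j < dim_col (- (C' * C))"
    then have ij: "i < 2" "j < 2" using cc by auto
    have s2: "(\<Sum>x<2. f x) = f 0 + f 1" for f :: "nat \<Rightarrow> 'k" by (simp add: numeral_2_eq_2)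
    have "(- (C' * C)) $$ (i, j) = - (C' * C) $$ (i, j)" using ij cc by (simp del: index_mult_mat(1))
    also have "\<dots> = - (C' $$ (i, 0) * C $$ (0, j) + C' $$ (i, 1) * C $$ (1, j))"
      unfolding mult_col_index[OF cc(4,3) ij] s2 ..
    finally show "(C * C') $$ (i, j) = (- (C' * C)) $$ (i, j)"
      unfolding mult_col_index[OF cc(3,4) ij] s2 using lt2[OF ij(1)] lt2[OF ij(2)] Ce
      by (elim disjE) (simp_all add: mult.commute)
  qed (use cc in auto)
  ultimately have "separated B" unfolding separated_def using cc by blast
  then show ?thesis by (rule levi_case[OF c(1-9) _ nc])
qed

text \<open>The rows for \<alpha> and \<alpha>^q = \<alpha>^-1 cannot be paired, so two rows with
  one common eigenvalue are needed, and a second orbit provides them. Shifting both orbits inverts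
  all eigenvalues of the family. This differs from A up to sign unless the family spans the whole
  space and \<alpha>^2 = -1, which is the quaternion case.\<close>

lemma collapse_inverse_pair:
  assumes aq: "\<alpha> ^ q \<noteq> \<alpha>" "(\<alpha> ^ q) ^ q = \<alpha>" and norm: "\<alpha> * \<alpha> ^ q = 1"
    and fam2: "eigenfamily A n 2 (\<lambda>a. Suc a mod 2) (\<lambda>a. \<alpha> ^ (q ^ a)) V2 W2"
    and all: "\<And>\<beta> y. eigenpair A \<beta> y \<Longrightarrow> \<beta> = \<alpha> \<or> \<beta> = \<alpha> ^ q"
  shows class_collapses
proof -
  have V2: "V2 \<in> carrier_mat n 2" and W2: "W2 \<in> carrier_mat 2 n" using fam2 unfolding eigenfamily_def by auto
  have "V2 * W2 \<noteq> 1\<^sub>m n" by (rule no_wide_factorization[OF V2 W2]) (use n_ge_3 in simp)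
  then obtain \<gamma> y0 where y0: "eigenpair A \<gamma> y0" "W2 * y0 = 0\<^sub>m 2 1" by (rule complement_eigenvector[OF fam2])
  \<comment> \<open>The second orbit is made to start at \<alpha>^q, by applying Frobenius if
    necessary. The eigenvalues then come in the order \<alpha>, \<alpha>^q, \<alpha>^q, \<alpha>,
    and the rows 1 and 2 share one before and after the shift.\<close>
  have "\<exists>y. eigenpair A (\<alpha> ^ q) y \<and> W2 * y = 0\<^sub>m 2 1"
  proof (cases "\<gamma> = \<alpha> ^ q")
    case False
    then have "\<gamma> = \<alpha>" using all[OF y0(1)] by simp
    then have "eigenpair A (\<alpha> ^ q) (fpow 1 y0)" using eigenpair_fpow[OF y0(1), of 1] by simp
    moreover have "y0 \<in> carrier_mat n 1" using y0(1) unfolding eigenpair_def by simp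
    then have "W2 * fpow 1 y0 = 0\<^sub>m 2 1" by (rule family_annihilates_fpow(1)[OF fam2 _ y0(2)])
    ultimately show ?thesis by blast
  qed (use y0 in blast)
  then obtain y where y: "eigenpair A (\<alpha> ^ q) y" "W2 * y = 0\<^sub>m 2 1" by blast
  obtain d V W where d: "d > 0" "(\<alpha> ^ q) ^ (q ^ d) = \<alpha> ^ q" "\<And>i. 0 < i \<Longrightarrow> i < d \<Longrightarrow> (\<alpha> ^ q) ^ (q ^ i) \<noteq> \<alpha> ^ q"
    and fam: "eigenfamily A n (2 + d) (\<lambda>a. if a < 2 then Suc a mod 2 else 2 + Suc (a - 2) mod d)
       (\<lambda>a. if a < 2 then \<alpha> ^ (q ^ a) else (\<alpha> ^ q) ^ (q ^ (a - 2))) V W"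
    by (rule extend_family[OF fam2 y]) (rule that)
  have qq: "x ^ (q ^ 2) = (x ^ q) ^ q" for x :: 'k by (simp add: power2_eq_square power_mult)
  have "d \<noteq> 1" using d(2) aq by auto
  moreover have "\<not> 2 < d" using d(3)[of 2] aq(2) unfolding qq by auto
  ultimately have d2: "d = 2" using d(1) by simp
  have four: "2 + (2::nat) = 4" by simp
  define \<pi> where "\<pi> a = (if a < 2 then Suc a mod 2 else 2 + Suc (a - 2) mod 2)" for a :: nat
  define \<delta> where "\<delta> a = (if a < 2 then \<alpha> ^ (q ^ a) else (\<alpha> ^ q) ^ (q ^ (a - 2)))" for a :: nat
  have fam: "eigenfamily A n 4 \<pi> \<delta> V W" using fam unfolding d2 four \<pi>_def \<delta>_def .
  have pi: "\<pi> 0 = 1" "\<pi> 1 = 0" "\<pi> 2 = 3" "\<pi> 3 = 2" unfolding \<pi>_def by simp_all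
  have de: "\<delta> 0 = \<alpha>" "\<delta> 1 = \<alpha> ^ q" "\<delta> 2 = \<alpha> ^ q" "\<delta> 3 = \<alpha>" unfolding \<delta>_def using aq by simp_all
  have a0: "\<alpha> \<noteq> 0" using norm by auto
  show ?thesis
  proof (cases "V * W = 1\<^sub>m n \<and> \<alpha> * \<alpha> = - 1")
    case True
    have "\<alpha> * \<alpha> ^ q = \<alpha> * (- \<alpha>)" using norm True by simp
    then have am: "\<alpha> ^ q = - \<alpha>" using a0 mult_left_cancel by blast
    show ?thesis
      by (rule collapse_quaternion[OF _ _ pi _ _ _ _ fam]) (use True am aq(1) de in auto)
  next
    case False
    have V: "V \<in> carrier_mat n 4" and W: "W \<in> carrier_mat 4 n" and WV: "W * V = 1\<^sub>m 4"
      and AV: "A * V = V * mat_diag 4 \<delta>" and WA: "W * A = mat_diag 4 \<delta> * W" using fam unfolding eigenfamily_def by auto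
    \<comment> \<open>On the four indices \<open>\<pi>\<close> is an involution, so composing with
      it is the shift along both orbits.\<close>
    define \<delta>' where "\<delta>' a = \<delta> (\<pi> a)" for a
    have shift: "\<delta>' (\<pi> a) = \<delta> a" if "a < 4" for a
      using that unfolding less_4_cases \<delta>'_def by (elim disjE) (simp_all only: pi)
    obtain g gi B Bi where c: "g \<in> carrier_mat n n" "gi \<in> carrier_mat n n" "g * gi = 1\<^sub>m n" "rational g" "det g = 1"
      "B \<in> carrier_mat n n" "Bi \<in> carrier_mat n n" "B * Bi = 1\<^sub>m n" "B * g = g * A"
      "B * V = V * mat_diag 4 \<delta>'" "W * B = mat_diag 4 \<delta>' * W"
      and cy: "\<And>y. y \<in> carrier_mat n 1 \<Longrightarrow> W * y = 0\<^sub>m 4 1 \<Longrightarrow> B * y = A * y"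
      and cz: "\<And>z. z \<in> carrier_mat 1 n \<Longrightarrow> z * V = 0\<^sub>m 1 4 \<Longrightarrow> z * B = z * A"
      by (rule conjugate_family_shift[OF n_pos Ai fam, of \<delta>']) (rule shift that; assumption)+
    have d': "\<delta>' 0 = \<alpha> ^ q" "\<delta>' 1 = \<alpha>" "\<delta>' 2 = \<alpha>" unfolding \<delta>'_def by (simp_all only: pi de)
    have i: "(0::nat) < 4" "(1::nat) < 4" "(2::nat) < 4" by auto
    note colA = family_col[OF V A_carrier AV] and colB = family_col[OF V c(6,10)]
    note rowA = family_row[OF W A_carrier WA] and rowB = family_row[OF W c(6,11)]
    note up = unit_products[OF V W] and dual = family_dual[OF V W WV]
    have sep: "separated B"
    proof (cases "V * W = 1\<^sub>m n")
      case True
      have "\<alpha> ^ q \<noteq> - \<alpha>"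
      proof
        assume "\<alpha> ^ q = - \<alpha>"
        then have "- (\<alpha> * \<alpha>) = 1" using norm by simp
        then have "\<alpha> * \<alpha> = - 1" by (metis minus_minus)
        then show False using False True by simp
      qed
      then show ?thesis
        by (intro separated_single[OF c(6) up(1)[of 0] up(2)[of 0] _ colA[OF i(1)] colB[OF i(1)]])
          (use dual[OF i(1,1)] d' de aq in auto)
    next
      case neq: False
      obtain \<gamma> u where u: "eigenpair A \<gamma> u" "W * u = 0\<^sub>m 4 1" by (rule complement_eigenvector[OF fam neq])
      obtain \<eta> where e: "\<eta> \<in> carrier_mat 1 n" "\<eta> * u = 1\<^sub>m 1" "\<eta> * V = 0\<^sub>m 1 4" by (rule complement_dual[OF fam u])
      have uc: "u \<in> carrier_mat n 1" using u(1) unfolding eigenpair_def by simp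
      have [simp]: "dim_row V = n" "dim_col V = 4" "dim_row W = 4" "dim_col W = n" "dim_row u = n" "dim_row \<eta> = 1" "dim_col \<eta> = n"
        using V W uc e by auto
      have 1: "unit_row 4 0 * W * u = 0\<^sub>m 1 1"
        using u(2) by (simp add: mult_mat_assoc right_mult_zero_mat[OF unit_dims(6)])
      have "\<eta> * (V * unit_col 4 0) = (\<eta> * V) * unit_col 4 0" by (simp add: mult_mat_assoc)
      then have 2: "\<eta> * (V * unit_col 4 0) = 0\<^sub>m 1 1" unfolding e(3) by (simp add: left_mult_zero_mat[OF unit_dims(5)])
      show ?thesis
        by (rule separated_pair[OF c(6) up(1)[of 0] up(2)[of 0] u(1) e(1) _ 1 2 e(2) colA[OF i(1)] colB[OF i(1)] cy[OF uc u(2)]])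
          (use dual[OF i(1,1)] d' de aq in auto)
    qed
    have n1: "\<alpha> * \<alpha> \<noteq> 1"
    proof
      assume "\<alpha> * \<alpha> = 1"
      then have "\<alpha> * \<alpha> = \<alpha> * \<alpha> ^ q" using norm by simp
      then show False using a0 aq(1) mult_left_cancel by metis
    qed
    have n2: "\<alpha> ^ q * \<alpha> ^ q \<noteq> 1"
    proof
      assume "\<alpha> ^ q * \<alpha> ^ q = 1"
      then have "\<alpha> ^ q * \<alpha> ^ q = \<alpha> ^ q * \<alpha>" using norm by (simp add: mult.commute)
      moreover have "\<alpha> ^ q \<noteq> 0" using a0 by simp
      ultimately show False using aq(1) mult_left_cancel by metis
    qed
    show ?thesis
    proof (rule siegel_case[OF c(1-9) sep up(2) rowA[OF i(2)] rowB[OF i(2)] up(2) rowA[OF i(3)] rowB[OF i(3)] up(1)[of 1]])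
      show "unit_row 4 1 * W * (V * unit_col 4 1) = 1\<^sub>m 1" using dual[OF i(2,2)] by simp
      show "unit_row 4 2 * W * (V * unit_col 4 1) = 0\<^sub>m 1 1" using dual[OF i(3,2)] by simp
      have "unit_row 4 2 * W * (V * unit_col 4 2) = 1\<^sub>m 1" using dual[OF i(3,3)] by simp
      then show "unit_row 4 2 * W \<noteq> 0\<^sub>m 1 n" by (rule row_nonzero[OF _ up(1)])
      show "\<delta> 1 * \<delta> 2 \<noteq> 1" unfolding de by (rule n2)
      show "\<delta>' 1 * \<delta>' 2 \<noteq> 1" unfolding d' by (rule n1)
    qed
  qed
qed

end

section \<open>The Frobenius map of a finite field and of its algebraic closure\<close>

text \<open>Multiplication by a nonzero x permutes the nonzero elements and so preserves their
  product.\<close>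

lemma power_CARD_eq: "(x :: 'a::{field, finite}) ^ CARD('a) = x"
proof (cases "x = 0")
  case False
  have b: "bij_betw ((*) x) (UNIV - {0}) (UNIV - {0})"
    by (rule bij_betwI[where g = "\<lambda>y. y / x"]) (use False in auto)
  have "(\<Prod>y\<in>UNIV - {0}. x * y) = \<Prod>(UNIV - {0})" using prod.reindex_bij_betw[OF b, of "\<lambda>y. y"] by simp
  then have "x ^ card (UNIV - {0 :: 'a}) * \<Prod>(UNIV - {0}) = \<Prod>(UNIV - {0})" by (simp add: prod.distrib)
  moreover have "\<Prod>(UNIV - {0 :: 'a}) \<noteq> 0" by simp
  ultimately have "x ^ (CARD('a) - 1) = 1" by (simp add: card_Diff_singleton)
  moreover have "x ^ CARD('a) = x ^ (CARD('a) - 1) * x"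
    using power_minus_mult[of "CARD('a)" x] by simp
  ultimately show ?thesis by simp
qed simp

text \<open>The polynomial (X + 1)^q - X^q - 1 vanishes at all q elements of the field but has
  degree below q, so it is zero, and its coefficients are these binomials. The prime of which q is a
  power does not have to be named.\<close>

lemma binomial_CARD_eq_0:
  assumes "0 < i" "i < CARD('a)"
  shows "of_nat (CARD('a) choose i) = (0 :: 'a::{field, finite})"
proof -
  define q where "q = CARD('a)"
  define p :: "'a poly" where "p = (\<Sum>i\<in>{1..<q}. monom (of_nat (q choose i)) i)"
  have q: "q > 1" using assms unfolding q_def by simp
  have split: "{..q} = insert 0 (insert q {1..<q})" using q by auto
  have "poly p x = 0" for x
  proof -
    have "1 + x = (x + 1) ^ q" using power_CARD_eq[of "x + 1"] unfolding q_def by simp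
    also have "\<dots> = (\<Sum>i\<le>q. of_nat (q choose i) * x ^ i)" unfolding binomial_ring by simp
    also have "\<dots> = 1 + (x ^ q + poly p x)"
      unfolding split p_def using q by (simp add: poly_sum poly_monom)
    finally show ?thesis using power_CARD_eq[of x] unfolding q_def by simp
  qed
  then have "{x. poly p x = 0} = UNIV" by simp
  moreover have "degree p \<le> q - 1" unfolding p_def
    by (rule degree_sum_le) (auto intro!: order.trans[OF degree_monom_le])
  ultimately have "p = 0" using card_poly_roots_bound[of p] q unfolding q_def by force
  then have "coeff p i = 0" by simp
  moreover have "coeff p i = of_nat (q choose i)"
    unfolding p_def using assms by (simp add: coeff_sum q_def)
  ultimately show ?thesis unfolding q_def by simp
qed

text \<open>The inner binomial coefficients vanish in the finite field, hence also in its algebraic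
  closure, where only the outer terms of the binomial expansion remain.\<close>

lemma frobenius_field_alg_closure:
  "frobenius_field TYPE('a::{field, finite} alg_closure) CARD('a)"
proof
  have "card {0, 1 :: 'a} \<le> CARD('a)" by (rule card_mono) auto
  then show q: "CARD('a) > 1" by simp
  fix x y :: "'a alg_closure"
  have z: "of_nat (CARD('a) choose i) = (0 :: 'a alg_closure)" if "i \<in> {1..<CARD('a)}" for i
  proof -
    have "of_nat (CARD('a) choose i) = (0 :: 'a)" by (rule binomial_CARD_eq_0) (use that in auto)
    then have "to_ac (of_nat (CARD('a) choose i) :: 'a) = to_ac 0" by (rule arg_cong)
    then show ?thesis unfolding to_ac_of_nat to_ac_0 .
  qed
  have split: "{..CARD('a)} = insert 0 (insert CARD('a) {1..<CARD('a)})" using q by auto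
  show "(x + y) ^ CARD('a) = x ^ CARD('a) + y ^ CARD('a)"
    unfolding binomial_ring split using q z by simp
qed

context semisimple_case
begin

text \<open>In an eigenbasis all diagonal entries are eigenvalues and hence equal to c; a scalar
  matrix does not change under the return to the original basis.\<close>

lemma scalar_if_single_eigenvalue:
  assumes "\<And>\<gamma> y. eigenpair A \<gamma> y \<Longrightarrow> \<gamma> = c"
  shows "A = c \<cdot>\<^sub>m 1\<^sub>m n"
proof -
  obtain P Q \<epsilon> where d: "diagonalizes P Q \<epsilon>" by (rule obtain_diagonalization)
  then have P: "P \<in> carrier_mat n n" "Q \<in> carrier_mat n n" "P * Q = 1\<^sub>m n" "Q * P = 1\<^sub>m n" "A * P = P * mat_diag n \<epsilon>"
    unfolding diagonalizes_def by auto
  have [simp]: "dim_row P = n" "dim_col P = n" "dim_row Q = n" "dim_col Q = n" using P by auto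
  have "\<epsilon> i = c" if i: "i < n" for i
  proof -
    have "unit_row n i * Q * (P * unit_col n i) = 1\<^sub>m 1" using family_dual[OF P(1,2,4) i i] by simp
    then have "P * unit_col n i \<noteq> 0\<^sub>m n 1"
      using right_mult_zero_mat[OF unit_products(2)[OF P(1,2), of i], of 1] by (metis index_one_mat(1) index_zero_mat(1) zero_neq_one less_one)
    moreover have "A * (P * unit_col n i) = \<epsilon> i \<cdot>\<^sub>m (P * unit_col n i)" by (rule family_col[OF P(1) A_carrier P(5) i])
    ultimately have "eigenpair A (\<epsilon> i) (P * unit_col n i)"
      unfolding eigenpair_def using unit_products(1)[OF P(1,2)] by simp
    then show ?thesis by (rule assms)
  qed
  then have e: "mat_diag n \<epsilon> = c \<cdot>\<^sub>m 1\<^sub>m n" by (intro eq_matI) auto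
  have "A = (A * P) * Q" using P(3) by (simp add: mat_ring)
  also have "\<dots> = P * (c \<cdot>\<^sub>m Q)" unfolding P(5) e by (simp add: mat_ring smult_mat_mult_left)
  also have "\<dots> = c \<cdot>\<^sub>m 1\<^sub>m n" using P(3) by (simp add: smult_mat_mult_right)
  finally show ?thesis .
qed

end

theorem theorem6p2:
  fixes A :: "('a::{field, finite}) alg_closure mat" and q n m :: nat
  assumes "q = CARD('a)"
    and "n \<ge> 3"
    and "m = 2 * n \<or> (m = 2 * n + 1 \<and> odd q)"
    and "A \<in> carrier (GL_q q n) - group_center (GL_q q n)"
    and "semisimple_mat A"
    and "j_emb n m A \<in> carrier (SO_derived q m)"
    and "q \<in> {3, 5, 7} \<Longrightarrow> \<not> special_situation q n m A"
  shows "collapses (PSO_derived q m) (conj_class (PSO_derived q m) (proj q m (j_emb n m A)))"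
proof -
  interpret frobenius_field q "TYPE('a alg_closure)"
    unfolding assms(1) by (rule frobenius_field_alg_closure)
  have A: "A \<in> carrier_mat n n" "det A \<noteq> 0" "rational A"
    using assms(4) unfolding GL_q_def fixed_points_def rational_frobenius by (simp_all add: carrier_GL)
  obtain Ai where Ai: "Ai \<in> carrier_mat n n" "A * Ai = 1\<^sub>m n" by (rule invertible_obtain[OF A(1,2)])
  interpret semisimple_case q "TYPE('a alg_closure)" n m A Ai
    by unfold_locales (use assms A Ai in auto)
  \<comment> \<open>Scalar matrices commute with everything, so the case of a single eigenvalue
    contradicts the hypothesis that A is not central.\<close>
  have center: "c \<cdot>\<^sub>m 1\<^sub>m n \<in> group_center (GL_q q n)" if "A = c \<cdot>\<^sub>m 1\<^sub>m n" for c
    using assms(4) unfolding that group_center_def GL_q_def fixed_points_def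
    by (auto simp: carrier_GL smult_mat_mult_left smult_mat_mult_right mult_mat_unit_left mult_mat_unit_right)
  show ?thesis
  proof (cases "\<exists>\<alpha> y. eigenpair A \<alpha> y \<and> \<alpha> ^ q \<noteq> \<alpha>")
    case True
    then obtain \<alpha> y where y: "eigenpair A \<alpha> y" "\<alpha> ^ q \<noteq> \<alpha>" by blast
    obtain d V W where d: "d > 0" "\<alpha> ^ (q ^ d) = \<alpha>" "\<And>i. 0 < i \<Longrightarrow> i < d \<Longrightarrow> \<alpha> ^ (q ^ i) \<noteq> \<alpha>"
      and fam: "eigenfamily A n d (\<lambda>a. Suc a mod d) (\<lambda>a. \<alpha> ^ (q ^ a)) V W"
      by (rule orbit_family[OF y(1)]) (rule that)
    have "d \<noteq> 1" using d(2) y(2) by auto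
    show ?thesis
    proof (cases "d \<ge> 3")
      case True
      show ?thesis by (rule collapse_long_orbit[OF True d(2,3) fam])
    next
      case False
      then have d2: "d = 2" using d(1) \<open>d \<noteq> 1\<close> by simp
      note fam = fam[unfolded d2]
      have "\<alpha> ^ (q ^ 2) = (\<alpha> ^ q) ^ q" by (simp add: power2_eq_square power_mult)
      then have qq: "(\<alpha> ^ q) ^ q = \<alpha>" using d(2) unfolding d2 by simp
      show ?thesis
      proof (cases "\<alpha> * \<alpha> ^ q \<noteq> 1 \<or> (\<exists>\<beta> y. eigenpair A \<beta> y \<and> \<beta> \<noteq> \<alpha> \<and> \<beta> \<noteq> \<alpha> ^ q)")
        case True
        show ?thesis by (rule collapse_short_orbit[OF y(2) qq fam True])
      next
        case False
        then show ?thesis by (intro collapse_inverse_pair[OF y(2) qq _ fam]) blast+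
      qed
    qed
  next
    case False
    show ?thesis
    proof (cases "\<exists>a v b w. eigenpair A a v \<and> eigenpair A b w \<and> a \<noteq> b")
      case True
      then obtain a v b w where e: "eigenpair A a v" "eigenpair A b w" "a \<noteq> b" by blast
      then have "a ^ q = a" "b ^ q = b" using False by blast+
      then show ?thesis by (rule collapse_rational_eigenvalues[OF e(1,2) _ _ e(3)])
    next
      case False
      then obtain c where "\<And>\<gamma> y. eigenpair A \<gamma> y \<Longrightarrow> \<gamma> = c" by metis
      then have "A = c \<cdot>\<^sub>m 1\<^sub>m n" by (rule scalar_if_single_eigenvalue)
      then have "A \<in> group_center (GL_q q n)" using center by simp
      then show ?thesis using assms(4) by blast
    qed
  qed
qed

end
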